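(* Let $n\ge3$, let $\Omega\subset\mathbb{R}^n$ be a bounded domain with $0\in\partial\Omega$ satisfying both an interior and an exterior ball condition at $0$, and let $V\in\mathcal{A}(\Omega)$ be a non-negative (not a.e. zero) potential. (a) Let $\lambda\ge0$ and $b(\lambda)>0$ be such that $$\lambda\int_\Omega u^2dx+\int_\Omega|\nabla u|^2dx\ \ge\ \frac{n^2}{4}\int_\Omega\frac{u^2}{|x|^2}dx+b(\lambda)\int_\Omega Vu^2dx,\qquad u\in C_c^\infty(\Omega),\qquad( * )$$ where $b(\lambda)$ is the best (largest) constant. If in addition $b(\lambda)<\mathcal{C}^0(V)$, then $\frac{n^2}{4|x|^2}+b(\lambda)V(x)$ is a maximal potential, that is, inequality $( * )$ cannot be improved by adding a non-negative potential $W$ on the right-hand side: there are no non-negative, not a.e. zero $W\in\mathcal{A}(\Omega)$ and $C>0$ such that $$\lambda\int_\Omega u^2dx+\int_\Omega|\nabla u|^2dx\ \ge\ \frac{n^2}{4}\int_\Omega\frac{u^2}{|x|^2}dx+b(\lambda)\int_\Omega Vu^2dx+C\int_\Omega Wu^2dx,\qquad u\in C_c^\infty(\Omega).$$ (b) If $V$ is a subcritical potential, then there exist $\lambda\ge0$ and a best constant $b(\lambda)>0$ such that $( * )$ is true. Moreover $\frac{n^2}{4|x|^2}+b(\lambda)V(x)$ is a maximal potential (in the sense of (a)).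
   Context: $B_r$ is the open ball of radius $r$ centered at $0$. Interior (exterior) ball condition at $0$: there exists an open ball $B\subset\Omega$ (respectively $B\subset\mathbb{R}^n\setminus\overline\Omega$) with $0\in\partial B$. Admissible potentials: $\mathcal{A}(\Omega)$ is the class of non-negative $V\in L^{n/2}_{\rm loc}(\overline\Omega\setminus\{0\})$ for which there exist $\lambda\ge0$ and $C>0$ such that $\lambda\int_\Omega u^2dx+\int_\Omega|\nabla u|^2dx\ge\frac{n^2}{4}\int_\Omega\frac{u^2}{|x|^2}dx+C\int_\Omega Vu^2dx$ for all $u\in C_c^\infty(\Omega)$. For $V\in\mathcal{A}(\Omega)$ and small $r>0$, $$C_r(V)=\inf_{u\in C_c^\infty(\Omega\cap B_r)}\frac{\lambda\int_{\Omega\cap B_r}u^2dx+\int_{\Omega\cap B_r}|\nabla u|^2dx-\frac{n^2}{4}\int_{\Omega\cap B_r}\frac{u^2}{|x|^2}dx}{\int_{\Omega\cap B_r}Vu^2dx}$$ (infimum over $u$ with non-zero denominator, $+\infty$ if there is none), and $\mathcal{C}^0(V)=\lim_{r\to0+}C_r(V)\in[0,+\infty]$; the limit does not depend on the choice of $\lambda\ge0$. $V\in\mathcal{A}(\Omega)$ is called subcritical if $\mathcal{C}^0(V)=+\infty$. *)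

theory Defs
  imports "HOL-Analysis.Analysis"
begin

text \<open>The space \<open>\<real>\<^sup>n\<close> is an arbitrary Euclidean space of type \<open>'a\<close>, with \<open>n = DIM('a)\<close>.\<close>

definition gradient :: "('a::euclidean_space \<Rightarrow> real) \<Rightarrow> 'a \<Rightarrow> 'a" where
  "gradient u x = (\<Sum>e\<in>Basis. frechet_derivative u (at x) e *\<^sub>R e)"

primrec C_k :: "nat \<Rightarrow> ('a::euclidean_space \<Rightarrow> real) \<Rightarrow> bool" where
  "C_k 0 u \<longleftrightarrow> continuous_on UNIV u"
| "C_k (Suc k) u \<longleftrightarrow> (\<forall>x. u differentiable (at x)) \<and>
     (\<forall>e\<in>Basis. C_k k (\<lambda>x. frechet_derivative u (at x) e))"

text \<open>Test functions on an open set \<open>D\<close> are identified with their extensions by zero.\<close>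

definition test_functions :: "'a::euclidean_space set \<Rightarrow> ('a \<Rightarrow> real) set" where
  "test_functions D = {u. (\<forall>k. C_k k u) \<and>
     compact (closure {x. u x \<noteq> 0}) \<and> closure {x. u x \<noteq> 0} \<subseteq> D}"

definition interior_ball_at_0 :: "'a::euclidean_space set \<Rightarrow> bool" where
  "interior_ball_at_0 \<Omega> \<longleftrightarrow> (\<exists>c r. r > 0 \<and> ball c r \<subseteq> \<Omega> \<and> 0 \<in> frontier (ball c r))"

definition exterior_ball_at_0 :: "'a::euclidean_space set \<Rightarrow> bool" where
  "exterior_ball_at_0 \<Omega> \<longleftrightarrow>
     (\<exists>c r. r > 0 \<and> ball c r \<subseteq> - closure \<Omega> \<and> 0 \<in> frontier (ball c r))"

text \<open>Membership in \<open>L\<^sup>p\<^sub>l\<^sub>o\<^sub>c\<close> of the closure of \<open>\<Omega>\<close> minus the origin: potentials are functions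
  on \<open>\<Omega>\<close>, and integrability is required up to the boundary, away from the origin. Values
  on the boundary, which may have positive measure, play no role.\<close>

definition Lp_loc_off_0 :: "real \<Rightarrow> 'a::euclidean_space set \<Rightarrow> ('a \<Rightarrow> real) \<Rightarrow> bool" where
  "Lp_loc_off_0 p \<Omega> V \<longleftrightarrow> V \<in> borel_measurable (lebesgue_on \<Omega>) \<and>
     (\<forall>K. compact K \<and> K \<subseteq> closure \<Omega> - {0} \<longrightarrow>
        set_integrable lebesgue (K \<inter> \<Omega>) (\<lambda>x. \<bar>V x\<bar> powr p))"

definition energy :: "'a::euclidean_space set \<Rightarrow> real \<Rightarrow> ('a \<Rightarrow> real) \<Rightarrow> real" where
  "energy D l u = l * (LINT x:D|lebesgue. (u x)\<^sup>2) + (LINT x:D|lebesgue. (norm (gradient u x))\<^sup>2)"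

definition hardy_term :: "'a::euclidean_space set \<Rightarrow> ('a \<Rightarrow> real) \<Rightarrow> real" where
  "hardy_term D u = (real DIM('a))\<^sup>2 / 4 * (LINT x:D|lebesgue. (u x)\<^sup>2 / (norm x)\<^sup>2)"

definition potential_term :: "'a::euclidean_space set \<Rightarrow> ('a \<Rightarrow> real) \<Rightarrow> ('a \<Rightarrow> real) \<Rightarrow> real" where
  "potential_term D V u = (LINT x:D|lebesgue. V x * (u x)\<^sup>2)"

definition hardy_ineq :: "'a::euclidean_space set \<Rightarrow> real \<Rightarrow> ('a \<Rightarrow> real) \<Rightarrow> real \<Rightarrow> bool" where
  "hardy_ineq \<Omega> l V b \<longleftrightarrow> (\<forall>u\<in>test_functions \<Omega>.
     energy \<Omega> l u \<ge> hardy_term \<Omega> u + b * potential_term \<Omega> V u)"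

definition best_hardy_constant :: "'a::euclidean_space set \<Rightarrow> real \<Rightarrow> ('a \<Rightarrow> real) \<Rightarrow> real \<Rightarrow> bool" where
  "best_hardy_constant \<Omega> l V b \<longleftrightarrow>
     hardy_ineq \<Omega> l V b \<and> (\<forall>b'. hardy_ineq \<Omega> l V b' \<longrightarrow> b' \<le> b)"

definition admissible :: "'a::euclidean_space set \<Rightarrow> ('a \<Rightarrow> real) \<Rightarrow> bool" where
  "admissible \<Omega> V \<longleftrightarrow> (AE x in lebesgue_on \<Omega>. V x \<ge> 0) \<and>
     Lp_loc_off_0 (real DIM('a) / 2) \<Omega> V \<and>
     (\<exists>l\<ge>0. \<exists>C>0. hardy_ineq \<Omega> l V C)"

definition ae_zero_on :: "'a::euclidean_space set \<Rightarrow> ('a \<Rightarrow> real) \<Rightarrow> bool" where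
  "ae_zero_on \<Omega> V \<longleftrightarrow> (AE x in lebesgue_on \<Omega>. V x = 0)"

text \<open>The infimum of the empty set is \<open>\<infinity>\<close>.\<close>

definition C_r :: "'a::euclidean_space set \<Rightarrow> real \<Rightarrow> ('a \<Rightarrow> real) \<Rightarrow> real \<Rightarrow> ereal" where
  "C_r \<Omega> l V r =
     (INF u\<in>{u \<in> test_functions (\<Omega> \<inter> ball 0 r). potential_term (\<Omega> \<inter> ball 0 r) V u \<noteq> 0}.
        ereal ((energy (\<Omega> \<inter> ball 0 r) l u - hardy_term (\<Omega> \<inter> ball 0 r) u) /
               potential_term (\<Omega> \<inter> ball 0 r) V u))"

text \<open>The auxiliary parameter \<open>l \<ge> 0\<close> is kept explicit; the limit does not depend on it when
  \<open>\<Omega>\<close> satisfies the exterior ball condition at the origin and \<open>V\<close> is admissible.\<close>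

definition C_zero :: "'a::euclidean_space set \<Rightarrow> real \<Rightarrow> ('a \<Rightarrow> real) \<Rightarrow> ereal" where
  "C_zero \<Omega> l V = Lim (at_right 0) (C_r \<Omega> l V)"

definition subcritical :: "'a::euclidean_space set \<Rightarrow> real \<Rightarrow> ('a \<Rightarrow> real) \<Rightarrow> bool" where
  "subcritical \<Omega> l V \<longleftrightarrow> admissible \<Omega> V \<and> C_zero \<Omega> l V = \<infinity>"

definition maximal_potential :: "'a::euclidean_space set \<Rightarrow> real \<Rightarrow> ('a \<Rightarrow> real) \<Rightarrow> real \<Rightarrow> bool" where
  "maximal_potential \<Omega> l V b \<longleftrightarrow>
     \<not> (\<exists>W C. admissible \<Omega> W \<and> \<not> ae_zero_on \<Omega> W \<and> C > 0 \<and>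
          (\<forall>u\<in>test_functions \<Omega>. energy \<Omega> l u \<ge>
             hardy_term \<Omega> u + b * potential_term \<Omega> V u + C * potential_term \<Omega> W u))"

end

theory Submission
  imports Defs "HOL-Computational_Algebra.Polynomial"
begin

text \<open>Write \<open>Q(u)\<close> for the difference of the two sides of the Hardy inequality with the constant \<open>b\<close>. If \<open>b\<close>
is the best constant, then no inequality \<open>Q(u) \<ge> a \<integral>V u\<^sup>2\<close> with \<open>a > 0\<close> can hold. Maximality is
therefore proved by showing that an improvement \<open>Q(u) \<ge> C \<integral>W u\<^sup>2\<close>, for whatever non-trivial \<open>W\<close>,
already forces such an inequality.

Two facts give coercivity up to a lower order term. Close to the origin the assumption
\<open>b < C\<^sup>0(V)\<close> leaves room in \<open>Q\<close>, and the exterior ball provides a Hardy inequality with surplus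
\<open>K \<integral>u\<^sup>2\<close>, with \<open>K\<close> as large as desired on small balls, which absorbs the zero order terms
with \<open>\<lambda>\<close> and \<open>\<mu>\<close> (\<open>hardy_near_boundary_point\<close>, \<open>near_origin_coercivity\<close>). Away
from the origin the potentials are infinitesimally form bounded, by the Sobolev inequality and
\<open>V \<in> L\<^bsup>n/2\<^esup>\<close> (\<open>sobolev_weighted\<close>, \<open>weight_absorbed\<close>). Localising with a partition of unity yields
\<open>\<delta> \<integral>V u\<^sup>2 \<le> Q(u) + N F(u)\<close>, where \<open>F(u)\<close> is the integral of \<open>u\<^sup>2\<close> off a ball centred at
the origin (\<open>coercive_up_to_far_mass\<close>). It remains to bound \<open>F(u)\<close> by a multiple of
\<open>Q(u)\<close> (\<open>far_mass_gap\<close>).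

Otherwise there are test functions \<open>u\<^sub>k \<ge> 0\<close> with \<open>F(u\<^sub>k) = 1\<close> and \<open>Q(u\<^sub>k) \<rightarrow> 0\<close>. The improved
inequality gives \<open>\<integral>W u\<^sub>k\<^sup>2 \<rightarrow> 0\<close>, so that \<open>u\<^sub>k \<rightarrow> 0\<close> in measure on a set of positive measure where
\<open>W\<close> is bounded below. One would expect a limit of the \<open>u\<^sub>k\<close> to be a non-negative supersolution,
and the strong maximum principle to make it vanish. Here this argument is carried out for the sequence
itself: positivity of \<open>Q\<close> at \<open>u\<^sub>k + t \<eta>\<^sup>2 / (u\<^sub>k + \<epsilon>)\<close> bounds the gradient of
\<open>ln (u\<^sub>k + \<epsilon>)\<close> in \<open>L\<^sup>2\<close> locally, uniformly in \<open>\<epsilon>\<close> (\<open>log_gradient_estimate\<close>), and the Poincare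
inequality for this function propagates convergence to zero in measure from any set of positive
measure to a surrounding ball, hence through the connected set \<open>\<Omega>\<close> (\<open>vanishes_on_compact\<close>). By
the Sobolev inequality the \<open>u\<^sub>k\<^sup>2\<close> are uniformly integrable off the ball, so \<open>F(u\<^sub>k) \<rightarrow> 0\<close>, a
contradiction.

Both the Poincare and the Sobolev inequality come from one estimate for \<open>L\<^sup>2\<close> norms of increments
(\<open>double_translation_estimate\<close>). For a subcritical potential, part (b) follows from part (a), since
\<open>C\<^sup>0(V) = \<infinity>\<close> exceeds the best constant, which exists because \<open>V\<close> is not a.e. zero.\<close>

section \<open>Smooth functions and test functions\<close>

lemma gradient_inner:
  assumes "u differentiable (at x)"
  shows "gradient u x \<bullet> h = frechet_derivative u (at x) h"
proof -
  have lin: "linear (frechet_derivative u (at x))"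
    using assms linear_frechet_derivative by blast
  have "frechet_derivative u (at x) h = frechet_derivative u (at x) (\<Sum>e\<in>Basis. (h \<bullet> e) *\<^sub>R e)"
    by (simp add: euclidean_representation)
  also have "\<dots> = (\<Sum>e\<in>Basis. (h \<bullet> e) *\<^sub>R frechet_derivative u (at x) e)"
    using lin by (simp add: linear_sum linear_cmul)
  also have "\<dots> = gradient u x \<bullet> h"
    by (simp add: gradient_def inner_sum_left inner_commute[of h] mult.commute)
  finally show ?thesis by simp
qed

lemma has_derivative_gradient:
  assumes "u differentiable (at x)"
  shows "(u has_derivative (\<lambda>h. gradient u x \<bullet> h)) (at x)"
  using assms frechet_derivative_works[of u "at x"] by (simp add: gradient_inner[OF assms])

lemma gradient_eqI:
  assumes "(u has_derivative (\<lambda>h. G \<bullet> h)) (at x)"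
  shows "gradient u x = G"
proof -
  have "frechet_derivative u (at x) = (\<lambda>h. G \<bullet> h)"
    using assms frechet_derivative_at by metis
  then show ?thesis by (simp add: gradient_def euclidean_representation)
qed

lemma C_k_Suc_D: "C_k (Suc k) u \<Longrightarrow> C_k k u"
proof (induction k arbitrary: u)
  case 0
  then show ?case
    by (auto intro!: continuous_at_imp_continuous_on differentiable_imp_continuous_within)
next
  case (Suc k)
  then show ?case by (metis C_k.simps(2))
qed

lemma C_k_SucI:
  assumes "\<And>x. (u has_derivative (\<lambda>h. G x \<bullet> h)) (at x)"
    and "\<And>e. e \<in> Basis \<Longrightarrow> C_k k (\<lambda>x. G x \<bullet> e)"
  shows "C_k (Suc k) u"
proof -
  have "frechet_derivative u (at x) = (\<lambda>h. G x \<bullet> h)" for x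
    using assms(1)[of x] frechet_derivative_at by metis
  then show ?thesis using assms by (auto simp: differentiable_def)
qed

lemma C_k_SucE:
  assumes "C_k (Suc k) u"
  shows "\<And>x. (u has_derivative (\<lambda>h. gradient u x \<bullet> h)) (at x)"
    and "\<And>e. e \<in> Basis \<Longrightarrow> C_k k (\<lambda>x. gradient u x \<bullet> e)"
proof -
  have d: "u differentiable (at x)" for x using assms by simp
  show "(u has_derivative (\<lambda>h. gradient u x \<bullet> h)) (at x)" for x
    by (rule has_derivative_gradient[OF d])
  show "C_k k (\<lambda>x. gradient u x \<bullet> e)" if "e \<in> Basis" for e
    using assms that by (simp add: gradient_inner[OF d])
qed

lemma C_k_const: "C_k k (\<lambda>x::'a::euclidean_space. c)"
proof (induction k arbitrary: c)
  case (Suc k)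
  show ?case
    by (rule C_k_SucI[where G = "\<lambda>_. 0"]) (auto simp: Suc)
qed simp

lemma C_k_add:
  fixes u v :: "'a::euclidean_space \<Rightarrow> real"
  shows "C_k k u \<Longrightarrow> C_k k v \<Longrightarrow> C_k k (\<lambda>x. u x + v x)"
proof (induction k arbitrary: u v)
  case (Suc k)
  note u = C_k_SucE[OF Suc.prems(1)] and v = C_k_SucE[OF Suc.prems(2)]
  show ?case
    by (rule C_k_SucI[where G = "\<lambda>x. gradient u x + gradient v x"])
      (auto simp: inner_add_left intro!: derivative_eq_intros u v Suc.IH)
qed (auto intro: continuous_intros)

lemma C_k_mult:
  fixes u v :: "'a::euclidean_space \<Rightarrow> real"
  shows "C_k k u \<Longrightarrow> C_k k v \<Longrightarrow> C_k k (\<lambda>x. u x * v x)"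
proof (induction k arbitrary: u v)
  case (Suc k)
  note u = C_k_SucE[OF Suc.prems(1)] and v = C_k_SucE[OF Suc.prems(2)]
  show ?case
  proof (rule C_k_SucI[where G = "\<lambda>x. u x *\<^sub>R gradient v x + v x *\<^sub>R gradient u x"])
    show "((\<lambda>x. u x * v x) has_derivative
        (\<lambda>h. (u x *\<^sub>R gradient v x + v x *\<^sub>R gradient u x) \<bullet> h)) (at x)" for x
      by (auto intro!: derivative_eq_intros u(1) v(1) simp: inner_add_left)
    show "C_k k (\<lambda>x. (u x *\<^sub>R gradient v x + v x *\<^sub>R gradient u x) \<bullet> e)" if "e \<in> Basis" for e
      unfolding inner_add_left inner_scaleR_left
      by (intro C_k_add Suc.IH u(2) v(2) that C_k_Suc_D[OF Suc.prems(1)] C_k_Suc_D[OF Suc.prems(2)])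
  qed
qed (auto intro: continuous_intros)

lemma C_k_inner: "C_k k (\<lambda>x::'a::euclidean_space. x \<bullet> a)"
proof (cases k)
  case (Suc k')
  show ?thesis unfolding Suc
    by (rule C_k_SucI[where G = "\<lambda>_. a"])
      (auto intro!: derivative_eq_intros C_k_const simp: inner_commute)
qed (auto intro!: continuous_intros)

lemma C_k_sum: "finite S \<Longrightarrow> (\<And>i. i \<in> S \<Longrightarrow> C_k k (f i)) \<Longrightarrow> C_k k (\<lambda>x. \<Sum>i\<in>S. f i x)"
  by (induction S rule: finite_induct) (auto intro: C_k_const C_k_add)

lemma C_k_norm_sq: "C_k k (\<lambda>x::'a::euclidean_space. (norm (x - a))\<^sup>2)"
proof -
  have "(\<lambda>x::'a. (norm (x - a))\<^sup>2) = (\<lambda>x. \<Sum>e\<in>Basis. (x \<bullet> e + (- (a \<bullet> e))) * (x \<bullet> e + (- (a \<bullet> e))))"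
    unfolding power2_norm_eq_inner
    by (subst euclidean_inner) (simp add: inner_diff_left)
  then show ?thesis
    by (auto simp del: add_uminus_conv_diff intro!: C_k_sum C_k_mult C_k_add C_k_inner C_k_const)
qed

text \<open>Composition with a function of one real variable needs no bookkeeping of higher
  derivatives when that function lies in a family that is closed under differentiation.\<close>

lemma C_k_compose:
  fixes u :: "'a::euclidean_space \<Rightarrow> real"
  assumes F: "\<And>f. f \<in> F \<Longrightarrow> \<exists>f'\<in>F. \<forall>t\<in>I. (f has_field_derivative f' t) (at t)"
    and I: "\<And>x. u x \<in> I"
  shows "f \<in> F \<Longrightarrow> C_k k u \<Longrightarrow> C_k k (\<lambda>x. f (u x))"
proof (induction k arbitrary: f)
  case 0
  then obtain f' where "\<forall>t\<in>I. (f has_field_derivative f' t) (at t)" using F by blast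
  then have "isCont f (u x)" for x using I DERIV_isCont by blast
  moreover have "isCont u x" for x using 0 by (simp add: continuous_on_eq_continuous_at)
  ultimately have "isCont (\<lambda>x. f (u x)) x" for x by (rule isCont_o2[rotated])
  then show ?case by (simp add: continuous_on_eq_continuous_at)
next
  case (Suc k)
  obtain f' where f': "f' \<in> F" "\<forall>t\<in>I. (f has_field_derivative f' t) (at t)"
    using F Suc.prems by blast
  note u = C_k_SucE[OF Suc.prems(2)]
  show ?case
  proof (rule C_k_SucI[where G = "\<lambda>x. f' (u x) *\<^sub>R gradient u x"])
    show "((\<lambda>x. f (u x)) has_derivative (\<lambda>h. (f' (u x) *\<^sub>R gradient u x) \<bullet> h)) (at x)" for x
      using has_derivative_compose[OF u(1)[of x], of f "\<lambda>h. f' (u x) * h"] f'(2) I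
      by (simp add: has_field_derivative_def)
    show "C_k k (\<lambda>x. (f' (u x) *\<^sub>R gradient u x) \<bullet> e)" if "e \<in> Basis" for e
      unfolding inner_scaleR_left
      by (rule C_k_mult[OF Suc.IH[OF f'(1) C_k_Suc_D[OF Suc.prems(2)]] u(2)[OF that]])
  qed
qed

text \<open>Real powers form a family closed under differentiation on the positive half-line, and
  cover reciprocals and square roots at once.\<close>

lemma C_k_powr:
  fixes u :: "'a::euclidean_space \<Rightarrow> real"
  assumes "C_k k u" "\<And>x. u x > 0"
  shows "C_k k (\<lambda>x. u x powr a)"
proof (rule C_k_compose[where F = "{\<lambda>t::real. c * t powr b |b c. True}" and I = "{0<..}" and f = "\<lambda>t. t powr a"])
  fix f assume "f \<in> {\<lambda>t::real. c * t powr b |b c. True}"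
  then obtain b c where f: "f = (\<lambda>t::real. c * t powr b)" by blast
  show "\<exists>f'\<in>{\<lambda>t::real. c * t powr b |b c. True}. \<forall>t\<in>{0<..}. (f has_field_derivative f' t) (at t)"
    unfolding f
    by (rule bexI[where x = "\<lambda>t. (c * b) * t powr (b - 1)"]) (auto intro!: derivative_eq_intros)
next
  show "(\<lambda>t. t powr a) \<in> {\<lambda>t::real. c * t powr b |b c. True}"
    by (rule CollectI, rule exI[of _ a], rule exI[of _ 1]) auto
qed (use assms in auto)

lemma C_k_inverse:
  fixes u :: "'a::euclidean_space \<Rightarrow> real"
  assumes "C_k k u" "\<And>x. u x > 0"
  shows "C_k k (\<lambda>x. 1 / u x)"
proof -
  have "(\<lambda>x. 1 / u x) = (\<lambda>x. u x powr (-1))"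
  proof
    show "1 / u x = u x powr (-1)" for x
      using assms(2)[of x] by (simp add: powr_minus_divide)
  qed
  then show ?thesis using C_k_powr[OF assms, of "-1"] by argo
qed

lemma C_k_sqrt:
  fixes u :: "'a::euclidean_space \<Rightarrow> real"
  assumes "C_k k u" "\<And>x. u x > 0"
  shows "C_k k (\<lambda>x. sqrt (u x))"
proof -
  have "(\<lambda>x. sqrt (u x)) = (\<lambda>x. u x powr (1/2))"
    using assms(2) by (auto simp: powr_half_sqrt less_imp_le)
  then show ?thesis using C_k_powr[OF assms] by simp
qed

text \<open>The functions \<open>p(1/t) exp (- 1/t)\<close>, extended by zero to \<open>t \<le> 0\<close>. With an arbitrary
  polynomial \<open>p\<close> they are closed under differentiation, as \<open>C_k_compose\<close> requires.\<close>

definition flat_exp :: "real poly \<Rightarrow> real \<Rightarrow> real" where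
  "flat_exp p t = (if t > 0 then poly p (1 / t) * exp (- (1 / t)) else 0)"

lemma poly_times_exp_minus_tendsto_0: "((\<lambda>y. poly p y * exp (- y)) \<longlongrightarrow> (0::real)) at_top"
proof -
  have "((\<lambda>y::real. y ^ k / exp y) \<longlongrightarrow> 0) at_top" for k
    by (rule tendsto_power_div_exp_0)
  then have "((\<lambda>y. \<Sum>i\<le>degree p. coeff p i * (y ^ i / exp y)) \<longlongrightarrow> (\<Sum>i\<le>degree p. coeff p i * 0)) at_top"
    by (intro tendsto_intros)
  moreover have "poly p y * exp (- y) = (\<Sum>i\<le>degree p. coeff p i * (y ^ i / exp y))" for y
    by (simp add: poly_altdef sum_distrib_right exp_minus divide_inverse mult.assoc)
  ultimately show ?thesis by simp
qed

lemma flat_exp_has_derivative: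
  "(flat_exp p has_field_derivative flat_exp (monom 1 2 * (p - pderiv p)) t) (at t)"
proof -
  consider "t > 0" | "t < 0" | "t = 0" by linarith
  then show ?thesis
  proof cases
    case 1
    have "((\<lambda>t. poly p (1 / t) * exp (- (1 / t))) has_field_derivative
        flat_exp (monom 1 2 * (p - pderiv p)) t) (at t)"
      using 1 unfolding flat_exp_def
      by (auto intro!: derivative_eq_intros DERIV_chain2[OF poly_DERIV]
          simp: poly_monom power2_eq_square field_simps)
    then show ?thesis
      by (rule has_field_derivative_transform_within_open[where S = "{0<..}"])
        (use 1 in \<open>auto simp: flat_exp_def\<close>)
  next
    case 2
    have "((\<lambda>t. 0) has_field_derivative flat_exp (monom 1 2 * (p - pderiv p)) t) (at t)"
      using 2 by (simp add: flat_exp_def)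
    then show ?thesis
      by (rule has_field_derivative_transform_within_open[where S = "{..<0}"])
        (use 2 in \<open>auto simp: flat_exp_def\<close>)
  next
    case 3
    have "((\<lambda>h. (flat_exp p h - flat_exp p 0) / h) \<longlongrightarrow> 0) (at 0)"
    proof (rule filterlim_split_at)
      show "((\<lambda>h. (flat_exp p h - flat_exp p 0) / h) \<longlongrightarrow> 0) (at_left 0)"
        by (rule Lim_transform_eventually[OF tendsto_const])
          (auto simp: flat_exp_def eventually_at_filter)
      have "((\<lambda>h. poly (monom 1 1 * p) (inverse h) * exp (- inverse h)) \<longlongrightarrow> (0::real)) (at_right 0)"
        by (rule filterlim_compose[OF poly_times_exp_minus_tendsto_0 filterlim_inverse_at_top_right])
      then show "((\<lambda>h. (flat_exp p h - flat_exp p 0) / h) \<longlongrightarrow> 0) (at_right 0)"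
        by (rule Lim_transform_eventually)
          (auto simp: flat_exp_def eventually_at_filter poly_monom field_simps)
    qed
    then have "(flat_exp p has_field_derivative 0) (at 0)"
      by (simp add: has_field_derivative_iff)
    then show ?thesis using 3 by (simp add: flat_exp_def)
  qed
qed

definition smooth_step :: "real \<Rightarrow> real" where "smooth_step t = flat_exp 1 t"

lemma smooth_step_simps: "t > 0 \<Longrightarrow> smooth_step t > 0" "t \<le> 0 \<Longrightarrow> smooth_step t = 0" "smooth_step t \<ge> 0"
  by (auto simp: smooth_step_def flat_exp_def)

lemma smooth_step_le: "smooth_step t \<le> 1"
  by (auto simp: smooth_step_def flat_exp_def)

lemma smooth_step_mono: "s \<le> t \<Longrightarrow> smooth_step s \<le> smooth_step t"
  by (auto simp: smooth_step_def flat_exp_def frac_le)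

lemma C_k_smooth_step:
  fixes u :: "'a::euclidean_space \<Rightarrow> real"
  assumes "C_k k u"
  shows "C_k k (\<lambda>x. smooth_step (u x))"
  unfolding smooth_step_def
  by (rule C_k_compose[where F = "range flat_exp" and I = UNIV])
    (use assms flat_exp_has_derivative in auto)

abbreviation smooth :: "('a::euclidean_space \<Rightarrow> real) \<Rightarrow> bool" where
  "smooth u \<equiv> \<forall>k. C_k k u"

lemma smooth_has_derivative:
  assumes "smooth u"
  shows "(u has_derivative (\<lambda>h. gradient u x \<bullet> h)) (at x)"
  using C_k_SucE(1) assms by blast

lemma smooth_continuous: "smooth u \<Longrightarrow> continuous_on S u"
  by (metis C_k.simps(1) continuous_on_subset subset_UNIV)

lemma smooth_continuous_gradient:
  assumes "smooth u" shows "continuous_on S (gradient u)"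
proof -
  have "continuous_on UNIV (\<lambda>x. gradient u x \<bullet> e)" if "e \<in> Basis" for e
    using C_k_SucE(2)[of 0 u e] assms that by (metis C_k.simps(1))
  then have "continuous_on UNIV (gradient u)"
    by (subst continuous_on_componentwise) auto
  then show ?thesis using continuous_on_subset by blast
qed

lemma test_functionsI:
  assumes "smooth u" "compact K" "K \<subseteq> D" "\<And>x. x \<notin> K \<Longrightarrow> u x = 0"
  shows "u \<in> test_functions D"
proof -
  have "closure {x. u x \<noteq> 0} \<subseteq> K"
    by (rule closure_minimal) (use assms compact_imp_closed in auto)
  then have "compact (closure {x. u x \<noteq> 0})"
    using assms(2) closed_closure compact_closure compact_imp_bounded bounded_subset closure_subset
    by (metis order_trans)
  then show ?thesis using \<open>closure _ \<subseteq> K\<close> assms by (auto simp: test_functions_def)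
qed

lemma test_functionsE:
  assumes "u \<in> test_functions D"
  obtains K where "smooth u" "compact K" "K \<subseteq> D" "\<And>x. x \<notin> K \<Longrightarrow> u x = 0"
    "\<And>x. x \<notin> K \<Longrightarrow> gradient u x = 0"
proof (rule that[of "closure {x. u x \<noteq> 0}"])
  fix x assume x: "x \<notin> closure {x. u x \<noteq> 0}"
  then show "u x = 0" using closure_subset[of "{x. u x \<noteq> 0}"] by blast
  have "((\<lambda>x. 0) has_derivative (\<lambda>h. 0 \<bullet> h)) (at x)" by simp
  then have "(u has_derivative (\<lambda>h. 0 \<bullet> h)) (at x)"
    by (rule has_derivative_transform_within_open[where s = "- closure {x. u x \<noteq> 0}"])
      (use x closure_subset[of "{x. u x \<noteq> 0}"] in auto)
  then show "gradient u x = 0" by (rule gradient_eqI)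
qed (use assms in \<open>auto simp: test_functions_def\<close>)

lemma test_functions_mono: "D \<subseteq> D' \<Longrightarrow> u \<in> test_functions D \<Longrightarrow> u \<in> test_functions D'"
  by (auto simp: test_functions_def)

lemma test_functions_smooth: "u \<in> test_functions D \<Longrightarrow> smooth u"
  by (auto simp: test_functions_def)

lemma test_functions_mult:
  assumes "u \<in> test_functions D" "smooth v"
  shows "(\<lambda>x. v x * u x) \<in> test_functions D"
proof -
  obtain K where K: "smooth u" "compact K" "K \<subseteq> D" "\<And>x. x \<notin> K \<Longrightarrow> u x = 0"
    using assms(1) by (rule test_functionsE) blast
  show ?thesis
    by (rule test_functionsI[OF _ K(2,3)]) (use K assms in \<open>auto intro: C_k_mult\<close>)
qed

lemma test_functions_add:
  assumes "u \<in> test_functions D" "v \<in> test_functions D"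
  shows "(\<lambda>x. u x + v x) \<in> test_functions D"
proof -
  obtain K where K: "smooth u" "compact K" "K \<subseteq> D" "\<And>x. x \<notin> K \<Longrightarrow> u x = 0"
    using assms(1) by (rule test_functionsE) blast
  obtain L where L: "smooth v" "compact L" "L \<subseteq> D" "\<And>x. x \<notin> L \<Longrightarrow> v x = 0"
    using assms(2) by (rule test_functionsE) blast
  show ?thesis
    by (rule test_functionsI[where K = "K \<union> L"]) (use K L in \<open>auto intro: C_k_add\<close>)
qed

lemma gradient_mult:
  assumes "smooth u" "smooth v"
  shows "gradient (\<lambda>x. u x * v x) x = u x *\<^sub>R gradient v x + v x *\<^sub>R gradient u x"
  by (rule gradient_eqI)
    (auto intro!: derivative_eq_intros smooth_has_derivative assms simp: inner_add_left)

lemma gradient_add: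
  assumes "smooth u" "smooth v"
  shows "gradient (\<lambda>x. u x + v x) x = gradient u x + gradient v x"
  by (rule gradient_eqI)
    (auto intro!: derivative_eq_intros smooth_has_derivative assms simp: inner_add_left)

lemma gradient_cmult:
  assumes "smooth u"
  shows "gradient (\<lambda>x. c * u x) x = c *\<^sub>R gradient u x"
  by (rule gradient_eqI)
    (auto intro!: derivative_eq_intros smooth_has_derivative assms simp: inner_add_left)

section \<open>A translation estimate\<close>

lemma square_increment_le:
  fixes g :: "'a::euclidean_space \<Rightarrow> real"
  assumes g: "\<And>x. (g has_derivative (\<lambda>h. G x \<bullet> h)) (at x)" and G: "continuous_on UNIV G"
  shows "ennreal ((g (x + h) - g x)\<^sup>2) \<le>
    (\<integral>\<^sup>+t. indicator {0..1} t * ennreal ((norm h)\<^sup>2 * (norm (G (x + t *\<^sub>R h)))\<^sup>2) \<partial>lborel)"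
proof -
  define f where "f t = G (x + t *\<^sub>R h) \<bullet> h" for t :: real
  define d where "d = g (x + h) - g x"
  have Gc: "continuous_on {0..1} (\<lambda>t::real. G (x + t *\<^sub>R h))"
    by (rule continuous_on_compose2[OF G]) (auto intro!: continuous_intros)
  have fc: "continuous_on {0..1} f"
    unfolding f_def by (intro continuous_intros Gc)
  have "((\<lambda>t. g (x + t *\<^sub>R h)) has_vector_derivative f t) (at t within {0..1})" for t
  proof -
    have "((\<lambda>t. x + t *\<^sub>R h) has_derivative (\<lambda>s. s *\<^sub>R h)) (at t)"
      by (auto intro!: derivative_eq_intros)
    from has_derivative_compose[OF this g]
    have "((\<lambda>t. g (x + t *\<^sub>R h)) has_derivative (\<lambda>s. s * f t)) (at t)"
      by (simp add: f_def)
    then show ?thesis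
      by (simp add: has_vector_derivative_def has_derivative_at_withinI)
  qed
  from fundamental_theorem_of_calculus[OF _ this]
  have I1: "(f has_integral d) {0..1}" by (simp add: d_def)
  have f2: "(\<lambda>t. (f t)\<^sup>2) integrable_on {0..1}"
    by (intro integrable_continuous_real continuous_intros fc)
  have G2: "(\<lambda>t. (norm h)\<^sup>2 * (norm (G (x + t *\<^sub>R h)))\<^sup>2) integrable_on {0..1::real}"
    by (intro integrable_continuous_real continuous_intros Gc)
  \<comment> \<open>Cauchy-Schwarz on the unit interval, as non-negativity of a variance.\<close>
  have "((\<lambda>t. (f t)\<^sup>2 - (2 * d) * f t + d\<^sup>2) has_integral
      (integral {0..1} (\<lambda>t. (f t)\<^sup>2) - (2 * d) * d + d\<^sup>2)) {0..1}"
    using has_integral_add[OF has_integral_diff[OF integrable_integral[OF f2]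
        has_integral_mult_right[OF I1, of "2 * d"]] has_integral_const_real[of "d\<^sup>2" 0 1]]
    by simp
  moreover have "0 \<le> (f t)\<^sup>2 - (2 * d) * f t + d\<^sup>2" for t
    using zero_le_power2[of "f t - d"] by (simp add: power2_eq_square algebra_simps)
  ultimately have "0 \<le> integral {0..1} (\<lambda>t. (f t)\<^sup>2) - (2 * d) * d + d\<^sup>2"
    by (meson has_integral_nonneg)
  then have "d\<^sup>2 \<le> integral {0..1} (\<lambda>t. (f t)\<^sup>2)" by (simp add: power2_eq_square)
  also have "\<dots> \<le> integral {0..1} (\<lambda>t. (norm h)\<^sup>2 * (norm (G (x + t *\<^sub>R h)))\<^sup>2)"
  proof (rule integral_le[OF f2 G2])
    fix t
    have "\<bar>f t\<bar> \<le> norm h * norm (G (x + t *\<^sub>R h))"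
      unfolding f_def by (metis Cauchy_Schwarz_ineq2 mult.commute)
    then have "\<bar>f t\<bar>\<^sup>2 \<le> (norm h * norm (G (x + t *\<^sub>R h)))\<^sup>2" by (intro power_mono) auto
    then show "(f t)\<^sup>2 \<le> (norm h)\<^sup>2 * (norm (G (x + t *\<^sub>R h)))\<^sup>2" by (simp add: power_mult_distrib)
  qed
  finally have "ennreal (d\<^sup>2) \<le> ennreal (integral {0..1} (\<lambda>t. (norm h)\<^sup>2 * (norm (G (x + t *\<^sub>R h)))\<^sup>2))"
    by (rule ennreal_leI)
  also have "\<dots> = (\<integral>\<^sup>+t. indicator {0..1} t * ennreal ((norm h)\<^sup>2 * (norm (G (x + t *\<^sub>R h)))\<^sup>2) \<partial>lborel)"
    using nn_integral_has_integral_lebesgue'[OF _ integrable_integral[OF G2]]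
    by (simp add: mult.commute)
  finally show ?thesis by (simp add: d_def)
qed

lemma nn_integral_translate:
  fixes f :: "'a::euclidean_space \<Rightarrow> ennreal"
  assumes "f \<in> borel_measurable borel"
  shows "(\<integral>\<^sup>+x. f (c + x) \<partial>lborel) = (\<integral>\<^sup>+x. f x \<partial>lborel)"
  by (subst (2) lborel_distr_plus[of c, symmetric], subst nn_integral_distr) (use assms in auto)

text \<open>The fundamental theorem of calculus along segments; convexity keeps the segment from
  \<open>x\<close> to \<open>x + h\<close> inside \<open>C\<close>.\<close>

lemma translation_estimate:
  fixes g :: "'a::euclidean_space \<Rightarrow> real"
  assumes g: "\<And>x. (g has_derivative (\<lambda>h. G x \<bullet> h)) (at x)" and G: "continuous_on UNIV G"
    and C: "convex C" and [measurable]: "C \<in> sets borel"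
  shows "(\<integral>\<^sup>+x. indicator C x * indicator C (x + h) * ennreal ((g (x + h) - g x)\<^sup>2) \<partial>lborel)
    \<le> ennreal ((norm h)\<^sup>2) * (\<integral>\<^sup>+x. indicator C x * ennreal ((norm (G x))\<^sup>2) \<partial>lborel)"
proof -
  have [measurable]: "G \<in> borel_measurable borel"
    by (rule borel_measurable_continuous_onI[OF G])
  define F where "F x t = indicator {0..1::real} t *
      (indicator C (x + t *\<^sub>R h) * ennreal ((norm h)\<^sup>2 * (norm (G (x + t *\<^sub>R h)))\<^sup>2))" for x t
  have [measurable]: "case_prod F \<in> borel_measurable (lborel \<Otimes>\<^sub>M lborel)"
    unfolding F_def by measurable
  have "indicator C x * indicator C (x + h) * ennreal ((g (x + h) - g x)\<^sup>2) \<le> (\<integral>\<^sup>+t. F x t \<partial>lborel)" for x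
  proof (cases "x \<in> C \<and> x + h \<in> C")
    case True
    have seg: "x + t *\<^sub>R h \<in> C" if "t \<in> {0..1}" for t
    proof -
      have "(1 - t) *\<^sub>R x + t *\<^sub>R (x + h) \<in> C"
        using C True that by (intro convexD) auto
      then show ?thesis by (simp add: algebra_simps)
    qed
    have "ennreal ((g (x + h) - g x)\<^sup>2) \<le>
      (\<integral>\<^sup>+t. indicator {0..1} t * ennreal ((norm h)\<^sup>2 * (norm (G (x + t *\<^sub>R h)))\<^sup>2) \<partial>lborel)"
      by (rule square_increment_le[OF g G])
    also have "\<dots> = (\<integral>\<^sup>+t. F x t \<partial>lborel)"
      by (rule nn_integral_cong) (auto simp: F_def seg split: split_indicator)
    finally show ?thesis using True by simp
  qed (auto split: split_indicator)
  then have "(\<integral>\<^sup>+x. indicator C x * indicator C (x + h) * ennreal ((g (x + h) - g x)\<^sup>2) \<partial>lborel)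
      \<le> (\<integral>\<^sup>+x. (\<integral>\<^sup>+t. F x t \<partial>lborel) \<partial>lborel)"
    by (intro nn_integral_mono) auto
  also have "\<dots> = (\<integral>\<^sup>+t. (\<integral>\<^sup>+x. F x t \<partial>lborel) \<partial>lborel)"
    by (rule lborel_pair.Fubini'[symmetric]) measurable
  also have "\<dots> = (\<integral>\<^sup>+t. indicator {0..1::real} t *
      (ennreal ((norm h)\<^sup>2) * (\<integral>\<^sup>+x. indicator C x * ennreal ((norm (G x))\<^sup>2) \<partial>lborel)) \<partial>lborel)"
  proof (rule nn_integral_cong)
    fix t :: real
    have "(\<integral>\<^sup>+x. indicator C (x + t *\<^sub>R h) * ennreal ((norm h)\<^sup>2 * (norm (G (x + t *\<^sub>R h)))\<^sup>2) \<partial>lborel)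
      = (\<integral>\<^sup>+x. indicator C x * ennreal ((norm h)\<^sup>2 * (norm (G x))\<^sup>2) \<partial>lborel)"
      using nn_integral_translate[of "\<lambda>x. indicator C x * ennreal ((norm h)\<^sup>2 * (norm (G x))\<^sup>2)" "t *\<^sub>R h"]
      by (simp add: add.commute)
    also have "\<dots> = (\<integral>\<^sup>+x. ennreal ((norm h)\<^sup>2) * (indicator C x * ennreal ((norm (G x))\<^sup>2)) \<partial>lborel)"
      by (rule nn_integral_cong) (simp add: ennreal_mult mult_ac)
    also have "\<dots> = ennreal ((norm h)\<^sup>2) * (\<integral>\<^sup>+x. indicator C x * ennreal ((norm (G x))\<^sup>2) \<partial>lborel)"
      by (rule nn_integral_cmult) measurable
    finally show "(\<integral>\<^sup>+x. F x t \<partial>lborel) = indicator {0..1::real} t *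
      (ennreal ((norm h)\<^sup>2) * (\<integral>\<^sup>+x. indicator C x * ennreal ((norm (G x))\<^sup>2) \<partial>lborel))"
      unfolding F_def by (subst nn_integral_cmult) (auto, measurable)
  qed
  also have "\<dots> = ennreal ((norm h)\<^sup>2) * (\<integral>\<^sup>+x. indicator C x * ennreal ((norm (G x))\<^sup>2) \<partial>lborel)"
    by (subst nn_integral_multc) auto
  finally show ?thesis .
qed

text \<open>For \<open>C\<close> a ball this is the Poincare inequality; for \<open>C\<close> the whole space it controls how
  much of a function can change within distance \<open>d\<close>, which is what the Sobolev inequality rests on.\<close>

lemma double_translation_estimate:
  fixes g :: "'a::euclidean_space \<Rightarrow> real"
  assumes g: "\<And>x. (g has_derivative (\<lambda>h. G x \<bullet> h)) (at x)" and G: "continuous_on UNIV G"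
    and C: "convex C" and [measurable]: "C \<in> sets borel"
  shows "(\<integral>\<^sup>+x. \<integral>\<^sup>+y. indicator C x * indicator C y * indicator (cball 0 d) (y - x) *
      ennreal ((g y - g x)\<^sup>2) \<partial>lborel \<partial>lborel)
    \<le> ennreal (d\<^sup>2) * emeasure lborel (cball 0 d :: 'a set) *
      (\<integral>\<^sup>+x. indicator C x * ennreal ((norm (G x))\<^sup>2) \<partial>lborel)"
proof -
  have "continuous_on UNIV g"
    using g has_derivative_continuous by (blast intro: continuous_at_imp_continuous_on)
  then have [measurable]: "g \<in> borel_measurable borel"
    by (rule borel_measurable_continuous_onI)
  have [measurable]: "cball 0 d \<in> sets (borel :: 'a measure)" by simp
  define E where "E = (\<integral>\<^sup>+x. indicator C x * ennreal ((norm (G x))\<^sup>2) \<partial>lborel)"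
  have "(\<integral>\<^sup>+x. \<integral>\<^sup>+y. indicator C x * indicator C y * indicator (cball 0 d) (y - x) *
      ennreal ((g y - g x)\<^sup>2) \<partial>lborel \<partial>lborel)
    = (\<integral>\<^sup>+x. \<integral>\<^sup>+h. indicator (cball 0 d) h * (indicator C x * indicator C (x + h) *
      ennreal ((g (x + h) - g x)\<^sup>2)) \<partial>lborel \<partial>lborel)"
  proof (rule nn_integral_cong)
    fix x :: 'a
    have "(\<integral>\<^sup>+y. indicator C x * indicator C y * indicator (cball 0 d) (y - x) *
      ennreal ((g y - g x)\<^sup>2) \<partial>lborel) =
      (\<integral>\<^sup>+h. indicator C x * indicator C (x + h) * indicator (cball 0 d) ((x + h) - x) *
      ennreal ((g (x + h) - g x)\<^sup>2) \<partial>lborel)"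
      by (rule nn_integral_translate[symmetric]) measurable
    then show "(\<integral>\<^sup>+y. indicator C x * indicator C y * indicator (cball 0 d) (y - x) *
      ennreal ((g y - g x)\<^sup>2) \<partial>lborel) = (\<integral>\<^sup>+h. indicator (cball 0 d) h * (indicator C x * indicator C (x + h) *
      ennreal ((g (x + h) - g x)\<^sup>2)) \<partial>lborel)"
      by (simp add: mult_ac)
  qed
  also have "\<dots> = (\<integral>\<^sup>+h. \<integral>\<^sup>+x. indicator (cball 0 d) h * (indicator C x * indicator C (x + h) *
      ennreal ((g (x + h) - g x)\<^sup>2)) \<partial>lborel \<partial>lborel)"
    by (rule lborel_pair.Fubini'[symmetric]) measurable
  also have "\<dots> \<le> (\<integral>\<^sup>+h. indicator (cball 0 d :: 'a set) h * (ennreal (d\<^sup>2) * E) \<partial>lborel)"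
  proof (rule nn_integral_mono)
    fix h :: 'a
    show "(\<integral>\<^sup>+x. indicator (cball 0 d) h * (indicator C x * indicator C (x + h) *
      ennreal ((g (x + h) - g x)\<^sup>2)) \<partial>lborel) \<le> indicator (cball 0 d) h * (ennreal (d\<^sup>2) * E)"
    proof (cases "h \<in> cball 0 d")
      case True
      then have "ennreal ((norm h)\<^sup>2) \<le> ennreal (d\<^sup>2)"
        by (intro ennreal_leI power_mono) auto
      then have "ennreal ((norm h)\<^sup>2) * E \<le> ennreal (d\<^sup>2) * E" by (rule mult_right_mono) simp
      then show ?thesis
        using translation_estimate[OF g G C, of h] True by (simp add: E_def)
    qed auto
  qed
  also have "\<dots> = ennreal (d\<^sup>2) * emeasure lborel (cball 0 d :: 'a set) * E"
    by (subst nn_integral_multc) (auto simp: mult_ac)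
  finally show ?thesis by (simp add: E_def)
qed

section \<open>A Sobolev inequality in weighted form\<close>

text \<open>A transition function with bounded derivative, so that truncating \<open>g\<close> between the levels
  \<open>t\<close> and \<open>2 t\<close> costs only the energy of \<open>g\<close> on the layer \<open>t < |g| < 2 t\<close>.\<close>

lemma smooth_ramp_exists:
  obtains \<Theta> \<Theta>' :: "real \<Rightarrow> real" and L where
    "\<And>s. (\<Theta> has_field_derivative \<Theta>' s) (at s)" "continuous_on UNIV \<Theta>'"
    "\<And>s. s \<le> 0 \<Longrightarrow> \<Theta> s = 0" "\<And>s. s \<ge> 1 \<Longrightarrow> \<Theta> s = 1"
    "\<And>s. s \<le> 0 \<or> s \<ge> 1 \<Longrightarrow> \<Theta>' s = 0" "\<And>s. \<bar>\<Theta>' s\<bar> \<le> L" "L > 0"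
proof -
  define f where "f = flat_exp 1"
  define f' where "f' = flat_exp (monom 1 2 * (1 - pderiv 1))"
  have d: "(f has_field_derivative f' s) (at s)" for s
    unfolding f_def f'_def by (rule flat_exp_has_derivative)
  have "continuous_on UNIV f'"
    unfolding f'_def using flat_exp_has_derivative DERIV_isCont by (blast intro: continuous_at_imp_continuous_on)
  moreover have "continuous_on UNIV f"
    using d DERIV_isCont by (blast intro: continuous_at_imp_continuous_on)
  ultimately have cont: "continuous_on A (\<lambda>s. f (h s))" "continuous_on A (\<lambda>s. f' (h s))"
    if "continuous_on A h" for A h
    using that continuous_on_compose2 by blast+
  have f0: "f s = 0" "f' s = 0" if "s \<le> 0" for s using that by (auto simp: f_def f'_def flat_exp_def)
  have fpos: "f s > 0" if "s > 0" for s using that by (auto simp: f_def flat_exp_def)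
  have fnn: "f s \<ge> 0" for s by (auto simp: f_def flat_exp_def)
  have den: "f s + f (1 - s) > 0" for s
    using fpos[of s] fpos[of "1 - s"] fnn[of s] fnn[of "1 - s"] by (cases "s > 0") auto
  define \<Theta> where "\<Theta> s = f s / (f s + f (1 - s))" for s
  define \<Theta>' where "\<Theta>' s = (f' s * f (1 - s) + f s * f' (1 - s)) / (f s + f (1 - s))\<^sup>2" for s
  have d1: "((\<lambda>s. f (1 - s)) has_field_derivative - f' (1 - s)) (at s)" for s
  proof -
    have "((\<lambda>s. 1 - s) has_field_derivative - 1) (at s)" by (auto intro!: derivative_eq_intros)
    from DERIV_chain2[OF d this] show ?thesis by simp
  qed
  have "(\<Theta> has_field_derivative \<Theta>' s) (at s)" for s
    unfolding \<Theta>_def[abs_def] \<Theta>'_def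
    by (rule derivative_eq_intros d d1 refl)+
      (use den[of s] in \<open>auto simp: power2_eq_square algebra_simps\<close>)
  moreover have c: "continuous_on UNIV \<Theta>'"
    unfolding \<Theta>'_def using den
    by (intro continuous_intros cont) (auto simp: less_imp_neq[symmetric])
  moreover have out: "\<Theta>' s = 0" if "s \<le> 0 \<or> s \<ge> 1" for s
    using that f0[of s] f0[of "1 - s"] by (auto simp: \<Theta>'_def)
  moreover have "bounded (\<Theta>' ` {0..1})"
    by (intro compact_imp_bounded compact_continuous_image continuous_on_subset[OF c]) auto
  then obtain L where L: "\<And>s. s \<in> {0..1} \<Longrightarrow> \<bar>\<Theta>' s\<bar> \<le> L"
    unfolding bounded_iff by (metis imageI real_norm_def)
  have "\<bar>\<Theta>' s\<bar> \<le> \<bar>L\<bar> + 1" for s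
    using L[of s] out[of s] by (cases "s \<in> {0..1}") auto
  moreover have "\<Theta> s = 0" if "s \<le> 0" for s using that f0 by (simp add: \<Theta>_def)
  moreover have "\<Theta> s = 1" if "s \<ge> 1" for s
    using that f0(1)[of "1 - s"] den[of s] by (simp add: \<Theta>_def)
  ultimately show ?thesis by (intro that[of \<Theta> \<Theta>' "\<bar>L\<bar> + 1"]) auto
qed

definition superlevel :: "('a::euclidean_space \<Rightarrow> real) \<Rightarrow> real \<Rightarrow> 'a set" where
  "superlevel g t = {x. t < \<bar>g x\<bar>}"

definition layer_energy :: "('a::euclidean_space \<Rightarrow> real) \<Rightarrow> real \<Rightarrow> real" where
  "layer_energy g t =
    (\<integral>x. indicator {x. t < \<bar>g x\<bar> \<and> \<bar>g x\<bar> < 2 * t} x * (norm (gradient g x))\<^sup>2 \<partial>lborel)"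

lemma test_function_borel:
  assumes "g \<in> test_functions D"
  shows "g \<in> borel_measurable borel" "gradient g \<in> borel_measurable borel"
  using assms test_functions_smooth
  by (blast intro: borel_measurable_continuous_onI smooth_continuous smooth_continuous_gradient)+

lemma integrable_continuous_compact_support:
  fixes f :: "'a::euclidean_space \<Rightarrow> real"
  assumes "continuous_on K f" "compact K" "\<And>x. x \<notin> K \<Longrightarrow> f x = 0"
  shows "integrable lborel f"
proof -
  have "integrable lborel (\<lambda>x. indicator K x *\<^sub>R f x)"
    by (rule borel_integrable_compact[OF assms(2,1)])
  moreover have "(\<lambda>x. indicator K x *\<^sub>R f x) = f"
    using assms(3) by (auto split: split_indicator)
  ultimately show ?thesis by simp
qed

lemma test_function_integrable:
  assumes "g \<in> test_functions D"
  shows "integrable lborel (\<lambda>x. (g x)\<^sup>2)" "integrable lborel (\<lambda>x. (norm (gradient g x))\<^sup>2)"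
proof -
  obtain K where K: "smooth g" "compact K" "K \<subseteq> D" "\<And>x. x \<notin> K \<Longrightarrow> g x = 0"
    "\<And>x. x \<notin> K \<Longrightarrow> gradient g x = 0"
    using assms by (rule test_functionsE) blast
  show "integrable lborel (\<lambda>x. (g x)\<^sup>2)"
    by (rule integrable_continuous_compact_support[OF _ K(2)])
      (intro continuous_on_power smooth_continuous K(1), simp add: K(4))
  show "integrable lborel (\<lambda>x. (norm (gradient g x))\<^sup>2)"
    by (rule integrable_continuous_compact_support[OF _ K(2)])
      (intro continuous_on_power continuous_on_norm smooth_continuous_gradient K(1), simp add: K(5))
qed

lemma superlevel_props:
  assumes "g \<in> test_functions D" "t > 0"
  shows "superlevel g t \<in> sets borel" "emeasure lborel (superlevel g t) < \<infinity>"
    "superlevel g t \<in> fmeasurable lborel"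
proof -
  obtain K where K: "smooth g" "compact K" "K \<subseteq> D" "\<And>x. x \<notin> K \<Longrightarrow> g x = 0"
    using assms by (elim test_functionsE) blast
  have [measurable]: "g \<in> borel_measurable borel" by (rule test_function_borel[OF assms(1)])
  show *: "superlevel g t \<in> sets borel" unfolding superlevel_def by measurable
  have "superlevel g t \<subseteq> K" using K(4) assms(2) by (force simp: superlevel_def)
  then have "emeasure lborel (superlevel g t) \<le> emeasure lborel K"
    using K(2) by (intro emeasure_mono) (auto simp: compact_imp_closed borel_closed)
  also have "\<dots> < \<infinity>" using K(2) emeasure_compact_finite by blast
  finally show "emeasure lborel (superlevel g t) < \<infinity>" .
  then show "superlevel g t \<in> fmeasurable lborel" using * by (intro fmeasurableI) auto
qed

text \<open>The truncation \<open>v\<close> of \<open>g\<close> is \<open>1\<close> on the higher superlevel set and \<open>0\<close> off the lower one.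
  In a ball of radius \<open>R\<close>, chosen from the measure of the lower set, at least half of the points lie
  off that set, so \<open>v\<close> changes by \<open>1\<close> between a point of the higher set and many points at distance
  at most \<open>R\<close>.\<close>

lemma level_step:
  obtains L :: real where "L > 0"
    "\<And>(g::'a::euclidean_space \<Rightarrow> real) t. g \<in> test_functions UNIV \<Longrightarrow> t > 0 \<Longrightarrow>
      t\<^sup>2 * measure lborel (superlevel g (2 * t)) \<le>
      L * measure lborel (superlevel g t) powr (2 / DIM('a)) * layer_energy g t"
proof -
  obtain \<Theta> \<Theta>' :: "real \<Rightarrow> real" and L where \<Theta>:
    "\<And>s. (\<Theta> has_field_derivative \<Theta>' s) (at s)" "continuous_on UNIV \<Theta>'"
    "\<And>s. s \<le> 0 \<Longrightarrow> \<Theta> s = 0" "\<And>s. s \<ge> 1 \<Longrightarrow> \<Theta> s = 1"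
    "\<And>s. s \<le> 0 \<or> s \<ge> 1 \<Longrightarrow> \<Theta>' s = 0" "\<And>s. \<bar>\<Theta>' s\<bar> \<le> L" "L > 0"
    by (rule smooth_ramp_exists) blast
  define \<omega> where "\<omega> = unit_ball_vol (real DIM('a))"
  have \<omega>: "\<omega> > 0" by (simp add: \<omega>_def)
  have main: "t\<^sup>2 * measure lborel (superlevel g (2 * t)) \<le>
      (4 * L\<^sup>2 * (2 / \<omega>) powr (2 / DIM('a))) * measure lborel (superlevel g t) powr (2 / DIM('a)) * layer_energy g t"
    if g: "g \<in> test_functions UNIV" and t: "t > 0" for g :: "'a \<Rightarrow> real" and t
  proof -
    define a where "a = measure lborel (superlevel g t)"
    define a2 where "a2 = measure lborel (superlevel g (2 * t))"
    note A = superlevel_props[OF g t]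
    have A2: "superlevel g (2 * t) \<in> sets borel" "superlevel g (2 * t) \<in> fmeasurable lborel"
      using superlevel_props[OF g, of "2 * t"] t by auto
    note [measurable] = A(1) A2(1) test_function_borel[OF g]
    have g': "(g has_derivative (\<lambda>h. gradient g x \<bullet> h)) (at x)" for x
      using g test_functions_smooth smooth_has_derivative by blast
    have a2a: "a2 \<le> a"
      unfolding a_def a2_def
      by (rule measure_mono_fmeasurable) (use A A2 t in \<open>auto simp: superlevel_def\<close>)
    define E where "E = layer_energy g t"
    have E0: "E \<ge> 0" unfolding E_def layer_energy_def by (rule integral_nonneg_AE) auto
    show ?thesis
    proof (cases "a = 0")
      case True
      then have "a2 = 0" using a2a by (simp add: a2_def antisym)
      then show ?thesis using True by (simp add: a_def a2_def)
    next
      case False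
      then have a: "a > 0" by (simp add: a_def less_le)
      define n where "n = real DIM('a)"
      have n: "n > 0" by (simp add: n_def)
      \<comment> \<open>A ball of radius \<open>R\<close> has twice the measure of the superlevel set, so that at least half
        of every such ball lies outside of it.\<close>
      define R where "R = (2 * a / \<omega>) powr (1 / n)"
      have R: "R > 0" using a \<omega> by (simp add: R_def)
      have "R ^ DIM('a) = R powr n" using R by (simp add: n_def powr_realpow)
      also have "\<dots> = 2 * a / \<omega>" using a \<omega> n by (simp add: R_def powr_powr)
      finally have ball: "measure lborel (cball x R) = 2 * a" for x :: 'a
        using content_cball[of R x] R \<omega> by (auto simp: \<omega>_def)
      have eball: "emeasure lborel (cball x R) = ennreal (2 * a)" for x :: 'a
        using ball[of x] emeasure_eq_ennreal_measure[of lborel "cball x R"] emeasure_compact_finite[of "cball x R"]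
        by simp
      define c where "c x = ((g x)\<^sup>2 - t\<^sup>2) / (3 * t\<^sup>2)" for x
      define v where "v x = \<Theta> (c x)" for x
      define G where "G x = (\<Theta>' (c x) * (2 * g x / (3 * t\<^sup>2))) *\<^sub>R gradient g x" for x
      have gc: "continuous_on UNIV g" "continuous_on UNIV (gradient g)"
        using g test_functions_smooth smooth_continuous smooth_continuous_gradient by blast+
      have c': "(c has_derivative (\<lambda>h. (2 * g x / (3 * t\<^sup>2)) * (gradient g x \<bullet> h))) (at x)" for x
        unfolding c_def using t by (auto intro!: derivative_eq_intros g' simp: field_simps)
      have v': "(v has_derivative (\<lambda>h. G x \<bullet> h)) (at x)" for x
        unfolding v_def G_def
        using has_derivative_compose[OF c'[of x] \<Theta>(1)[of "c x", unfolded has_field_derivative_def]]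
        by (simp add: mult_ac)
      have Gc: "continuous_on UNIV G"
        unfolding G_def c_def using t
        by (intro continuous_intros gc continuous_on_compose2[OF \<Theta>(2)]) auto
      have v0: "v x = 0" if "x \<notin> superlevel g t" for x
      proof -
        have "(g x)\<^sup>2 \<le> t\<^sup>2" using that t by (simp add: superlevel_def abs_le_square_iff[symmetric])
        then show ?thesis using t \<Theta>(3) by (simp add: v_def c_def divide_nonpos_pos)
      qed
      have v1: "v x = 1" if "x \<in> superlevel g (2 * t)" for x
      proof -
        have "(2 * t)\<^sup>2 \<le> (g x)\<^sup>2"
          unfolding abs_le_square_iff[symmetric] using that t by (simp add: superlevel_def)
        then show ?thesis using t \<Theta>(4) by (simp add: v_def c_def field_simps)
      qed
      have Gb: "(norm (G x))\<^sup>2 \<le> (2 * L\<^sup>2 / t\<^sup>2) *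
          (indicator {x. t < \<bar>g x\<bar> \<and> \<bar>g x\<bar> < 2 * t} x * (norm (gradient g x))\<^sup>2)" for x
      proof (cases "t < \<bar>g x\<bar> \<and> \<bar>g x\<bar> < 2 * t")
        case True
        have "\<bar>\<Theta>' (c x)\<bar>\<^sup>2 \<le> L\<^sup>2" by (intro power_mono \<Theta>(6)) auto
        moreover have "\<bar>g x\<bar>\<^sup>2 \<le> (2 * t)\<^sup>2" by (intro power_mono) (use True in auto)
        ultimately have "(\<Theta>' (c x))\<^sup>2 * (g x)\<^sup>2 \<le> L\<^sup>2 * (2 * t)\<^sup>2" by (intro mult_mono) auto
        then have "(\<Theta>' (c x) * (2 * g x / (3 * t\<^sup>2)))\<^sup>2 \<le> (16 / 9) * (L\<^sup>2 / t\<^sup>2)"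
          using t by (simp add: power_mult_distrib power_divide field_simps power2_eq_square)
        also have "\<dots> \<le> 2 * L\<^sup>2 / t\<^sup>2" using t by (simp add: field_simps)
        finally have "(\<Theta>' (c x) * (2 * g x / (3 * t\<^sup>2)))\<^sup>2 * (norm (gradient g x))\<^sup>2 \<le>
            2 * L\<^sup>2 / t\<^sup>2 * (norm (gradient g x))\<^sup>2" by (rule mult_right_mono) simp
        moreover have "(norm (G x))\<^sup>2 = (\<Theta>' (c x) * (2 * g x / (3 * t\<^sup>2)))\<^sup>2 * (norm (gradient g x))\<^sup>2"
          by (simp only: G_def norm_scaleR power_mult_distrib power2_abs)
        ultimately show ?thesis using True by simp
      next
        case False
        then have "\<not> t < \<bar>g x\<bar> \<or> \<not> \<bar>g x\<bar> < 2 * t" by blast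
        then have "c x \<le> 0 \<or> c x \<ge> 1"
        proof
          assume "\<not> t < \<bar>g x\<bar>"
          then have "(g x)\<^sup>2 \<le> t\<^sup>2" using t by (simp add: abs_le_square_iff[symmetric])
          then show ?thesis using t by (simp add: c_def divide_nonpos_pos)
        next
          assume "\<not> \<bar>g x\<bar> < 2 * t"
          then have "(2 * t)\<^sup>2 \<le> (g x)\<^sup>2"
            unfolding abs_le_square_iff[symmetric] using t by simp
          then show ?thesis using t by (simp add: c_def field_simps)
        qed
        then show ?thesis using False \<Theta>(5) by (auto simp: G_def)
      qed
      have "ennreal (a2 * a) = (\<integral>\<^sup>+x. indicator (superlevel g (2 * t)) x * ennreal a \<partial>lborel)"
        by (subst nn_integral_multc)
          (use A2 a in \<open>auto simp: a2_def ennreal_mult emeasure_eq_measure2\<close>)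
      also have "\<dots> \<le> (\<integral>\<^sup>+x. \<integral>\<^sup>+y. indicator UNIV x * indicator UNIV y *
          indicator (cball 0 R) (y - x) * ennreal ((v y - v x)\<^sup>2) \<partial>lborel \<partial>lborel)"
      proof (rule nn_integral_mono)
        fix x :: 'a
        show "indicator (superlevel g (2 * t)) x * ennreal a \<le> (\<integral>\<^sup>+y. indicator UNIV x * indicator UNIV y *
          indicator (cball 0 R) (y - x) * ennreal ((v y - v x)\<^sup>2) \<partial>lborel)"
        proof (cases "x \<in> superlevel g (2 * t)")
          case True
          have "ennreal a = ennreal (2 * a) - ennreal a" using a by (subst ennreal_minus) auto
          also have "\<dots> = emeasure lborel (cball x R) - emeasure lborel (superlevel g t)"
            using A(3) by (simp add: eball a_def emeasure_eq_measure2)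
          also have "\<dots> \<le> emeasure lborel (cball x R - superlevel g t)"
          proof -
            have "emeasure lborel (cball x R) \<le>
                emeasure lborel (superlevel g t \<union> (cball x R - superlevel g t))"
              by (intro emeasure_mono) auto
            also have "\<dots> \<le> emeasure lborel (superlevel g t) + emeasure lborel (cball x R - superlevel g t)"
              by (rule emeasure_subadditive) auto
            finally show ?thesis by (simp add: ennreal_minus_le_iff eball)
          qed
          also have "\<dots> = (\<integral>\<^sup>+y. indicator (cball x R - superlevel g t) y \<partial>lborel)"
            by simp
          also have "\<dots> \<le> (\<integral>\<^sup>+y. indicator UNIV x * indicator UNIV y *
              indicator (cball 0 R) (y - x) * ennreal ((v y - v x)\<^sup>2) \<partial>lborel)"
            by (rule nn_integral_mono) (use v0 v1[OF True] in \<open>auto simp: dist_norm norm_minus_commute split: split_indicator\<close>)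
          finally show ?thesis using True by simp
        qed auto
      qed
      also have "\<dots> \<le> ennreal (R\<^sup>2) * emeasure lborel (cball 0 R :: 'a set) *
          (\<integral>\<^sup>+x. indicator UNIV x * ennreal ((norm (G x))\<^sup>2) \<partial>lborel)"
        by (rule double_translation_estimate[OF v' Gc]) auto
      also have "\<dots> \<le> ennreal (R\<^sup>2) * ennreal (2 * a) * ennreal (2 * L\<^sup>2 / t\<^sup>2 * E)"
      proof -
        have int: "integrable lborel (\<lambda>x. (2 * L\<^sup>2 / t\<^sup>2) *
          (indicator {x. t < \<bar>g x\<bar> \<and> \<bar>g x\<bar> < 2 * t} x * (norm (gradient g x))\<^sup>2))"
          using integrable_mult_indicator[OF _ test_function_integrable(2)[OF g],
              of "{x. t < \<bar>g x\<bar> \<and> \<bar>g x\<bar> < 2 * t}"] by simp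
        have "(\<integral>\<^sup>+x. indicator UNIV x * ennreal ((norm (G x))\<^sup>2) \<partial>lborel) \<le>
          (\<integral>\<^sup>+x. ennreal ((2 * L\<^sup>2 / t\<^sup>2) *
          (indicator {x. t < \<bar>g x\<bar> \<and> \<bar>g x\<bar> < 2 * t} x * (norm (gradient g x))\<^sup>2)) \<partial>lborel)"
          by (rule nn_integral_mono) (use Gb in \<open>simp only: indicator_UNIV mult_1_left ennreal_leI\<close>)
        also have "\<dots> = ennreal (2 * L\<^sup>2 / t\<^sup>2 * E)"
          by (subst nn_integral_eq_integral[OF int]) (auto simp: E_def layer_energy_def)
        finally show ?thesis by (simp add: eball mult_left_mono)
      qed
      also have "\<dots> = ennreal (R\<^sup>2 * (2 * a) * (2 * L\<^sup>2 / t\<^sup>2 * E))"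
        using a E0 t by (subst (1 2) ennreal_mult) (auto intro!: mult_nonneg_nonneg)
      finally have "a2 * a \<le> R\<^sup>2 * (2 * a) * (2 * L\<^sup>2 / t\<^sup>2 * E)"
        using a E0 by (subst (asm) ennreal_le_iff) (auto intro!: mult_nonneg_nonneg)
      then have "t\<^sup>2 * a2 \<le> 4 * L\<^sup>2 * R\<^sup>2 * E" using a t by (simp add: field_simps)
      also have "R\<^sup>2 = (2 / \<omega>) powr (2 / n) * a powr (2 / n)"
      proof -
        have "R\<^sup>2 = R powr 2" using R by simp
        also have "\<dots> = (2 * a / \<omega>) powr (2 / n)" by (simp add: R_def powr_powr)
        also have "\<dots> = ((2 / \<omega>) * a) powr (2 / n)" by simp
        also have "\<dots> = (2 / \<omega>) powr (2 / n) * a powr (2 / n)" by (rule powr_mult)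
        finally show ?thesis .
      qed
      finally show ?thesis by (simp add: a_def a2_def n_def E_def mult_ac)
    qed
  qed
  show ?thesis
    by (rule that[OF _ main]) (use \<Theta>(7) \<omega> in auto)
qed

text \<open>Put \<open>c(t) = t\<^sup>2 |{|g| > t}|\<^bsup>1 - 2/n\<^esup>\<close> and let \<open>E(t)\<close> be the energy of the layer
  above \<open>t\<close>. In these terms the level estimate is \<open>c(2 t) \<le> L' c(t)\<^bsup>2/n\<^esup> E(t)\<^bsup>1 - 2/n\<^esup>\<close>. The
  exponents add up to one, so \<open>c(2 t) \<le> c(t) / 2 + C E(t)\<close>, which can be summed over dyadic
  levels, because the energies of disjoint layers add up to at most the total energy.\<close>

lemma dyadic_level_sum:
  assumes n3: "DIM('a::euclidean_space) \<ge> 3"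
  obtains C :: real where "C > 0"
    "\<And>(g::'a \<Rightarrow> real) t m. g \<in> test_functions UNIV \<Longrightarrow> t > 0 \<Longrightarrow>
      (\<Sum>j<m. (t * 2 ^ j)\<^sup>2 * measure lborel (superlevel g (t * 2 ^ j)) powr (1 - 2 / DIM('a))) \<le>
      2 * t\<^sup>2 * measure lborel (superlevel g t) powr (1 - 2 / DIM('a)) +
      C * (\<integral>x. (norm (gradient g x))\<^sup>2 \<partial>lborel)"
proof -
  define q where "q = 2 / real DIM('a)"
  define \<theta> where "\<theta> = 1 - q"
  have q: "q > 0" and \<theta>: "\<theta> > 0" using n3 by (auto simp: q_def \<theta>_def)
  obtain L :: real where L: "L > 0"
    "\<And>(g::'a \<Rightarrow> real) t. g \<in> test_functions UNIV \<Longrightarrow> t > 0 \<Longrightarrow>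
      t\<^sup>2 * measure lborel (superlevel g (2 * t)) \<le>
      L * measure lborel (superlevel g t) powr q * layer_energy g t"
    unfolding q_def by (rule level_step) blast
  define C where "C = 4 * L * (8 powr (q / \<theta>))"
  have C: "C > 0" using L by (simp add: C_def)
  have "(\<Sum>j<m. (t * 2 ^ j)\<^sup>2 * measure lborel (superlevel g (t * 2 ^ j)) powr \<theta>) \<le>
      2 * t\<^sup>2 * measure lborel (superlevel g t) powr \<theta> +
      (2 * C) * (\<integral>x. (norm (gradient g x))\<^sup>2 \<partial>lborel)"
    if g: "g \<in> test_functions UNIV" and t: "t > 0" for g :: "'a \<Rightarrow> real" and t m
  proof -
    note [measurable] = test_function_borel[OF g]
    define a where "a j = measure lborel (superlevel g (t * 2 ^ j))" for j :: nat
    define c where "c j = (t * 2 ^ j)\<^sup>2 * a j powr \<theta>" for j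
    define E where "E j = layer_energy g (t * 2 ^ j)" for j :: nat
    define D where "D = (\<integral>x. (norm (gradient g x))\<^sup>2 \<partial>lborel)"
    have c0: "c j \<ge> 0" for j by (simp add: c_def)
    have E0: "E j \<ge> 0" for j unfolding E_def layer_energy_def by (rule integral_nonneg_AE) auto
    have step: "c (Suc j) \<le> c j / 2 + C * E j" for j
    proof (cases "c (Suc j) \<le> c j / 2")
      case True
      then show ?thesis using C E0[of j] by (simp add: add_increasing2)
    next
      case False
      define s where "s = t * 2 ^ j"
      have s: "s > 0" using t by (simp add: s_def)
      have cs: "c j = s\<^sup>2 * a j powr \<theta>" "c (Suc j) = 4 * s\<^sup>2 * a (Suc j) powr \<theta>"
        by (auto simp: c_def s_def power_mult_distrib)
      have aj: "a j \<ge> 0" "a (Suc j) \<ge> 0" by (auto simp: a_def)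
      have lt: "a j powr \<theta> < 8 * a (Suc j) powr \<theta>"
        using False s by (simp add: cs)
      then have pos: "a (Suc j) > 0" using aj by (cases "a (Suc j) = 0") auto
      have "a j powr q = (a j powr \<theta>) powr (q / \<theta>)" using \<theta> by (simp add: powr_powr)
      also have "\<dots> \<le> (8 * a (Suc j) powr \<theta>) powr (q / \<theta>)"
        by (rule powr_mono2) (use lt q \<theta> in auto)
      also have "\<dots> = 8 powr (q / \<theta>) * a (Suc j) powr q"
        using \<theta> by (subst powr_mult) (auto simp: powr_powr)
      finally have aq: "a j powr q \<le> 8 powr (q / \<theta>) * a (Suc j) powr q" .
      have "s\<^sup>2 * a (Suc j) \<le> L * a j powr q * E j"
        using L(2)[OF g s] by (simp add: a_def E_def s_def mult_ac)
      also have "\<dots> \<le> L * (8 powr (q / \<theta>) * a (Suc j) powr q) * E j"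
        using aq L E0 by (intro mult_right_mono mult_left_mono) auto
      finally have "s\<^sup>2 * a (Suc j) \<le> L * (8 powr (q / \<theta>) * a (Suc j) powr q) * E j" .
      moreover have "a (Suc j) powr \<theta> * a (Suc j) powr q = a (Suc j)"
        using pos by (simp add: powr_add[symmetric] \<theta>_def)
      ultimately have "a (Suc j) powr q * (s\<^sup>2 * a (Suc j) powr \<theta>) \<le>
          a (Suc j) powr q * (L * (8 powr (q / \<theta>)) * E j)"
        by (simp add: mult_ac)
      then have "s\<^sup>2 * a (Suc j) powr \<theta> \<le> L * (8 powr (q / \<theta>)) * E j"
        using pos by simp
      then have "c (Suc j) \<le> C * E j" by (simp add: cs C_def)
      then show ?thesis using c0[of j] by simp
    qed
    have sumE: "(\<Sum>j<m. E j) \<le> D" for m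
    proof -
      define I where "I j = {x. t * 2 ^ j < \<bar>g x\<bar> \<and> \<bar>g x\<bar> < 2 * (t * 2 ^ j)}" for j :: nat
      have [measurable]: "I j \<in> sets borel" for j unfolding I_def by measurable
      have int: "integrable lborel (\<lambda>x. indicator (I j) x * (norm (gradient g x))\<^sup>2)" for j
        using integrable_mult_indicator[OF _ test_function_integrable(2)[OF g], of "I j"] by simp
      have disj: "I i \<inter> I j = {}" if "i < j" for i j
      proof -
        have "(2::real) * 2 ^ i \<le> 2 ^ j" using that power_increasing[of "Suc i" j "2::real"] by simp
        then have "2 * (t * 2 ^ i) \<le> t * 2 ^ j" using t by simp
        then show ?thesis unfolding I_def by fastforce
      qed
      have "disjoint_family_on I {..<m}"
        unfolding disjoint_family_on_def by (metis disj Int_commute nat_neq_iff)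
      then have le1: "(\<Sum>j<m. indicator (I j) x :: real) \<le> 1" for x
        by (subst indicator_UN_disjoint[symmetric]) (auto simp: indicator_le_1)
      have "(\<Sum>j<m. E j) = (\<integral>x. (\<Sum>j<m. indicator (I j) x * (norm (gradient g x))\<^sup>2) \<partial>lborel)"
      proof -
        have "E j = (\<integral>x. indicator (I j) x * (norm (gradient g x))\<^sup>2 \<partial>lborel)" for j
          by (simp add: E_def layer_energy_def I_def)
        then show ?thesis by (simp only: Bochner_Integration.integral_sum[OF int])
      qed
      also have "\<dots> \<le> D"
        unfolding D_def
      proof (rule integral_mono)
        show "(\<Sum>j<m. indicator (I j) x * (norm (gradient g x))\<^sup>2) \<le> (norm (gradient g x))\<^sup>2" for x
          using mult_right_mono[OF le1[of x], of "(norm (gradient g x))\<^sup>2"]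
          by (simp add: sum_distrib_right)
        show "integrable lborel (\<lambda>x. \<Sum>j<m. indicator (I j) x * (norm (gradient g x))\<^sup>2)"
          by (rule Bochner_Integration.integrable_sum) (rule int)
      qed (rule test_function_integrable(2)[OF g])
      finally show ?thesis .
    qed
    have "(\<Sum>j<m. c j) \<le> c 0 + (\<Sum>j<m. c j) / 2 + C * (\<Sum>j<m. E j)" for m
    proof (cases m)
      case 0 then show ?thesis using c0 by simp
    next
      case (Suc k)
      have "(\<Sum>j<Suc k. c j) = c 0 + (\<Sum>j<k. c (Suc j))" by (rule sum.lessThan_Suc_shift)
      also have "(\<Sum>j<k. c (Suc j)) \<le> (\<Sum>j<k. c j / 2 + C * E j)" by (intro sum_mono step)
      also have "\<dots> = (\<Sum>j<k. c j) / 2 + C * (\<Sum>j<k. E j)"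
        by (simp add: sum.distrib sum_divide_distrib sum_distrib_left)
      also have "\<dots> \<le> (\<Sum>j<Suc k. c j) / 2 + C * (\<Sum>j<Suc k. E j)"
        using c0[of k] E0[of k] C by (intro add_mono mult_left_mono) auto
      finally show ?thesis using Suc by simp
    qed
    from this[of m] sumE[of m] have "(\<Sum>j<m. c j) \<le> 2 * c 0 + 2 * C * D"
      using C mult_left_mono[OF sumE[of m], of C] by linarith
    then show ?thesis by (simp add: c_def a_def D_def)
  qed
  then show ?thesis
    using that[of "2 * C"] C unfolding \<theta>_def q_def by simp
qed

text \<open>Hoelder's inequality for an indicator function: split \<open>V\<close> at the height \<open>M\<close> that balances
  the two contributions.\<close>

lemma weight_on_set_le:
  assumes V: "V \<in> borel_measurable lebesgue" "\<And>x. V x \<ge> 0"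
    and int: "integrable lebesgue (\<lambda>x. V x powr p)" and p: "p > 1"
    and I: "(\<integral>x. V x powr p \<partial>lebesgue) \<le> I" "I > 0"
    and A: "A \<in> fmeasurable lebesgue"
  shows "integrable lebesgue (\<lambda>x. indicator A x * V x)"
    and "(\<integral>x. indicator A x * V x \<partial>lebesgue) \<le> 2 * I powr (1 / p) * measure lebesgue A powr (1 - 1 / p)"
proof -
  have ptw: "V x \<le> M + V x powr p * M powr (1 - p)" if "M > 0" for x M
  proof (cases "V x \<le> M")
    case False
    then have v: "V x > M" "V x > 0" using that by auto
    have "V x = V x powr p * V x powr (1 - p)" using v by (simp add: powr_add[symmetric])
    also have "\<dots> \<le> V x powr p * M powr (1 - p)"
      using v p that by (intro mult_left_mono powr_mono2') auto
    finally show ?thesis using that by simp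
  qed (simp add: add_increasing2)
  have iA: "integrable lebesgue (indicator A :: 'a \<Rightarrow> real)"
    using A by (intro integrable_real_indicator) (auto simp: fmeasurable_def)
  have bnd: "integrable lebesgue (\<lambda>x. M * indicator A x + M powr (1 - p) * V x powr p)" for M
    using iA int by auto
  have Ms: "A \<in> sets lebesgue" using A by auto
  have le: "indicator A x * V x \<le> M * indicator A x + M powr (1 - p) * V x powr p" if "M > 0" for M x
    using ptw[OF that, of x] by (auto split: split_indicator simp: mult.commute)
  show i: "integrable lebesgue (\<lambda>x. indicator A x * V x)"
    by (rule Bochner_Integration.integrable_bound[OF bnd[of 1]])
      (use V Ms le[of 1] in \<open>auto simp: abs_mult\<close>)
  have mono: "(\<integral>x. indicator A x * V x \<partial>lebesgue) \<le> M * measure lebesgue A + M powr (1 - p) * I" if "M > 0" for M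
  proof -
    have "(\<integral>x. indicator A x * V x \<partial>lebesgue) \<le> (\<integral>x. M * indicator A x + M powr (1 - p) * V x powr p \<partial>lebesgue)"
      by (rule integral_mono[OF i bnd le[OF that]])
    also have "\<dots> = M * measure lebesgue A + M powr (1 - p) * (\<integral>x. V x powr p \<partial>lebesgue)"
      using iA int Ms by (simp add: fmeasurable_def)
    also have "\<dots> \<le> M * measure lebesgue A + M powr (1 - p) * I" using I by (intro add_left_mono mult_left_mono) auto
    finally show ?thesis .
  qed
  show "(\<integral>x. indicator A x * V x \<partial>lebesgue) \<le> 2 * I powr (1 / p) * measure lebesgue A powr (1 - 1 / p)"
  proof (cases "measure lebesgue A = 0")
    case True
    then have "A \<in> null_sets lebesgue" using A
      by (metis completion.complete2 emeasure_eq_measure2 ennreal_0 fmeasurableD null_setsI)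
    then have "AE x in lebesgue. indicator A x * V x = 0"
      by (auto dest!: AE_not_in elim!: eventually_mono)
    then have "(\<integral>x. indicator A x * V x \<partial>lebesgue) = 0"
      by (rule integral_eq_zero_AE)
    then show ?thesis using True by simp
  next
    case False
    define a where "a = measure lebesgue A"
    have a: "a > 0" using False by (simp add: a_def less_le)
    define M where "M = (I / a) powr (1 / p)"
    have M: "M > 0" using a I by (simp add: M_def)
    have "M * a = I powr (1 / p) * a powr (1 - 1 / p)"
      using a I by (simp add: M_def powr_divide powr_diff)
    moreover have "M powr (1 - p) * I = M * a"
    proof -
      have "M powr (1 - p) * I = M * (M powr (- p) * I)"
        using M by (simp add: powr_diff powr_minus_divide)
      also have "M powr (- p) = a / I"
        using a I p by (simp add: M_def powr_powr powr_minus_divide)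
      finally show ?thesis using I by simp
    qed
    ultimately show ?thesis using mono[OF M] by (simp add: a_def)
  qed
qed

lemma dyadic_square_le:
  fixes s t :: real
  assumes t: "t > 0" and s: "\<bar>s\<bar> \<le> t * 2 ^ m"
  shows "s\<^sup>2 \<le> t\<^sup>2 + (\<Sum>j<m. 4 * (t * 2 ^ j)\<^sup>2 * indicator {x. t * 2 ^ j < \<bar>x\<bar>} s)"
  using s
proof (induction m)
  case 0
  then have "\<bar>s\<bar>\<^sup>2 \<le> t\<^sup>2" by (intro power_mono) auto
  then show ?case by simp
next
  case (Suc m)
  show ?case
  proof (cases "\<bar>s\<bar> \<le> t * 2 ^ m")
    case True
    then show ?thesis using Suc.IH by simp
  next
    case False
    have "\<bar>s\<bar>\<^sup>2 \<le> (t * 2 ^ Suc m)\<^sup>2" using Suc.prems by (intro power_mono) auto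
    then have "s\<^sup>2 \<le> 4 * (t * 2 ^ m)\<^sup>2" by (simp add: power_mult_distrib)
    moreover have "(\<Sum>j<m. 4 * (t * 2 ^ j)\<^sup>2 * indicator {x. t * 2 ^ j < \<bar>x\<bar>} s) \<ge> 0"
      by (intro sum_nonneg) auto
    moreover have "indicator {x. t * 2 ^ m < \<bar>x\<bar>} s = (1::real)" using False by simp
    ultimately show ?thesis using zero_le_power2[of t]
      by (simp only: sum.lessThan_Suc mult_1_right)
  qed
qed

text \<open>The dual form of the Sobolev inequality for the exponent \<open>2 n / (n - 2)\<close>, and the
  form in which it is applied. Bounding \<open>g\<^sup>2\<close> by a sum over dyadic levels reduces it to the integrals
  of \<open>V\<close> over superlevel sets; the lowest level \<open>t\<close> tends to zero in the end.\<close>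

theorem sobolev_weighted:
  assumes n3: "DIM('a::euclidean_space) \<ge> 3"
  obtains C :: real where "C > 0"
    "\<And>(g::'a \<Rightarrow> real) V I. g \<in> test_functions UNIV \<Longrightarrow> V \<in> borel_measurable lebesgue \<Longrightarrow>
      (\<And>x. V x \<ge> 0) \<Longrightarrow> integrable lebesgue (\<lambda>x. V x powr (DIM('a) / 2)) \<Longrightarrow>
      (\<integral>x. V x powr (DIM('a) / 2) \<partial>lebesgue) \<le> I \<Longrightarrow> I > 0 \<Longrightarrow>
      integrable lebesgue (\<lambda>x. V x * (g x)\<^sup>2) \<and>
      (\<integral>x. V x * (g x)\<^sup>2 \<partial>lebesgue) \<le>
        C * I powr (2 / DIM('a)) * (\<integral>x. (norm (gradient g x))\<^sup>2 \<partial>lebesgue)"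
proof -
  define p where "p = real DIM('a) / 2"
  have p: "p > 1" using n3 by (simp add: p_def)
  define \<theta> where "\<theta> = 1 - 1 / p"
  have ip: "2 / real DIM('a) = 1 / p" by (simp add: p_def)
  obtain C :: real where C: "C > 0"
    "\<And>(g::'a \<Rightarrow> real) t m. g \<in> test_functions UNIV \<Longrightarrow> t > 0 \<Longrightarrow>
      (\<Sum>j<m. (t * 2 ^ j)\<^sup>2 * measure lborel (superlevel g (t * 2 ^ j)) powr \<theta>) \<le>
      2 * t\<^sup>2 * measure lborel (superlevel g t) powr \<theta> + C * (\<integral>x. (norm (gradient g x))\<^sup>2 \<partial>lborel)"
    unfolding \<theta>_def ip[symmetric] by (rule dyadic_level_sum[OF n3]) blast
  show ?thesis
  proof (rule that[of "8 * C"])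
    show "8 * C > 0" using C by simp
  next
    fix g V :: "'a \<Rightarrow> real" and I
    assume g: "g \<in> test_functions UNIV" and Vm: "V \<in> borel_measurable lebesgue"
      and V0: "\<And>x. V x \<ge> 0"
      and int: "integrable lebesgue (\<lambda>x. V x powr (DIM('a) / 2))"
      and I: "(\<integral>x. V x powr (DIM('a) / 2) \<partial>lebesgue) \<le> I" "I > 0"
    obtain K where K: "smooth g" "compact K" "\<And>x. x \<notin> K \<Longrightarrow> g x = 0"
      using g by (elim test_functionsE) blast
    note W = weight_on_set_le[OF Vm V0, of p I, OF int[folded p_def] p I[folded p_def]]
    have Kf: "K \<in> fmeasurable lebesgue" using K(2) by (rule lmeasurable_compact)
    have "bounded (g ` K)"
      by (intro compact_imp_bounded compact_continuous_image smooth_continuous K)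
    then obtain B where B: "\<And>x. x \<in> K \<Longrightarrow> \<bar>g x\<bar> \<le> B" by (auto simp: bounded_iff)
    have gB: "\<bar>g x\<bar> \<le> \<bar>B\<bar>" for x using B[of x] K(3)[of x] by (cases "x \<in> K") auto
    have gm: "g \<in> borel_measurable lebesgue"
      using test_function_borel(1)[OF g] by (simp add: measurable_completion)
    have i: "integrable lebesgue (\<lambda>x. V x * (g x)\<^sup>2)"
    proof (rule Bochner_Integration.integrable_bound)
      show "integrable lebesgue (\<lambda>x. B\<^sup>2 * (indicator K x * V x))" using W(1)[OF Kf] by simp
      show "AE x in lebesgue. norm (V x * (g x)\<^sup>2) \<le> norm (B\<^sup>2 * (indicator K x * V x))"
      proof (rule AE_I2)
        fix x
        have "(g x)\<^sup>2 \<le> B\<^sup>2" using gB[of x] by (simp add: abs_le_square_iff)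
        then show "norm (V x * (g x)\<^sup>2) \<le> norm (B\<^sup>2 * (indicator K x * V x))"
          using V0[of x] K(3)[of x] by (cases "x \<in> K") (auto simp: abs_mult mult.commute mult_left_mono)
      qed
    qed (use Vm gm in measurable)
    define G where "G = (\<integral>x. (norm (gradient g x))\<^sup>2 \<partial>lebesgue)"
    have GG: "G = (\<integral>x. (norm (gradient g x))\<^sup>2 \<partial>lborel)"
      unfolding G_def using test_function_borel(2)[OF g] by (intro integral_completion) measurable
    define Y where "Y = (\<integral>x. indicator K x * V x \<partial>lebesgue) + 16 * I powr (1 / p) * measure lebesgue K powr \<theta>"
    have bound: "(\<integral>x. V x * (g x)\<^sup>2 \<partial>lebesgue) \<le> t\<^sup>2 * Y + 8 * C * I powr (1 / p) * G" if t: "t > 0" for t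
    proof -
      obtain m where "\<bar>B\<bar> / t < 2 ^ m" using real_arch_pow[of 2 "\<bar>B\<bar> / t"] by auto
      then have m: "\<bar>g x\<bar> \<le> t * 2 ^ m" for x using gB[of x] t by (simp add: field_simps)
      define A where "A j = superlevel g (t * 2 ^ j)" for j :: nat
      have Aj: "A j \<in> sets borel" "A j \<in> fmeasurable lborel" for j
        using superlevel_props[OF g, of "t * 2 ^ j"] t by (auto simp: A_def)
      have Af: "A j \<in> fmeasurable lebesgue" for j
        using Aj(2)[of j] by (simp add: fmeasurable_def)
      have mA: "measure lebesgue (A j) = measure lborel (A j)" for j using Aj by simp
      have ptw: "V x * (g x)\<^sup>2 \<le> t\<^sup>2 * (indicator K x * V x) + (\<Sum>j<m. 4 * (t * 2 ^ j)\<^sup>2 * (indicator (A j) x * V x))" for x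
      proof (cases "x \<in> K")
        case True
        have ind: "indicator (A j) x = (indicator {s. t * 2 ^ j < \<bar>s\<bar>} (g x) :: real)" for j
          by (simp add: A_def superlevel_def indicator_def)
        have "(g x)\<^sup>2 \<le> t\<^sup>2 + (\<Sum>j<m. 4 * (t * 2 ^ j)\<^sup>2 * indicator (A j) x)"
          unfolding ind by (rule dyadic_square_le[OF t m])
        from mult_left_mono[OF this V0[of x]] show ?thesis using True
          by (simp only: indicator_simps distrib_left sum_distrib_left mult_ac mult_1_left mult_1_right)
      next
        case False
        then show ?thesis using K(3) V0 by (auto intro!: sum_nonneg)
      qed
      have "(\<integral>x. V x * (g x)\<^sup>2 \<partial>lebesgue) \<le> (\<integral>x. t\<^sup>2 * (indicator K x * V x) +
          (\<Sum>j<m. 4 * (t * 2 ^ j)\<^sup>2 * (indicator (A j) x * V x)) \<partial>lebesgue)"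
        by (rule integral_mono[OF i _ ptw]) (use W(1)[OF Kf] W(1)[OF Af] in auto)
      also have "\<dots> = t\<^sup>2 * (\<integral>x. indicator K x * V x \<partial>lebesgue) +
          (\<Sum>j<m. 4 * (t * 2 ^ j)\<^sup>2 * (\<integral>x. indicator (A j) x * V x \<partial>lebesgue))"
        using W(1)[OF Kf] W(1)[OF Af] by simp
      also have "\<dots> \<le> t\<^sup>2 * (\<integral>x. indicator K x * V x \<partial>lebesgue) +
          (\<Sum>j<m. 4 * (t * 2 ^ j)\<^sup>2 * (2 * I powr (1 / p) * measure lebesgue (A j) powr \<theta>))"
        using W(2)[OF Af] by (intro add_left_mono sum_mono mult_left_mono) (auto simp: \<theta>_def)
      also have "(\<Sum>j<m. 4 * (t * 2 ^ j)\<^sup>2 * (2 * I powr (1 / p) * measure lebesgue (A j) powr \<theta>)) =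
          8 * I powr (1 / p) * (\<Sum>j<m. (t * 2 ^ j)\<^sup>2 * measure lborel (A j) powr \<theta>)"
        unfolding sum_distrib_left mA by (intro sum.cong) auto
      also have "\<dots> \<le> 8 * I powr (1 / p) * (2 * t\<^sup>2 * measure lborel (superlevel g t) powr \<theta> + C * G)"
        using C(2)[OF g t, of m] by (intro mult_left_mono) (auto simp: A_def GG)
      also have "\<dots> \<le> 8 * I powr (1 / p) * (2 * t\<^sup>2 * measure lebesgue K powr \<theta> + C * G)"
      proof -
        have "measure lebesgue (A 0) \<le> measure lebesgue K"
        proof (rule measure_mono_fmeasurable)
          show "A 0 \<subseteq> K"
          proof
            fix x assume "x \<in> A 0"
            then have "g x \<noteq> 0" using t by (auto simp: A_def superlevel_def)
            then show "x \<in> K" using K(3) by blast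
          qed
        qed (use Kf Af[of 0] in auto)
        then have "measure lborel (superlevel g t) powr \<theta> \<le> measure lebesgue K powr \<theta>"
          using mA[of 0] p by (intro powr_mono2) (auto simp: A_def \<theta>_def)
        then show ?thesis by (intro mult_left_mono add_right_mono) auto
      qed
      finally show ?thesis by (simp add: Y_def algebra_simps)
    qed
    have "(\<integral>x. V x * (g x)\<^sup>2 \<partial>lebesgue) \<le> 8 * C * I powr (1 / p) * G"
    proof (rule tendsto_lowerbound)
      show "((\<lambda>t. t\<^sup>2 * Y + 8 * C * I powr (1 / p) * G) \<longlongrightarrow> 8 * C * I powr (1 / p) * G) (at_right 0)"
        by (auto intro!: tendsto_eq_intros)
      show "\<forall>\<^sub>F t in at_right 0. (\<integral>x. V x * (g x)\<^sup>2 \<partial>lebesgue) \<le> t\<^sup>2 * Y + 8 * C * I powr (1 / p) * G"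
        using bound by (auto simp: eventually_at_filter)
    qed simp
    then show "integrable lebesgue (\<lambda>x. V x * (g x)\<^sup>2) \<and> (\<integral>x. V x * (g x)\<^sup>2 \<partial>lebesgue) \<le>
        8 * C * I powr (2 / DIM('a)) * (\<integral>x. (norm (gradient g x))\<^sup>2 \<partial>lebesgue)"
      using i by (simp add: ip G_def)
  qed
qed

section \<open>The Hardy inequality near a boundary point with an exterior ball\<close>

lemma integral_translate:
  fixes f :: "'a::euclidean_space \<Rightarrow> real"
  assumes "f \<in> borel_measurable borel"
  shows "(\<integral>x. f (c + x) \<partial>lborel) = (\<integral>x. f x \<partial>lborel)"
  by (subst (2) lborel_distr_plus[of c, symmetric], subst integral_distr) (use assms in auto)

lemma integrable_translate:
  fixes f :: "'a::euclidean_space \<Rightarrow> real"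
  assumes "integrable lborel f"
  shows "integrable lborel (\<lambda>x. f (c + x))"
proof -
  have "integrable (distr lborel borel ((+) c)) f" using assms by (simp add: lborel_distr_plus)
  then show ?thesis by (subst (asm) integrable_distr_eq) (use assms in auto)
qed

text \<open>Difference quotients integrate to zero by translation invariance.\<close>

lemma integral_directional_derivative:
  fixes F :: "'a::euclidean_space \<Rightarrow> real"
  assumes F: "\<And>x. (F has_derivative F' x) (at x)" and c: "continuous_on UNIV (\<lambda>x. F' x e)"
    and K: "compact K" "\<And>x. x \<notin> K \<Longrightarrow> F x = 0" "\<And>x. x \<notin> K \<Longrightarrow> F' x e = 0"
  shows "(\<integral>x. F' x e \<partial>lborel) = 0"
proof -
  have Fc: "continuous_on UNIV F"
    using F has_derivative_continuous by (blast intro: continuous_at_imp_continuous_on)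
  have [measurable]: "F \<in> borel_measurable borel" "(\<lambda>x. F' x e) \<in> borel_measurable borel"
    using borel_measurable_continuous_onI Fc c by blast+
  have Fi: "integrable lborel F"
    by (rule integrable_continuous_compact_support[OF continuous_on_subset[OF Fc] K(1,2)]) auto
  define L where "L = {x + y |x y. x \<in> K \<and> y \<in> cball 0 (norm e)}"
  have L: "compact L" unfolding L_def by (rule compact_sums[OF K(1)]) simp
  have KL: "K \<subseteq> L"
  proof
    fix x assume "x \<in> K"
    then have "x = x + 0 \<and> x \<in> K \<and> 0 \<in> cball 0 (norm e)" by simp
    then show "x \<in> L" unfolding L_def by blast
  qed
  have "bounded ((\<lambda>x. F' x e) ` K)"
    by (intro compact_imp_bounded compact_continuous_image continuous_on_subset[OF c] K(1)) auto
  then obtain B where B: "\<And>x. x \<in> K \<Longrightarrow> \<bar>F' x e\<bar> \<le> B"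
    unfolding bounded_iff by (metis imageI real_norm_def)
  have B': "\<bar>F' x e\<bar> \<le> \<bar>B\<bar>" for x using B[of x] K(3)[of x] by (cases "x \<in> K") auto
  have line: "((\<lambda>t. F (x + t *\<^sub>R e)) has_field_derivative F' (x + t *\<^sub>R e) e) (at t)" for x t
  proof -
    have "((\<lambda>t. x + t *\<^sub>R e) has_derivative (\<lambda>s. s *\<^sub>R e)) (at t)"
      by (auto intro!: derivative_eq_intros)
    from has_derivative_compose[OF this F]
    have "((\<lambda>t. F (x + t *\<^sub>R e)) has_derivative (\<lambda>s. F' (x + t *\<^sub>R e) (s *\<^sub>R e))) (at t)" .
    moreover have "F' y (s *\<^sub>R e) = F' y e * s" for y s
      using linear_cmul[OF has_derivative_linear[OF F[of y]], of s e] by (simp add: mult.commute)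
    ultimately show ?thesis by (simp add: has_field_derivative_def)
  qed
  define h where "h i = inverse (real (Suc i))" for i
  have h: "h i > 0" "h i \<le> 1" for i by (auto simp: h_def field_simps)
  define q where "q i x = (F (x + h i *\<^sub>R e) - F x) / h i" for i x
  have "(\<lambda>i. (\<integral>x. q i x \<partial>lborel)) \<longlonglongrightarrow> (\<integral>x. F' x e \<partial>lborel)"
  proof (rule integral_dominated_convergence[where w = "\<lambda>x. \<bar>B\<bar> * indicator L x"])
    show "integrable lborel (\<lambda>x. \<bar>B\<bar> * indicator L x)"
      using L emeasure_compact_finite[OF L] by (auto intro!: integrable_real_indicator borel_compact)
    show "AE x in lborel. (\<lambda>i. q i x) \<longlonglongrightarrow> F' x e"
    proof (rule AE_I2)
      fix x
      have "((\<lambda>t. (F (x + t *\<^sub>R e) - F x) / t) \<longlongrightarrow> F' x e) (at 0)"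
        using line[of x 0] by (simp add: has_field_derivative_iff)
      moreover have "filterlim h (at 0) sequentially"
        unfolding h_def filterlim_at using LIMSEQ_inverse_real_of_nat by auto
      ultimately show "(\<lambda>i. q i x) \<longlonglongrightarrow> F' x e"
        unfolding q_def by (rule filterlim_compose)
    qed
    show "AE x in lborel. norm (q i x) \<le> \<bar>B\<bar> * indicator L x" for i
    proof (rule AE_I2)
      fix x
      show "norm (q i x) \<le> \<bar>B\<bar> * indicator L x"
      proof (cases "x \<in> L")
        case True
        obtain z where "F (x + h i *\<^sub>R e) - F (x + 0 *\<^sub>R e) = (h i - 0) * F' (x + z *\<^sub>R e) e"
          using MVT2[of 0 "h i" "\<lambda>t. F (x + t *\<^sub>R e)" "\<lambda>t. F' (x + t *\<^sub>R e) e"] line h by blast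
        then show ?thesis using B'[of "x + z *\<^sub>R e"] h[of i] True by (simp add: q_def)
      next
        case False
        have "x + h i *\<^sub>R e \<notin> K"
        proof
          assume k: "x + h i *\<^sub>R e \<in> K"
          have "norm (- h i *\<^sub>R e) \<le> norm e"
            using h[of i] by (simp add: mult_left_le_one_le)
          then have "x = (x + h i *\<^sub>R e) + (- h i *\<^sub>R e) \<and> x + h i *\<^sub>R e \<in> K \<and> - h i *\<^sub>R e \<in> cball 0 (norm e)"
            using k by simp
          then show False using False unfolding L_def by blast
        qed
        then show ?thesis using False KL K(2) by (auto simp: q_def)
      qed
    qed
  qed (auto simp: q_def)
  moreover have "(\<integral>x. q i x \<partial>lborel) = 0" for i
  proof -
    have "(\<integral>x. q i x \<partial>lborel) = ((\<integral>x. F (h i *\<^sub>R e + x) \<partial>lborel) - (\<integral>x. F x \<partial>lborel)) / h i"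
      using Fi integrable_translate[OF Fi, of "h i *\<^sub>R e"]
      by (simp add: q_def[abs_def] add.commute)
    then show ?thesis by (simp add: integral_translate)
  qed
  ultimately show ?thesis using LIMSEQ_unique[OF _ tendsto_const] by fastforce
qed

lemma square_le_drift:
  fixes a T :: "'a::euclidean_space"
  shows "2 * w * (a \<bullet> T) - w\<^sup>2 * (norm T)\<^sup>2 \<le> (norm a)\<^sup>2"
proof -
  have "0 \<le> (norm (a - w *\<^sub>R T))\<^sup>2" by simp
  also have "\<dots> = (norm a)\<^sup>2 - 2 * w * (a \<bullet> T) + w\<^sup>2 * (norm T)\<^sup>2"
    unfolding power2_norm_eq_inner
    by (simp add: inner_diff_left inner_diff_right inner_commute power2_eq_square algebra_simps)
  finally show ?thesis by simp
qed

text \<open>If \<open>\<phi> > 0\<close> on \<open>U\<close> then \<open>T = \<nabla> \<phi> / \<phi>\<close> satisfies \<open>div T + |T|\<^sup>2 = \<Delta> \<phi> / \<phi>\<close>, so this is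
  the Hardy inequality with weight \<open>- \<Delta> \<phi> / \<phi>\<close>. It follows from \<open>|\<nabla> w - w T|\<^sup>2 \<ge> 0\<close>, because
  the divergence of \<open>w\<^sup>2 T\<close> integrates to zero.\<close>

lemma hardy_from_drift:
  fixes T :: "'a::euclidean_space \<Rightarrow> 'a"
  assumes U: "open U" and T: "\<And>x. x \<in> U \<Longrightarrow> (T has_derivative T' x) (at x)"
    and T': "\<And>e. e \<in> Basis \<Longrightarrow> continuous_on U (\<lambda>x. T' x e)"
    and p: "continuous_on U p"
    and le: "\<And>x. x \<in> U \<Longrightarrow> p x \<le> - (\<Sum>e\<in>Basis. T' x e \<bullet> e) - (norm (T x))\<^sup>2"
    and w: "w \<in> test_functions U"
  shows "(\<integral>x. p x * (w x)\<^sup>2 \<partial>lborel) \<le> (\<integral>x. (norm (gradient w x))\<^sup>2 \<partial>lborel)"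
proof -
  obtain K where K: "smooth w" "compact K" "K \<subseteq> U" "\<And>x. x \<notin> K \<Longrightarrow> w x = 0"
    "\<And>x. x \<notin> K \<Longrightarrow> gradient w x = 0"
    using w by (rule test_functionsE) blast
  have Tc: "continuous_on U T"
    using T U has_derivative_continuous by (metis continuous_at_imp_continuous_on)
  define D where "D e x = (if x \<in> U then 2 * w x * (gradient w x \<bullet> e) * (T x \<bullet> e) + (w x)\<^sup>2 * (T' x e \<bullet> e) else 0)" for e x
  have cover: "U \<union> - K = UNIV" using K(3) by auto
  have oK: "open (- K)" using K(2) by (simp add: compact_imp_closed open_Compl)
  have DK: "D e x = 0" if "x \<notin> K" for e x using that K by (simp add: D_def)
  have Dc: "continuous_on UNIV (D e)" if e: "e \<in> Basis" for e
    unfolding cover[symmetric]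
  proof (rule continuous_on_open_Un[OF U oK])
    have "continuous_on U (\<lambda>x. 2 * w x * (gradient w x \<bullet> e) * (T x \<bullet> e) + (w x)\<^sup>2 * (T' x e \<bullet> e))"
      using T'[OF e] by (intro continuous_intros Tc smooth_continuous smooth_continuous_gradient K(1))
    then show "continuous_on U (D e)" by (rule continuous_on_eq) (simp add: D_def)
    show "continuous_on (- K) (D e)" by (rule continuous_on_eq[OF continuous_on_const[of _ 0]]) (simp add: DK)
  qed
  have zero: "(\<integral>x. D e x \<partial>lborel) = 0" if e: "e \<in> Basis" for e
  proof -
    define F where "F x = (w x)\<^sup>2 * (T x \<bullet> e)" for x
    define F' where "F' x h = (if x \<in> U then 2 * w x * (gradient w x \<bullet> h) * (T x \<bullet> e) + (w x)\<^sup>2 * (T' x h \<bullet> e) else 0)" for x h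
    have F'D: "F' x e = D e x" for x by (simp add: F'_def D_def)
    have der: "(F has_derivative F' x) (at x)" for x
    proof (cases "x \<in> U")
      case True
      then show ?thesis
        unfolding F_def F'_def
        by (auto intro!: derivative_eq_intros T smooth_has_derivative[OF K(1)])
    next
      case False
      then have x: "x \<in> - K" using K(3) by auto
      have "((\<lambda>x. 0) has_derivative (\<lambda>h. 0)) (at x)" by simp
      then have "(F has_derivative (\<lambda>h. 0)) (at x)"
        by (rule has_derivative_transform_within_open[OF _ oK x]) (simp add: F_def K(4))
      moreover have "F' x = (\<lambda>h. 0)" using False by (simp add: F'_def fun_eq_iff)
      ultimately show ?thesis by simp
    qed
    have "(\<integral>x. F' x e \<partial>lborel) = 0"
      by (rule integral_directional_derivative[OF der _ K(2)])
        (use Dc[OF e] DK K in \<open>auto simp: F'D F_def\<close>)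
    then show ?thesis by (simp add: F'D)
  qed
  have Di: "integrable lborel (D e)" if "e \<in> Basis" for e
    by (rule integrable_continuous_compact_support[OF continuous_on_subset[OF Dc[OF that]] K(2) DK]) auto
  have pi: "integrable lborel (\<lambda>x. p x * (w x)\<^sup>2)"
    by (rule integrable_continuous_compact_support[OF _ K(2)])
      (use K(4) in \<open>auto intro!: continuous_on_mult continuous_on_subset[OF p K(3)] continuous_on_power smooth_continuous[OF K(1)]\<close>)
  have ptw: "p x * (w x)\<^sup>2 + (\<Sum>e\<in>Basis. D e x) \<le> (norm (gradient w x))\<^sup>2" for x
  proof (cases "x \<in> U")
    case True
    have "(\<Sum>e\<in>Basis. D e x) = 2 * w x * (\<Sum>e\<in>Basis. (gradient w x \<bullet> e) * (T x \<bullet> e)) + (w x)\<^sup>2 * (\<Sum>e\<in>Basis. T' x e \<bullet> e)"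
      using True by (simp add: D_def sum.distrib sum_distrib_left mult.assoc)
    also have "(\<Sum>e\<in>Basis. (gradient w x \<bullet> e) * (T x \<bullet> e)) = gradient w x \<bullet> T x"
      by (rule euclidean_inner[symmetric])
    finally have "p x * (w x)\<^sup>2 + (\<Sum>e\<in>Basis. D e x) \<le> 2 * w x * (gradient w x \<bullet> T x) - (w x)\<^sup>2 * (norm (T x))\<^sup>2"
      using mult_left_mono[OF le[OF True], of "(w x)\<^sup>2"] by (simp add: algebra_simps)
    also have "\<dots> \<le> (norm (gradient w x))\<^sup>2" by (rule square_le_drift)
    finally show ?thesis .
  next
    case False
    then have "x \<notin> K" using K(3) by auto
    then show ?thesis by (simp add: K DK)
  qed
  have "(\<integral>x. p x * (w x)\<^sup>2 \<partial>lborel) = (\<integral>x. p x * (w x)\<^sup>2 + (\<Sum>e\<in>Basis. D e x) \<partial>lborel)"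
    using pi Di zero by simp
  also have "\<dots> \<le> (\<integral>x. (norm (gradient w x))\<^sup>2 \<partial>lborel)"
    by (rule integral_mono[OF _ _ ptw]) (use pi Di test_function_integrable(2)[OF w] in auto)
  finally show ?thesis .
qed

text \<open>The elementary estimate for the drift below, with \<open>Y = |\<nabla> s|\<^sup>2\<close>, \<open>i = 1/|x|\<close> and
  \<open>\<sigma> = 1/s\<close>.\<close>

lemma drift_estimate:
  fixes n b s \<rho> A c Y :: real
  assumes "n > 0" "b > 0" "s > 0" "\<rho> > 0" and A: "A = n * b / 2" and c: "c = 2 * n * A + 1"
    and Y: "Y = 1 + 2 * b * s" and s: "s \<le> 2 * \<rho>" "A * s \<le> 1"
    and i: "i = 1 / \<rho>" and \<sigma>: "\<sigma> = 1 / s" and \<kappa>: "\<kappa> = \<sigma> - A" and m: "m = n / 2 * i\<^sup>2 + c * i"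
  shows "n\<^sup>2 / 4 * i\<^sup>2 + i - (c\<^sup>2 + 4 * A * c + A\<^sup>2 + 2 * b * A) \<le>
    - (- \<sigma>\<^sup>2 * Y + \<kappa> * b * n - m * n + (n * i\<^sup>2 + c * i)) -
      (\<kappa>\<^sup>2 * Y - 2 * \<kappa> * m * (s + b / 2 * \<rho>\<^sup>2) + m\<^sup>2 * \<rho>\<^sup>2)"
proof -
  have "A > 0" using assms(1,2) by (simp add: A)
  then have "c > 0" using assms(1) unfolding c by (intro add_pos_pos mult_pos_pos) auto
  have "i > 0" using assms(4) by (simp add: i)
  note pos = \<open>A > 0\<close> \<open>c > 0\<close> \<open>i > 0\<close>
  have ri: "\<rho> * i = 1" and ss: "\<sigma> * s = 1" using assms by auto
  have "A \<le> 1 / s" using s(2) assms(3) by (simp add: pos_le_divide_eq)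
  then have \<kappa>0: "\<kappa> \<ge> 0" by (simp add: \<kappa> \<sigma>)
  have m0: "m \<ge> 0" using pos assms(1) by (simp add: m)
  have e1: "\<sigma>\<^sup>2 * Y - \<kappa>\<^sup>2 * Y = 2 * A * \<sigma> - A\<^sup>2 + 4 * A * b - 2 * b * A\<^sup>2 * s"
  proof -
    have "\<sigma>\<^sup>2 * Y - \<kappa>\<^sup>2 * Y = (2 * A * \<sigma> - A\<^sup>2) * (1 + 2 * b * s)"
      by (simp add: \<kappa> Y power2_eq_square algebra_simps)
    also have "\<dots> = 2 * A * \<sigma> - A\<^sup>2 + 4 * A * b * (\<sigma> * s) - 2 * b * A\<^sup>2 * s"
      by (simp add: algebra_simps)
    finally show ?thesis using ss by simp
  qed
  have e2: "2 * \<kappa> * m * (s + b / 2 * \<rho>\<^sup>2) = 2 * m - 2 * m * A * s + \<kappa> * m * b * \<rho>\<^sup>2"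
  proof -
    have "2 * \<kappa> * m * (s + b / 2 * \<rho>\<^sup>2) = 2 * m * (\<sigma> * s) - 2 * m * A * s + \<kappa> * m * b * \<rho>\<^sup>2"
      by (simp add: \<kappa> algebra_simps)
    then show ?thesis using ss by simp
  qed
  have "m * \<rho> = n / 2 * i * (\<rho> * i) + c * (\<rho> * i)"
    by (simp add: m power2_eq_square algebra_simps)
  then have mr: "m * \<rho> = n / 2 * i + c" by (simp add: ri)
  then have e3: "m\<^sup>2 * \<rho>\<^sup>2 = n\<^sup>2 / 4 * i\<^sup>2 + n * c * i + c\<^sup>2"
    unfolding power_mult_distrib[symmetric] mr by (simp add: power2_eq_square algebra_simps)
  have e4: "\<kappa> * b * n = 2 * A * \<sigma> - A * b * n"
    by (simp add: \<kappa> A algebra_simps)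
  have "m * A * s \<le> m * A * (2 * \<rho>)" using s m0 pos by (intro mult_left_mono) auto
  also have "\<dots> = n * A * i + 2 * A * c"
  proof -
    have "m * A * (2 * \<rho>) = 2 * A * (m * \<rho>)" by simp
    then show ?thesis unfolding mr by (simp add: algebra_simps)
  qed
  finally have b1: "2 * m * A * s \<le> 2 * n * A * i + 4 * A * c" by simp
  have b2: "2 * b * A\<^sup>2 * s \<le> 2 * b * A"
    using mult_left_mono[OF s(2), of "2 * b * A"] assms(2) pos by (simp add: power2_eq_square mult_ac)
  have b3: "\<kappa> * m * b * \<rho>\<^sup>2 \<ge> 0" using \<kappa>0 m0 assms(2) by simp
  have b4: "A * b * n \<ge> 0" "A * b \<ge> 0" using pos assms(1,2) by simp_all
  have "m * n + 2 * m = n\<^sup>2 / 2 * i\<^sup>2 + n * c * i + n * i\<^sup>2 + 2 * c * i"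
    by (simp add: m power2_eq_square algebra_simps)
  moreover have "c * i = 2 * n * A * i + i" by (simp add: c algebra_simps)
  ultimately show ?thesis
    using e1 e2 e3 e4 b1 b2 b3 b4 by linarith
qed

text \<open>The drift is \<open>\<nabla> \<phi> / \<phi>\<close> for \<open>\<phi> = s exp (- A s) |x|\<^bsup>-n/2\<^esup> exp (- c |x|)\<close>, where \<open>s\<close>
  is a multiple of the power of the point \<open>x\<close> with respect to a sphere through the origin, hence
  vanishes on that sphere. On a half-space the function \<open>s |x|\<^bsup>-n/2\<^esup>\<close> with \<open>s\<close> linear is
  exactly critical for the constant \<open>n\<^sup>2/4\<close>; the factor \<open>exp (- A s)\<close> compensates the curvature
  of the sphere, and \<open>exp (- c |x|)\<close> the error of order \<open>1/|x|\<close> that remains, leaving a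
  surplus of \<open>1/|x|\<close> up to a bounded error. The surplus exceeds any given constant on small
  balls.\<close>

lemma hardy_near_boundary_point:
  fixes p :: "'a::euclidean_space"
  assumes p: "p \<noteq> 0"
  obtains r where "r > 0"
    "\<And>w. w \<in> test_functions (ball 0 r \<inter> {x. x \<bullet> p < x \<bullet> x}) \<Longrightarrow>
      (\<integral>x. ((real DIM('a))\<^sup>2 / 4 / (norm x)\<^sup>2 + K) * (w x)\<^sup>2 \<partial>lborel) \<le>
        (\<integral>x. (norm (gradient w x))\<^sup>2 \<partial>lborel)"
proof -
  define n where "n = real DIM('a)"
  define b where "b = 2 / norm p"
  define e where "e = - (p /\<^sub>R norm p)"
  define A where "A = n * b / 2"
  define c where "c = 2 * n * A + 1"
  define K0 where "K0 = c\<^sup>2 + 4 * A * c + A\<^sup>2 + 2 * b * A"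
  have n: "n > 0" and b: "b > 0" using p by (auto simp: n_def b_def)
  have A: "A > 0" using n b by (simp add: A_def)
  have c: "c > 0" using n A unfolding c_def by (intro add_pos_pos mult_pos_pos) auto
  have K0: "K0 \<ge> 0" using A c b by (simp add: K0_def)
  have e: "norm e = 1" "e \<bullet> e = 1" using p by (auto simp: e_def dot_square_norm)
  \<comment> \<open>The three bounds on \<open>r\<close> give \<open>s x \<le> 2 |x|\<close>, \<open>A s x \<le> 1\<close> and \<open>1 / |x| \<ge> K0 + K\<close>.\<close>
  define r where "r = Min {2 / b, 1 / (2 * A), 1 / (K0 + \<bar>K\<bar> + 1)}"
  have r: "r > 0" "r \<le> 2 / b" "r \<le> 1 / (2 * A)" "r \<le> 1 / (K0 + \<bar>K\<bar> + 1)"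
    using A b K0 by (auto simp: r_def)
  define U where "U = ball 0 r \<inter> {x. x \<bullet> p < x \<bullet> x}"
  define s where "s x = x \<bullet> e + b / 2 * (x \<bullet> x)" for x
  define y where "y x = e + b *\<^sub>R x" for x
  define \<kappa> where "\<kappa> x = 1 / s x - A" for x
  define m where "m x = n / 2 * (1 / norm x)\<^sup>2 + c * (1 / norm x)" for x :: 'a
  define T where "T x = \<kappa> x *\<^sub>R y x - m x *\<^sub>R x" for x
  define T' where "T' x h = (- (y x \<bullet> h) / (s x)\<^sup>2) *\<^sub>R y x + (\<kappa> x * b) *\<^sub>R h
      - (m x *\<^sub>R h + (- (n * (1 / norm x) ^ 4 + c * (1 / norm x) ^ 3) * (x \<bullet> h)) *\<^sub>R x)" for x h
  have oU: "open U" unfolding U_def by (intro open_Int open_ball open_Collect_less continuous_intros)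
  have sU: "s x > 0" if "x \<in> U" for x
  proof -
    have "s x = (x \<bullet> x - x \<bullet> p) / norm p"
      using p by (simp add: s_def e_def b_def field_simps)
    then show ?thesis using that p by (simp add: U_def)
  qed
  have x0: "x \<noteq> 0" if "x \<in> U" for x using that by (auto simp: U_def)
  have s': "(s has_derivative (\<lambda>h. y x \<bullet> h)) (at x)" for x
    unfolding s_def y_def
    by (auto intro!: derivative_eq_intros simp: inner_add_left inner_commute algebra_simps)
  have y': "(y has_derivative (\<lambda>h. b *\<^sub>R h)) (at x)" for x
    unfolding y_def by (auto intro!: derivative_eq_intros)
  have \<kappa>': "(\<kappa> has_derivative (\<lambda>h. - (y x \<bullet> h) / (s x)\<^sup>2)) (at x)" if "x \<in> U" for x
    unfolding \<kappa>_def using sU[OF that]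
    by (auto intro!: derivative_eq_intros s' simp: field_simps power2_eq_square)
  have N': "((\<lambda>x. 1 / norm x) has_derivative (\<lambda>h. - ((1 / norm x) ^ 3 * (x \<bullet> h)))) (at x)" if "x \<in> U" for x
  proof -
    have "norm x \<noteq> 0" using x0[OF that] by simp
    from has_derivative_divide'[OF has_derivative_const has_derivative_norm[OF x0[OF that]] this, of 1]
    show ?thesis
      by (rule has_derivative_eq_rhs)
        (use x0[OF that] in \<open>simp add: fun_eq_iff sgn_div_norm field_simps power3_eq_cube inner_commute\<close>)
  qed
  have m': "(m has_derivative (\<lambda>h. - (n * (1 / norm x) ^ 4 + c * (1 / norm x) ^ 3) * (x \<bullet> h))) (at x)" if "x \<in> U" for x
    unfolding m_def
    by (rule derivative_eq_intros N'[OF that] refl)+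
      (simp add: fun_eq_iff algebra_simps power3_eq_cube power4_eq_xxxx)
  have TT: "(T has_derivative T' x) (at x)" if "x \<in> U" for x
    unfolding T_def T'_def
    by (rule derivative_eq_intros y' \<kappa>'[OF that] m'[OF that] refl)+ (simp add: fun_eq_iff algebra_simps)
  have sne: "s x \<noteq> 0" "(s x)\<^sup>2 \<noteq> 0" if "x \<in> U" for x using sU[OF that] by auto
  have sc: "continuous_on U s" unfolding s_def by (intro continuous_intros)
  have T'c: "continuous_on U (\<lambda>x. T' x h)" for h
    unfolding T'_def \<kappa>_def m_def y_def using sne x0
    by (intro continuous_intros sc) auto
  define P where "P x = (real DIM('a))\<^sup>2 / 4 / (norm x)\<^sup>2 + K" for x :: 'a
  have Pc: "continuous_on U P"
    unfolding P_def using x0 by (intro continuous_intros) auto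
  have le: "P x \<le> - (\<Sum>e\<in>Basis. T' x e \<bullet> e) - (norm (T x))\<^sup>2" if x: "x \<in> U" for x
  proof -
    define \<rho> where "\<rho> = norm x"
    define i where "i = 1 / \<rho>"
    have \<rho>: "\<rho> > 0" "\<rho> < r" using x x0[OF x] by (auto simp: \<rho>_def U_def)
    have xx: "x \<bullet> x = \<rho>\<^sup>2" by (simp add: \<rho>_def dot_square_norm)
    have yy: "y x \<bullet> y x = 1 + 2 * b * s x"
      by (simp add: y_def s_def e inner_add_left inner_add_right inner_commute algebra_simps)
    have xy: "x \<bullet> y x = s x + b / 2 * \<rho>\<^sup>2"
      by (simp add: y_def s_def inner_add_right xx)
    have s2: "s x \<le> 2 * \<rho>"
    proof -
      have "x \<bullet> e \<le> \<rho>" using norm_cauchy_schwarz[of x e] by (simp add: e \<rho>_def)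
      moreover have "b * \<rho> \<le> 2"
      proof -
        have "\<rho> \<le> 2 / b" using \<rho> r(2) by simp
        then show ?thesis using b by (simp add: field_simps)
      qed
      then have "b / 2 * \<rho>\<^sup>2 \<le> \<rho>" using \<rho> by (simp add: power2_eq_square)
      ultimately show ?thesis by (simp add: s_def xx)
    qed
    have As: "A * s x \<le> 1"
    proof -
      have "A * s x \<le> A * (2 * \<rho>)" using s2 A by (intro mult_left_mono) auto
      also have "\<dots> \<le> 1"
      proof -
        have "\<rho> \<le> 1 / (2 * A)" using \<rho> r(3) by simp
        then show ?thesis using A by (simp add: field_simps)
      qed
      finally show ?thesis .
    qed
    have tr: "(\<Sum>e\<in>Basis. T' x e \<bullet> e) = - (1 / s x)\<^sup>2 * (1 + 2 * b * s x) + \<kappa> x * b * n - m x * n + (n * i\<^sup>2 + c * i)"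
    proof -
      have "(\<Sum>e\<in>Basis. T' x e \<bullet> e) = (\<Sum>e\<in>Basis. (- 1 / (s x)\<^sup>2) * ((y x \<bullet> e) * (y x \<bullet> e)) +
          (\<kappa> x * b - m x) + (n * i ^ 4 + c * i ^ 3) * ((x \<bullet> e) * (x \<bullet> e)))"
        by (rule sum.cong) (auto simp: T'_def inner_diff_left inner_add_left i_def \<rho>_def algebra_simps)
      also have "\<dots> = (- 1 / (s x)\<^sup>2) * (y x \<bullet> y x) + n * (\<kappa> x * b - m x) + (n * i ^ 4 + c * i ^ 3) * (x \<bullet> x)"
        by (simp only: sum.distrib sum_distrib_left[symmetric] euclidean_inner[symmetric]) (simp add: n_def)
      also have "(n * i ^ 4 + c * i ^ 3) * (x \<bullet> x) = n * i\<^sup>2 + c * i"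
        using \<rho> by (simp add: xx i_def field_simps power2_eq_square power3_eq_cube power4_eq_xxxx)
      finally show ?thesis by (simp add: yy power_divide algebra_simps)
    qed
    have nT: "(norm (T x))\<^sup>2 = (\<kappa> x)\<^sup>2 * (1 + 2 * b * s x) - 2 * \<kappa> x * m x * (s x + b / 2 * \<rho>\<^sup>2) + (m x)\<^sup>2 * \<rho>\<^sup>2"
    proof -
      have "(norm (T x))\<^sup>2 = (\<kappa> x)\<^sup>2 * (y x \<bullet> y x) - 2 * \<kappa> x * m x * (x \<bullet> y x) + (m x)\<^sup>2 * (x \<bullet> x)"
        unfolding T_def power2_norm_eq_inner
        by (simp add: inner_diff_left inner_diff_right inner_commute power2_eq_square algebra_simps)
      then show ?thesis by (simp only: yy xy xx)
    qed
    have "n\<^sup>2 / 4 * i\<^sup>2 + i - K0 \<le> - (\<Sum>e\<in>Basis. T' x e \<bullet> e) - (norm (T x))\<^sup>2"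
      unfolding tr nT K0_def
      by (rule drift_estimate[OF n b sU[OF x] \<rho>(1) A_def c_def refl s2 As i_def refl])
        (auto simp: \<kappa>_def m_def i_def \<rho>_def)
    moreover have "K0 + K \<le> i"
    proof -
      have "\<rho> \<le> 1 / (K0 + \<bar>K\<bar> + 1)" using \<rho> r(4) by simp
      then have "K0 + \<bar>K\<bar> + 1 \<le> i" using \<rho> K0 by (simp add: i_def field_simps)
      then show ?thesis by simp
    qed
    ultimately show ?thesis by (simp add: P_def n_def i_def \<rho>_def power_divide)
  qed
  show ?thesis
  proof (rule that[OF r(1)])
    fix w assume "w \<in> test_functions (ball 0 r \<inter> {x. x \<bullet> p < x \<bullet> x})"
    then have "w \<in> test_functions U" by (simp add: U_def)
    from hardy_from_drift[OF oU TT T'c Pc le this]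
    show "(\<integral>x. ((real DIM('a))\<^sup>2 / 4 / (norm x)\<^sup>2 + K) * (w x)\<^sup>2 \<partial>lborel) \<le>
        (\<integral>x. (norm (gradient w x))\<^sup>2 \<partial>lborel)"
      by (simp add: P_def)
  qed
qed

section \<open>Quadratic forms with locally integrable potentials\<close>

definition local_potential :: "'a::euclidean_space set \<Rightarrow> ('a \<Rightarrow> real) \<Rightarrow> bool" where
  "local_potential \<Omega> q \<longleftrightarrow> q \<in> borel_measurable lebesgue \<and>
     (\<forall>K. compact K \<and> K \<subseteq> \<Omega> \<longrightarrow> integrable lebesgue (\<lambda>x. indicator K x * q x))"

definition qform :: "('a::euclidean_space \<Rightarrow> real) \<Rightarrow> ('a \<Rightarrow> real) \<Rightarrow> real" where
  "qform q u = (\<integral>x. (norm (gradient u x))\<^sup>2 + q x * (u x)\<^sup>2 \<partial>lebesgue)"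

lemma borel_lebesgue: "f \<in> borel_measurable borel \<Longrightarrow> f \<in> borel_measurable lebesgue"
  by (simp add: measurable_completion)

lemma integrable_lborel_lebesgue:
  fixes f :: "'a::euclidean_space \<Rightarrow> real"
  shows "integrable lborel f \<Longrightarrow> integrable lebesgue f"
  by (subst integrable_completion) (auto dest: borel_measurable_integrable)

lemma integral_lborel_lebesgue:
  fixes f :: "'a::euclidean_space \<Rightarrow> real"
  shows "f \<in> borel_measurable borel \<Longrightarrow> (\<integral>x. f x \<partial>lebesgue) = (\<integral>x. f x \<partial>lborel)"
  by (rule integral_completion) simp

lemma test_integrable:
  assumes "u \<in> test_functions \<Omega>"
  shows "integrable lebesgue (\<lambda>x. (u x)\<^sup>2)" "integrable lebesgue (\<lambda>x. (norm (gradient u x))\<^sup>2)"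
  using test_function_integrable[OF assms] by (auto intro: integrable_lborel_lebesgue)

lemma integrable_potential_times:
  assumes q: "local_potential \<Omega> q" and f: "continuous_on UNIV f"
    and K: "compact K" "K \<subseteq> \<Omega>" "\<And>x. x \<notin> K \<Longrightarrow> f x = 0"
  shows "integrable lebesgue (\<lambda>x. q x * f x)"
proof -
  have "bounded (f ` K)"
    by (intro compact_imp_bounded compact_continuous_image continuous_on_subset[OF f] K(1)) auto
  then obtain B where B: "\<And>x. x \<in> K \<Longrightarrow> \<bar>f x\<bar> \<le> B"
    unfolding bounded_iff by (metis imageI real_norm_def)
  have fm: "f \<in> borel_measurable lebesgue"
    using borel_lebesgue borel_measurable_continuous_onI[OF f] by blast
  have i: "integrable lebesgue (\<lambda>x. indicator K x * q x)" and qm: "q \<in> borel_measurable lebesgue"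
    using q K by (auto simp: local_potential_def)
  show ?thesis
  proof (rule Bochner_Integration.integrable_bound)
    show "integrable lebesgue (\<lambda>x. \<bar>B\<bar> * (indicator K x * q x))" using i by simp
    show "AE x in lebesgue. norm (q x * f x) \<le> norm (\<bar>B\<bar> * (indicator K x * q x))"
    proof (rule AE_I2)
      fix x
      show "norm (q x * f x) \<le> norm (\<bar>B\<bar> * (indicator K x * q x))"
      proof (cases "x \<in> K")
        case True
        then have "\<bar>q x\<bar> * \<bar>f x\<bar> \<le> \<bar>q x\<bar> * \<bar>B\<bar>" using B[OF True] by (intro mult_left_mono) auto
        then show ?thesis using True by (simp add: abs_mult mult.commute)
      qed (simp add: K(3))
    qed
  qed (use qm fm in measurable)
qed

lemma integrable_potential_square:
  assumes "local_potential \<Omega> q" "u \<in> test_functions \<Omega>"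
  shows "integrable lebesgue (\<lambda>x. q x * (u x)\<^sup>2)"
proof -
  obtain K where K: "smooth u" "compact K" "K \<subseteq> \<Omega>" "\<And>x. x \<notin> K \<Longrightarrow> u x = 0"
    using assms(2) by (rule test_functionsE) blast
  show ?thesis
    by (rule integrable_potential_times[OF assms(1) _ K(2,3)])
      (intro continuous_on_power smooth_continuous K(1), simp add: K(4))
qed

lemma integrable_qform:
  assumes "local_potential \<Omega> q" "u \<in> test_functions \<Omega>"
  shows "integrable lebesgue (\<lambda>x. (norm (gradient u x))\<^sup>2 + q x * (u x)\<^sup>2)"
  using integrable_potential_square[OF assms] test_integrable[OF assms(2)] by simp

lemma qform_split:
  assumes "local_potential \<Omega> q" "u \<in> test_functions \<Omega>"
  shows "qform q u = (\<integral>x. (norm (gradient u x))\<^sup>2 \<partial>lebesgue) + (\<integral>x. q x * (u x)\<^sup>2 \<partial>lebesgue)"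
  unfolding qform_def using integrable_potential_square[OF assms] test_integrable[OF assms(2)] by simp

lemma qform_le_upper_bound:
  assumes q: "local_potential \<Omega> q" and le: "\<And>x. q x \<le> l" and u: "u \<in> test_functions \<Omega>"
  shows "qform q u \<le> (\<integral>x. (norm (gradient u x))\<^sup>2 \<partial>lebesgue) + l * (\<integral>x. (u x)\<^sup>2 \<partial>lebesgue)"
proof -
  have "(\<integral>x. q x * (u x)\<^sup>2 \<partial>lebesgue) \<le> (\<integral>x. l * (u x)\<^sup>2 \<partial>lebesgue)"
    using integrable_potential_square[OF q u] test_integrable[OF u]
    by (intro integral_mono) (auto intro: mult_right_mono le)
  then show ?thesis by (simp add: qform_split[OF q u])
qed

section \<open>Near-minimisers of a critical form\<close>

text \<open>The weak Harnack idea: testing with \<open>\<psi> = \<eta>\<^sup>2 / (u + \<epsilon>)\<close> bounds the gradient of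
  \<open>ln (u + \<epsilon>)\<close>. Since \<open>u\<close> is not a solution, the Euler-Lagrange identity is replaced by
  positivity of the form at \<open>u + t \<psi>\<close>.\<close>

lemma log_gradient_estimate:
  fixes q u :: "'a::euclidean_space \<Rightarrow> real"
  assumes q: "local_potential \<Omega> q" and le: "\<And>x. q x \<le> l" and l: "l \<ge> 0"
    and pos: "\<And>v. v \<in> test_functions \<Omega> \<Longrightarrow> qform q v \<ge> 0"
    and u: "u \<in> test_functions \<Omega>" "\<And>x. u x \<ge> 0"
    and \<eta>: "\<eta> \<in> test_functions \<Omega>" "\<And>x. \<bar>\<eta> x\<bar> \<le> 1" and \<epsilon>: "\<epsilon> > 0" and t: "t > 0"
  shows "integrable lebesgue (\<lambda>x. (\<eta> x)\<^sup>2 * (norm (gradient u x))\<^sup>2 / (u x + \<epsilon>)\<^sup>2)"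
    and "(\<integral>x. (\<eta> x)\<^sup>2 * (norm (gradient u x))\<^sup>2 / (u x + \<epsilon>)\<^sup>2 \<partial>lebesgue) \<le>
      4 * (\<integral>x. (norm (gradient \<eta> x))\<^sup>2 \<partial>lebesgue) + 2 * l * (\<integral>x. (\<eta> x)\<^sup>2 \<partial>lebesgue) + qform q u / t +
      t * (8 / \<epsilon>\<^sup>2 * (\<integral>x. (norm (gradient \<eta> x))\<^sup>2 \<partial>lebesgue) + l / \<epsilon>\<^sup>2 * (\<integral>x. (\<eta> x)\<^sup>2 \<partial>lebesgue) +
        2 / \<epsilon>^4 * (\<integral>x. (\<eta> x)\<^sup>2 * (norm (gradient u x))\<^sup>2 \<partial>lebesgue))"
proof -
  have su: "smooth u" and s\<eta>: "smooth \<eta>" using u \<eta> test_functions_smooth by blast+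
  have up: "u x + \<epsilon> > 0" for x using u(2)[of x] \<epsilon> by simp
  define \<psi> where "\<psi> x = (\<eta> x * (1 / (u x + \<epsilon>))) * \<eta> x" for x
  have sr: "smooth (\<lambda>x. 1 / (u x + \<epsilon>))"
    using su up by (auto intro!: C_k_inverse C_k_add C_k_const)
  have \<psi>: "\<psi> \<in> test_functions \<Omega>"
    unfolding \<psi>_def using C_k_mult s\<eta> sr by (intro test_functions_mult \<eta>(1)) blast
  have \<psi>eq: "\<psi> x = (\<eta> x)\<^sup>2 / (u x + \<epsilon>)" for x by (simp add: \<psi>_def power2_eq_square)
  have G\<psi>: "gradient \<psi> x = (2 * \<eta> x / (u x + \<epsilon>)) *\<^sub>R gradient \<eta> x - ((\<eta> x)\<^sup>2 / (u x + \<epsilon>)\<^sup>2) *\<^sub>R gradient u x" for x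
  proof (rule gradient_eqI)
    show "(\<psi> has_derivative (\<lambda>h. ((2 * \<eta> x / (u x + \<epsilon>)) *\<^sub>R gradient \<eta> x - ((\<eta> x)\<^sup>2 / (u x + \<epsilon>)\<^sup>2) *\<^sub>R gradient u x) \<bullet> h)) (at x)"
      unfolding \<psi>eq[abs_def]
    proof (rule has_derivative_eq_rhs)
      have d1: "((\<lambda>x. (\<eta> x)\<^sup>2) has_derivative (\<lambda>h. 2 * \<eta> x * (gradient \<eta> x \<bullet> h))) (at x)"
        by (auto intro!: derivative_eq_intros smooth_has_derivative[OF s\<eta>])
      have d2: "((\<lambda>x. u x + \<epsilon>) has_derivative (\<lambda>h. gradient u x \<bullet> h)) (at x)"
        by (auto intro!: derivative_eq_intros smooth_has_derivative[OF su])
      have ne: "u x + \<epsilon> \<noteq> 0" using up[of x] by simp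
      show "((\<lambda>x. (\<eta> x)\<^sup>2 / (u x + \<epsilon>)) has_derivative (\<lambda>h. (2 * \<eta> x * (gradient \<eta> x \<bullet> h) * (u x + \<epsilon>) -
          (\<eta> x)\<^sup>2 * (gradient u x \<bullet> h)) / ((u x + \<epsilon>) * (u x + \<epsilon>)))) (at x)"
        by (rule has_derivative_divide'[OF d1 d2 ne])
      have alg: "(2 * a * b * d - a\<^sup>2 * c) / (d * d) = (2 * a / d) * b - (a\<^sup>2 / d\<^sup>2) * c" if "d \<noteq> 0" for a b c d :: real
        using that by (simp add: field_simps power2_eq_square)
      show "(\<lambda>h. (2 * \<eta> x * (gradient \<eta> x \<bullet> h) * (u x + \<epsilon>) -
          (\<eta> x)\<^sup>2 * (gradient u x \<bullet> h)) / ((u x + \<epsilon>) * (u x + \<epsilon>))) =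
          (\<lambda>h. ((2 * \<eta> x / (u x + \<epsilon>)) *\<^sub>R gradient \<eta> x - ((\<eta> x)\<^sup>2 / (u x + \<epsilon>)\<^sup>2) *\<^sub>R gradient u x) \<bullet> h)"
        by (simp only: alg[OF ne] inner_diff_left inner_scaleR_left)
    qed
  qed
  obtain K where K: "compact K" "K \<subseteq> \<Omega>" "\<And>x. x \<notin> K \<Longrightarrow> \<eta> x = 0"
    using \<eta>(1) by (rule test_functionsE) blast
  have i1: "integrable lebesgue (\<lambda>x. (\<eta> x)\<^sup>2 * (norm (gradient u x))\<^sup>2 / (u x + \<epsilon>)\<^sup>2)"
  proof (intro integrable_lborel_lebesgue integrable_continuous_compact_support[OF _ K(1)])
    show "continuous_on K (\<lambda>x. (\<eta> x)\<^sup>2 * (norm (gradient u x))\<^sup>2 / (u x + \<epsilon>)\<^sup>2)"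
      using up by (intro continuous_intros smooth_continuous smooth_continuous_gradient su s\<eta>)
        (auto simp: less_imp_neq[symmetric])
  qed (simp add: K)
  have i2: "integrable lebesgue (\<lambda>x. (\<eta> x)\<^sup>2 * (norm (gradient u x))\<^sup>2)"
    by (intro integrable_lborel_lebesgue integrable_continuous_compact_support[OF _ K(1)]
       continuous_intros smooth_continuous smooth_continuous_gradient su s\<eta>) (simp add: K)
  note iu = integrable_qform[OF q u(1)] and i\<psi> = integrable_qform[OF q \<psi>] and i\<eta> = test_integrable[OF \<eta>(1)]
  define N where "N = (\<integral>x. (norm (gradient \<eta> x))\<^sup>2 \<partial>lebesgue)"
  define M where "M = (\<integral>x. (\<eta> x)\<^sup>2 \<partial>lebesgue)"
  define J where "J = (\<integral>x. (\<eta> x)\<^sup>2 * (norm (gradient u x))\<^sup>2 / (u x + \<epsilon>)\<^sup>2 \<partial>lebesgue)"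
  define R where "R = (\<integral>x. (\<eta> x)\<^sup>2 * (norm (gradient u x))\<^sup>2 \<partial>lebesgue)"
  have t\<psi>: "(\<lambda>x. t * \<psi> x) \<in> test_functions \<Omega>"
    by (rule test_functions_mult[OF \<psi>]) (auto intro: C_k_const)
  have v: "(\<lambda>x. u x + t * \<psi> x) \<in> test_functions \<Omega>"
    by (rule test_functions_add[OF u(1) t\<psi>])
  have Gv: "gradient (\<lambda>x. u x + t * \<psi> x) x = gradient u x + t *\<^sub>R gradient \<psi> x" for x
    using gradient_add[OF su test_functions_smooth[OF t\<psi>]] gradient_cmult[OF test_functions_smooth[OF \<psi>]] by simp
  have ptw: "(norm (gradient (\<lambda>x. u x + t * \<psi> x) x))\<^sup>2 + q x * (u x + t * \<psi> x)\<^sup>2 \<le>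
      ((norm (gradient u x))\<^sup>2 + q x * (u x)\<^sup>2) +
      t * (4 * (norm (gradient \<eta> x))\<^sup>2 + 2 * l * (\<eta> x)\<^sup>2 - (\<eta> x)\<^sup>2 * (norm (gradient u x))\<^sup>2 / (u x + \<epsilon>)\<^sup>2) +
      t\<^sup>2 * ((norm (gradient \<psi> x))\<^sup>2 + q x * (\<psi> x)\<^sup>2)" for x
  proof -
    define a where "a = (\<eta> x / (u x + \<epsilon>)) *\<^sub>R gradient u x"
    have na: "(norm a)\<^sup>2 = (\<eta> x)\<^sup>2 * (norm (gradient u x))\<^sup>2 / (u x + \<epsilon>)\<^sup>2"
      by (simp add: a_def power_mult_distrib power_divide)
    have "gradient u x \<bullet> gradient \<psi> x = 2 * (gradient \<eta> x \<bullet> a) - (norm a)\<^sup>2"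
      unfolding na using up[of x]
      by (simp add: G\<psi> a_def inner_diff_right inner_commute dot_square_norm power2_eq_square)
    moreover have "2 * (gradient \<eta> x \<bullet> a) \<le> (norm a)\<^sup>2 / 2 + 2 * (norm (gradient \<eta> x))\<^sup>2"
    proof -
      have "0 \<le> (norm (a - 2 *\<^sub>R gradient \<eta> x))\<^sup>2" by simp
      then show ?thesis
        unfolding power2_norm_eq_inner by (simp add: inner_diff_left inner_diff_right inner_commute)
    qed
    ultimately have g: "gradient u x \<bullet> gradient \<psi> x \<le> 2 * (norm (gradient \<eta> x))\<^sup>2 - (norm a)\<^sup>2 / 2" by simp
    have "u x * \<psi> x \<le> (\<eta> x)\<^sup>2"
      using up[of x] u(2)[of x] \<epsilon> by (simp add: \<psi>eq field_simps)
    moreover have "u x * \<psi> x \<ge> 0" using up[of x] u(2)[of x] by (simp add: \<psi>eq)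
    ultimately have "q x * (u x * \<psi> x) \<le> l * (\<eta> x)\<^sup>2"
      using mult_right_mono[OF le[of x], of "u x * \<psi> x"] mult_left_mono[OF _ l, of "u x * \<psi> x" "(\<eta> x)\<^sup>2"] by linarith
    with g have "2 * t * (gradient u x \<bullet> gradient \<psi> x + q x * (u x * \<psi> x)) \<le>
        2 * t * (2 * (norm (gradient \<eta> x))\<^sup>2 - (norm a)\<^sup>2 / 2 + l * (\<eta> x)\<^sup>2)"
      using t by (intro mult_left_mono) auto
    moreover have "(norm (gradient u x + t *\<^sub>R gradient \<psi> x))\<^sup>2 =
        (norm (gradient u x))\<^sup>2 + 2 * t * (gradient u x \<bullet> gradient \<psi> x) + t\<^sup>2 * (norm (gradient \<psi> x))\<^sup>2"
      unfolding power2_norm_eq_inner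
      by (simp add: inner_add_left inner_add_right inner_commute power2_eq_square algebra_simps)
    moreover have "q x * (u x + t * \<psi> x)\<^sup>2 = q x * (u x)\<^sup>2 + 2 * t * (q x * (u x * \<psi> x)) + t\<^sup>2 * (q x * (\<psi> x)\<^sup>2)"
      by (simp add: power2_eq_square algebra_simps)
    ultimately show ?thesis unfolding Gv na[symmetric] by (simp add: algebra_simps)
  qed
  have "0 \<le> qform q (\<lambda>x. u x + t * \<psi> x)" by (rule pos[OF v])
  also have "\<dots> \<le> (\<integral>x. ((norm (gradient u x))\<^sup>2 + q x * (u x)\<^sup>2) +
      t * (4 * (norm (gradient \<eta> x))\<^sup>2 + 2 * l * (\<eta> x)\<^sup>2 - (\<eta> x)\<^sup>2 * (norm (gradient u x))\<^sup>2 / (u x + \<epsilon>)\<^sup>2) +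
      t\<^sup>2 * ((norm (gradient \<psi> x))\<^sup>2 + q x * (\<psi> x)\<^sup>2) \<partial>lebesgue)"
    unfolding qform_def
    by (rule integral_mono[OF integrable_qform[OF q v] _ ptw])
      (intro Bochner_Integration.integrable_add Bochner_Integration.integrable_diff integrable_mult_right iu i\<psi> i\<eta> i1)
  also have "\<dots> = qform q u + t * (4 * N + 2 * l * M - J) + t\<^sup>2 * qform q \<psi>"
  proof -
    have "(\<integral>x. f1 x + t * (4 * f2 x + 2 * l * f3 x - f4 x) + t\<^sup>2 * f5 x \<partial>lebesgue) =
      (\<integral>x. f1 x \<partial>lebesgue) + t * (4 * (\<integral>x. f2 x \<partial>lebesgue) + 2 * l * (\<integral>x. f3 x \<partial>lebesgue) - (\<integral>x. f4 x \<partial>lebesgue)) +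
      t\<^sup>2 * (\<integral>x. f5 x \<partial>lebesgue)"
      if "integrable lebesgue f1" "integrable lebesgue f2" "integrable lebesgue f3" "integrable lebesgue f4"
        "integrable lebesgue f5" for f1 f2 f3 f4 f5 :: "'a \<Rightarrow> real"
      using that by simp
    from this[OF iu i\<eta>(2,1) i1 i\<psi>] show ?thesis
      unfolding qform_def N_def M_def J_def .
  qed
  finally have "t * J \<le> t * (4 * N + 2 * l * M + qform q u / t + t * qform q \<psi>)"
    using t by (simp add: algebra_simps power2_eq_square)
  then have J1: "J \<le> 4 * N + 2 * l * M + qform q u / t + t * qform q \<psi>"
    using t by (simp only: mult_le_cancel_left_pos)
  have "qform q \<psi> \<le> (\<integral>x. (norm (gradient \<psi> x))\<^sup>2 \<partial>lebesgue) + l * (\<integral>x. (\<psi> x)\<^sup>2 \<partial>lebesgue)"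
    by (rule qform_le_upper_bound[OF q le \<psi>])
  also have "(\<integral>x. (\<psi> x)\<^sup>2 \<partial>lebesgue) \<le> (\<integral>x. 1 / \<epsilon>\<^sup>2 * (\<eta> x)\<^sup>2 \<partial>lebesgue)"
  proof (rule integral_mono)
    fix x
    have "(\<eta> x)\<^sup>2 \<le> 1" using \<eta>(2)[of x] by (simp add: abs_square_le_1)
    then have "(\<eta> x)\<^sup>2 * (\<eta> x)\<^sup>2 \<le> 1 * (\<eta> x)\<^sup>2" by (intro mult_right_mono) auto
    moreover have "\<epsilon>\<^sup>2 \<le> (u x + \<epsilon>)\<^sup>2" using u(2)[of x] \<epsilon> by (intro power_mono) auto
    ultimately have "((\<eta> x)\<^sup>2 * (\<eta> x)\<^sup>2) / (u x + \<epsilon>)\<^sup>2 \<le> (\<eta> x)\<^sup>2 / \<epsilon>\<^sup>2"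
      using \<epsilon> by (intro frac_le) auto
    then show "(\<psi> x)\<^sup>2 \<le> 1 / \<epsilon>\<^sup>2 * (\<eta> x)\<^sup>2" by (simp add: \<psi>eq power_divide power2_eq_square[of "(\<eta> x)\<^sup>2"])
  qed (use test_integrable[OF \<psi>] i\<eta> in auto)
  also have "(\<integral>x. (norm (gradient \<psi> x))\<^sup>2 \<partial>lebesgue) \<le>
      (\<integral>x. 8 / \<epsilon>\<^sup>2 * (norm (gradient \<eta> x))\<^sup>2 + 2 / \<epsilon>^4 * ((\<eta> x)\<^sup>2 * (norm (gradient u x))\<^sup>2) \<partial>lebesgue)"
  proof (rule integral_mono)
    fix x
    have e1: "(\<eta> x)\<^sup>2 \<le> 1" using \<eta>(2)[of x] by (simp add: abs_square_le_1)
    have eu: "\<epsilon>\<^sup>2 \<le> (u x + \<epsilon>)\<^sup>2" using u(2)[of x] \<epsilon> by (intro power_mono) auto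
    have eu4: "\<epsilon>^4 \<le> (u x + \<epsilon>)^4" using u(2)[of x] \<epsilon> by (intro power_mono) auto
    have "(norm (gradient \<psi> x))\<^sup>2 \<le> 2 * (norm ((2 * \<eta> x / (u x + \<epsilon>)) *\<^sub>R gradient \<eta> x))\<^sup>2 +
        2 * (norm (((\<eta> x)\<^sup>2 / (u x + \<epsilon>)\<^sup>2) *\<^sub>R gradient u x))\<^sup>2" (is "_ \<le> 2 * (norm ?a)\<^sup>2 + 2 * (norm ?b)\<^sup>2")
    proof -
      have "0 \<le> (norm (?a + ?b))\<^sup>2" by simp
      then show ?thesis unfolding G\<psi> power2_norm_eq_inner[of "_ - _"] power2_norm_eq_inner[of "_ + _"]
          power2_norm_eq_inner[of ?a] power2_norm_eq_inner[of ?b]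
        by (simp only: inner_diff_left inner_diff_right inner_add_left inner_add_right inner_commute[of ?b ?a])
    qed
    also have "(norm ?a)\<^sup>2 = 4 * ((\<eta> x)\<^sup>2 / (u x + \<epsilon>)\<^sup>2) * (norm (gradient \<eta> x))\<^sup>2"
      by (simp add: power_mult_distrib power_divide)
    also have "\<dots> \<le> 4 * (1 / \<epsilon>\<^sup>2) * (norm (gradient \<eta> x))\<^sup>2"
      using e1 eu \<epsilon> by (intro mult_right_mono mult_left_mono frac_le) auto
    also have "(norm ?b)\<^sup>2 = ((\<eta> x)\<^sup>2 * (\<eta> x)\<^sup>2) / (u x + \<epsilon>)^4 * (norm (gradient u x))\<^sup>2"
    proof -
      have "(u x + \<epsilon>)^4 = ((u x + \<epsilon>)\<^sup>2)\<^sup>2" by simp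
      then show ?thesis
        by (simp only: norm_scaleR power_mult_distrib power2_abs power_divide power2_eq_square[of "(\<eta> x)\<^sup>2"])
    qed
    also have "\<dots> \<le> (1 * (\<eta> x)\<^sup>2) / \<epsilon>^4 * (norm (gradient u x))\<^sup>2"
      using e1 eu4 \<epsilon> by (intro mult_right_mono frac_le) auto
    finally show "(norm (gradient \<psi> x))\<^sup>2 \<le> 8 / \<epsilon>\<^sup>2 * (norm (gradient \<eta> x))\<^sup>2 + 2 / \<epsilon>^4 * ((\<eta> x)\<^sup>2 * (norm (gradient u x))\<^sup>2)"
      by simp
  qed (use test_integrable[OF \<psi>] i\<eta> i2 in auto)
  finally have "qform q \<psi> \<le> (8 / \<epsilon>\<^sup>2 * N + 2 / \<epsilon>^4 * R) + l * (1 / \<epsilon>\<^sup>2 * M)"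
    using l i\<eta> i2 by (simp add: N_def M_def R_def mult_left_mono)
  then have "t * qform q \<psi> \<le> t * ((8 / \<epsilon>\<^sup>2 * N + 2 / \<epsilon>^4 * R) + l * (1 / \<epsilon>\<^sup>2 * M))"
    using t by (intro mult_left_mono) auto
  with J1 have "J \<le> 4 * N + 2 * l * M + qform q u / t + t * (8 / \<epsilon>\<^sup>2 * N + l / \<epsilon>\<^sup>2 * M + 2 / \<epsilon>^4 * R)"
    by (simp add: algebra_simps)
  then show "(\<integral>x. (\<eta> x)\<^sup>2 * (norm (gradient u x))\<^sup>2 / (u x + \<epsilon>)\<^sup>2 \<partial>lebesgue) \<le>
      4 * (\<integral>x. (norm (gradient \<eta> x))\<^sup>2 \<partial>lebesgue) + 2 * l * (\<integral>x. (\<eta> x)\<^sup>2 \<partial>lebesgue) + qform q u / t +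
      t * (8 / \<epsilon>\<^sup>2 * (\<integral>x. (norm (gradient \<eta> x))\<^sup>2 \<partial>lebesgue) + l / \<epsilon>\<^sup>2 * (\<integral>x. (\<eta> x)\<^sup>2 \<partial>lebesgue) +
        2 / \<epsilon>^4 * (\<integral>x. (\<eta> x)\<^sup>2 * (norm (gradient u x))\<^sup>2 \<partial>lebesgue))"
    by (simp add: J_def N_def M_def R_def)
  show "integrable lebesgue (\<lambda>x. (\<eta> x)\<^sup>2 * (norm (gradient u x))\<^sup>2 / (u x + \<epsilon>)\<^sup>2)" by (rule i1)
qed

lemma superlevel_in_fmeasurable:
  assumes "u \<in> test_functions \<Omega>" "S \<in> sets borel" "bounded S"
  shows "{x \<in> S. u x > \<delta>} \<in> fmeasurable lborel" "S \<in> fmeasurable lborel"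
    "{x \<in> S. u x \<le> \<delta>} \<in> fmeasurable lborel"
proof -
  note [measurable] = test_function_borel[OF assms(1)] assms(2)
  show S: "S \<in> fmeasurable lborel"
    using emeasure_bounded_finite[OF assms(3)] assms(2) by (intro fmeasurableI) auto
  show "{x \<in> S. u x > \<delta>} \<in> fmeasurable lborel" "{x \<in> S. u x \<le> \<delta>} \<in> fmeasurable lborel"
    by (rule fmeasurableI2[OF S]; auto; measurable)+
qed

text \<open>Between \<open>u > \<delta>\<close> and \<open>u \<le> \<epsilon>\<close> the function \<open>ln (u + \<epsilon>)\<close> changes by at least
  \<open>ln (\<delta> / (2 \<epsilon>))\<close>, so by the Poincare inequality the two sets cannot both be large.\<close>

lemma log_poincare:
  fixes u :: "'a::euclidean_space \<Rightarrow> real"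
  assumes u: "u \<in> test_functions \<Omega>" "\<And>x. u x \<ge> 0" and \<epsilon>: "\<epsilon> > 0" "2 * \<epsilon> < \<delta>"
    and E: "E \<subseteq> ball a s" "E \<in> sets borel" and s: "s > 0"
    and J: "integrable lebesgue (\<lambda>x. indicator (ball a s) x * ((norm (gradient u x))\<^sup>2 / (u x + \<epsilon>)\<^sup>2))"
      "(\<integral>x. indicator (ball a s) x * ((norm (gradient u x))\<^sup>2 / (u x + \<epsilon>)\<^sup>2) \<partial>lebesgue) \<le> J"
  shows "measure lborel {x \<in> ball a s. u x > \<delta>} * measure lborel {x \<in> E. u x \<le> \<epsilon>} * (ln (\<delta> / (2 * \<epsilon>)))\<^sup>2
    \<le> (2 * s)\<^sup>2 * measure lborel (cball 0 (2 * s) :: 'a set) * J"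
proof -
  have su: "smooth u" using u test_functions_smooth by blast
  have up: "u x + \<epsilon> > 0" for x using u(2)[of x] \<epsilon> by simp
  note [measurable] = test_function_borel[OF u(1)] E(2)
  define g where "g x = ln (u x + \<epsilon>)" for x
  define G where "G x = (1 / (u x + \<epsilon>)) *\<^sub>R gradient u x" for x
  have g': "(g has_derivative (\<lambda>h. G x \<bullet> h)) (at x)" for x
    unfolding g_def G_def using up[of x]
    by (auto intro!: derivative_eq_intros smooth_has_derivative[OF su] simp: fun_eq_iff divide_inverse mult.commute)
  have Gc: "continuous_on UNIV G"
    unfolding G_def using up
    by (intro continuous_intros smooth_continuous smooth_continuous_gradient su) (auto simp: less_imp_neq[symmetric])
  define F where "F = {x \<in> ball a s. u x > \<delta>}"
  define E' where "E' = {x \<in> E. u x \<le> \<epsilon>}"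
  define m where "m = ln (\<delta> / (2 * \<epsilon>))"
  have m: "m > 0" using \<epsilon> by (simp add: m_def)
  have [measurable]: "F \<in> sets borel" "E' \<in> sets borel" unfolding F_def E'_def by measurable
  have bE: "bounded E" using E(1) bounded_subset bounded_ball by blast
  have eF: "emeasure lborel F = ennreal (measure lborel F)"
    unfolding F_def by (rule emeasure_eq_measure2[OF superlevel_in_fmeasurable(1)[OF u(1)]]) auto
  have eE: "emeasure lborel E' = ennreal (measure lborel E')"
    unfolding E'_def by (rule emeasure_eq_measure2[OF superlevel_in_fmeasurable(3)[OF u(1) E(2) bE]])
  have gap: "m\<^sup>2 \<le> (g y - g x)\<^sup>2" if "x \<in> F" "y \<in> E'" for x y
  proof -
    have "ln \<delta> \<le> g x" unfolding g_def using that \<epsilon> by (intro ln_mono) (auto simp: F_def)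
    moreover have "g y \<le> ln (2 * \<epsilon>)"
      unfolding g_def using that up[of y] by (intro ln_mono) (auto simp: E'_def)
    ultimately have "m \<le> g x - g y" using \<epsilon> by (simp add: m_def ln_div)
    then have "m\<^sup>2 \<le> (g x - g y)\<^sup>2" using m by (intro power_mono) auto
    then show ?thesis by (simp add: power2_commute)
  qed
  have "ennreal (measure lborel F * measure lborel E' * m\<^sup>2) =
      (\<integral>\<^sup>+x. indicator F x * ennreal (measure lborel E' * m\<^sup>2) \<partial>lborel)"
    by (subst nn_integral_multc) (auto simp: eF ennreal_mult mult.assoc)
  also have "\<dots> \<le> (\<integral>\<^sup>+x. \<integral>\<^sup>+y. indicator (ball a s) x * indicator (ball a s) y * indicator (cball 0 (2 * s)) (y - x) *
      ennreal ((g y - g x)\<^sup>2) \<partial>lborel \<partial>lborel)"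
  proof (rule nn_integral_mono)
    fix x :: 'a
    show "indicator F x * ennreal (measure lborel E' * m\<^sup>2) \<le> (\<integral>\<^sup>+y. indicator (ball a s) x * indicator (ball a s) y *
        indicator (cball 0 (2 * s)) (y - x) * ennreal ((g y - g x)\<^sup>2) \<partial>lborel)"
    proof (cases "x \<in> F")
      case True
      have "ennreal (measure lborel E' * m\<^sup>2) = (\<integral>\<^sup>+y. indicator E' y * ennreal (m\<^sup>2) \<partial>lborel)"
        by (subst nn_integral_multc) (auto simp: eE ennreal_mult)
      also have "\<dots> \<le> (\<integral>\<^sup>+y. indicator (ball a s) x * indicator (ball a s) y *
        indicator (cball 0 (2 * s)) (y - x) * ennreal ((g y - g x)\<^sup>2) \<partial>lborel)"
      proof (rule nn_integral_mono)
        fix y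
        show "indicator E' y * ennreal (m\<^sup>2) \<le> indicator (ball a s) x * indicator (ball a s) y *
          indicator (cball 0 (2 * s)) (y - x) * ennreal ((g y - g x)\<^sup>2)"
        proof (cases "y \<in> E'")
          case y: True
          have xa: "x \<in> ball a s" and ya: "y \<in> ball a s" using True y E by (auto simp: F_def E'_def)
          have "norm (y - x) \<le> dist a y + dist a x"
            by (metis dist_commute dist_norm dist_triangle)
          then have "y - x \<in> cball 0 (2 * s)" using xa ya by simp
          then show ?thesis using xa ya y gap[OF True y] by (simp add: ennreal_leI)
        qed simp
      qed
      finally show ?thesis using True by simp
    qed simp
  qed
  also have "\<dots> \<le> ennreal ((2 * s)\<^sup>2) * emeasure lborel (cball 0 (2 * s) :: 'a set) *
      (\<integral>\<^sup>+x. indicator (ball a s) x * ennreal ((norm (G x))\<^sup>2) \<partial>lborel)"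
    by (rule double_translation_estimate[OF g' Gc]) auto
  also have "emeasure lborel (cball 0 (2 * s) :: 'a set) = ennreal (measure lborel (cball 0 (2 * s) :: 'a set))"
    using emeasure_compact_finite[of "cball 0 (2 * s) :: 'a set"] by (intro emeasure_eq_ennreal_measure) auto
  also have "(\<integral>\<^sup>+x. indicator (ball a s) x * ennreal ((norm (G x))\<^sup>2) \<partial>lborel) \<le> ennreal J"
  proof -
    have "(\<integral>\<^sup>+x. indicator (ball a s) x * ennreal ((norm (G x))\<^sup>2) \<partial>lborel) =
        (\<integral>\<^sup>+x. ennreal (indicator (ball a s) x * ((norm (gradient u x))\<^sup>2 / (u x + \<epsilon>)\<^sup>2)) \<partial>lebesgue)"
      unfolding nn_integral_completion
      by (rule nn_integral_cong) (simp add: G_def power_mult_distrib power_divide split: split_indicator)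
    also have "\<dots> = ennreal (\<integral>x. indicator (ball a s) x * ((norm (gradient u x))\<^sup>2 / (u x + \<epsilon>)\<^sup>2) \<partial>lebesgue)"
      by (rule nn_integral_eq_integral[OF J(1)]) auto
    also have "\<dots> \<le> ennreal J" using J(2) by (rule ennreal_leI)
    finally show ?thesis .
  qed
  finally have "ennreal (measure lborel F * measure lborel E' * m\<^sup>2) \<le>
      ennreal ((2 * s)\<^sup>2) * ennreal (measure lborel (cball 0 (2 * s) :: 'a set)) * ennreal J"
    by (simp add: mult_left_mono)
  moreover have J0: "J \<ge> 0"
    using J(2) by (rule order_trans[rotated]) (auto intro!: integral_nonneg_AE)
  ultimately have "ennreal (measure lborel F * measure lborel E' * m\<^sup>2) \<le>
      ennreal ((2 * s)\<^sup>2 * measure lborel (cball 0 (2 * s) :: 'a set) * J)"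
    by (simp add: ennreal_mult)
  then show ?thesis using J0 by (subst (asm) ennreal_le_iff) (auto simp: F_def E'_def m_def)
qed

definition vanishes_in_measure :: "(nat \<Rightarrow> 'a::euclidean_space \<Rightarrow> real) \<Rightarrow> 'a set \<Rightarrow> bool" where
  "vanishes_in_measure u S \<longleftrightarrow> (\<forall>\<delta>>0. (\<lambda>k. measure lborel {x \<in> S. u k x > \<delta>}) \<longlonglongrightarrow> 0)"

lemma vanishes_in_measure_subset:
  assumes "vanishes_in_measure u S" "T \<subseteq> S" "S \<in> sets borel" "T \<in> sets borel" "bounded S"
    and "\<And>k. u k \<in> test_functions \<Omega>"
  shows "vanishes_in_measure u T"
  unfolding vanishes_in_measure_def
proof (intro allI impI)
  fix \<delta> :: real assume "\<delta> > 0"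
  then have lim: "(\<lambda>k. measure lborel {x \<in> S. u k x > \<delta>}) \<longlonglongrightarrow> 0"
    using assms(1) by (simp add: vanishes_in_measure_def)
  have "bounded T" using assms(2,5) bounded_subset by blast
  then have "measure lborel {x \<in> T. u k x > \<delta>} \<le> measure lborel {x \<in> S. u k x > \<delta>}" for k
    using assms(2) fmeasurableD[OF superlevel_in_fmeasurable(1)[OF assms(6) assms(4)]]
    by (intro measure_mono_fmeasurable superlevel_in_fmeasurable[OF assms(6) assms(3,5)]) blast+
  then show "(\<lambda>k. measure lborel {x \<in> T. u k x > \<delta>}) \<longlonglongrightarrow> 0"
    by (intro tendsto_sandwich[OF _ _ tendsto_const lim]) auto
qed

lemma vanishes_in_measure_UN:
  assumes "finite A" "\<And>a. a \<in> A \<Longrightarrow> vanishes_in_measure u (S a)" "\<And>a. a \<in> A \<Longrightarrow> S a \<in> sets borel"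
    "\<And>a. a \<in> A \<Longrightarrow> bounded (S a)" and u: "\<And>k. u k \<in> test_functions \<Omega>"
  shows "vanishes_in_measure u (\<Union>a\<in>A. S a)"
  unfolding vanishes_in_measure_def
proof (intro allI impI)
  fix \<delta> :: real assume "\<delta> > 0"
  then have "(\<lambda>k. \<Sum>a\<in>A. measure lborel {x \<in> S a. u k x > \<delta>}) \<longlonglongrightarrow> (\<Sum>a\<in>A. 0)"
    using assms(2) by (intro tendsto_sum) (simp add: vanishes_in_measure_def)
  then have lim: "(\<lambda>k. \<Sum>a\<in>A. measure lborel {x \<in> S a. u k x > \<delta>}) \<longlonglongrightarrow> 0" by simp
  have "measure lborel {x \<in> \<Union>a\<in>A. S a. u k x > \<delta>} \<le> (\<Sum>a\<in>A. measure lborel {x \<in> S a. u k x > \<delta>})" for k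
  proof -
    have "{x \<in> \<Union>a\<in>A. S a. u k x > \<delta>} = (\<Union>a\<in>A. {x \<in> S a. u k x > \<delta>})" by auto
    moreover have "{x \<in> S a. u k x > \<delta>} \<in> sets lborel" if "a \<in> A" for a
      by (rule fmeasurableD[OF superlevel_in_fmeasurable(1)[OF u assms(3,4)[OF that]]])
    ultimately show ?thesis
      by (simp only: measure_UNION_le[OF assms(1)])
  qed
  then show "(\<lambda>k. measure lborel {x \<in> \<Union>a\<in>A. S a. u k x > \<delta>}) \<longlonglongrightarrow> 0"
    by (intro tendsto_sandwich[OF _ _ tendsto_const lim]) auto
qed

lemma bump_function_exists:
  assumes s: "s > 0" "cball a (2 * s) \<subseteq> \<Omega>"
  obtains \<eta> :: "'a::euclidean_space \<Rightarrow> real" and e0 where "\<eta> \<in> test_functions \<Omega>"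
    "\<And>x. x \<notin> cball a (2 * s) \<Longrightarrow> \<eta> x = 0" "\<And>x. \<bar>\<eta> x\<bar> \<le> 1" "e0 > 0" "\<And>x. x \<in> ball a s \<Longrightarrow> \<eta> x \<ge> e0"
proof -
  define \<eta> where "\<eta> x = smooth_step ((2 * s)\<^sup>2 - (norm (x - a))\<^sup>2)" for x
  have s\<eta>: "smooth \<eta>"
  proof
    fix k
    have "C_k k (\<lambda>x. (2 * s)\<^sup>2 + (- 1) * (norm (x - a))\<^sup>2)"
      by (intro C_k_add C_k_mult C_k_const C_k_norm_sq)
    then show "C_k k \<eta>" unfolding \<eta>_def by (intro C_k_smooth_step) simp
  qed
  have \<eta>0: "\<eta> x = 0" if "x \<notin> cball a (2 * s)" for x
  proof -
    have "2 * s \<le> norm (x - a)" using that by (simp add: dist_norm norm_minus_commute)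
    then have "(2 * s)\<^sup>2 \<le> (norm (x - a))\<^sup>2" using s by (intro power_mono) auto
    then show ?thesis by (simp add: \<eta>_def smooth_step_simps)
  qed
  have \<eta>: "\<eta> \<in> test_functions \<Omega>" by (rule test_functionsI[OF s\<eta> _ s(2) \<eta>0]) auto
  have \<eta>1: "\<bar>\<eta> x\<bar> \<le> 1" for x unfolding \<eta>_def by (simp add: smooth_step_le smooth_step_simps(3))
  define e0 where "e0 = smooth_step (3 * s\<^sup>2)"
  have e0: "e0 > 0" unfolding e0_def using s by (intro smooth_step_simps(1)) simp
  have \<eta>e: "\<eta> x \<ge> e0" if "x \<in> ball a s" for x
  proof -
    have "(norm (x - a))\<^sup>2 \<le> s\<^sup>2" using that by (intro power_mono) (auto simp: dist_norm norm_minus_commute)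
    then show ?thesis unfolding e0_def \<eta>_def by (intro smooth_step_mono) simp
  qed
  show ?thesis by (rule that[OF \<eta> \<eta>0 \<eta>1 e0 \<eta>e])
qed

text \<open>No limit function is extracted from the sequence \<open>u\<close>, so compactness is replaced by
  convergence in measure. The local energy bound makes the term with \<open>\<psi>\<close> in
  \<open>log_gradient_estimate\<close> bounded along the sequence for each fixed \<open>\<epsilon>\<close>.\<close>

locale near_minimisers =
  fixes \<Omega> :: "'a::euclidean_space set" and q :: "'a \<Rightarrow> real" and l :: real and u :: "nat \<Rightarrow> 'a \<Rightarrow> real"
  assumes q: "local_potential \<Omega> q" and q_le: "\<And>x. q x \<le> l" and l: "l \<ge> 0"
    and pos: "\<And>v. v \<in> test_functions \<Omega> \<Longrightarrow> qform q v \<ge> 0"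
    and u: "\<And>k. u k \<in> test_functions \<Omega>" and u_nonneg: "\<And>k x. u k x \<ge> 0"
    and lim: "(\<lambda>k. qform q (u k)) \<longlonglongrightarrow> 0"
    and energy_bound: "\<And>a s. cball a s \<subseteq> \<Omega> \<Longrightarrow>
      \<exists>M. \<forall>k. (\<integral>x. indicator (cball a s) x * (norm (gradient (u k) x))\<^sup>2 \<partial>lebesgue) \<le> M"
begin

text \<open>The strong maximum principle for near-minimisers. The bound \<open>C\<close> for the logarithmic
  energy is the same for all \<open>\<epsilon>\<close>, while the jump \<open>X = ln (\<delta> / (2 \<epsilon>))\<close> in \<open>log_poincare\<close> can be made
  as large as desired by choosing \<open>\<epsilon>\<close> small; only the index from which the bound holds depends
  on \<open>\<epsilon>\<close>.\<close>

lemma vanishes_on_ball: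
  assumes s: "s > 0" "cball a (2 * s) \<subseteq> \<Omega>"
    and E: "E \<subseteq> ball a s" "E \<in> sets borel" "measure lborel E > 0" and van: "vanishes_in_measure u E"
  shows "vanishes_in_measure u (ball a s)"
  unfolding vanishes_in_measure_def
proof (intro allI impI)
  fix \<delta> :: real assume \<delta>: "\<delta> > 0"
  obtain \<eta> :: "'a \<Rightarrow> real" and e0 where \<eta>: "\<eta> \<in> test_functions \<Omega>" and \<eta>0: "\<And>x. x \<notin> cball a (2 * s) \<Longrightarrow> \<eta> x = 0"
    and \<eta>1: "\<And>x. \<bar>\<eta> x\<bar> \<le> 1" and e0: "e0 > 0" and \<eta>e: "\<And>x. x \<in> ball a s \<Longrightarrow> \<eta> x \<ge> e0"
    by (rule bump_function_exists[OF s]) blast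
  define N where "N = (\<integral>x. (norm (gradient \<eta> x))\<^sup>2 \<partial>lebesgue)"
  define M where "M = (\<integral>x. (\<eta> x)\<^sup>2 \<partial>lebesgue)"
  obtain R where R: "\<And>k. (\<integral>x. indicator (cball a (2 * s)) x * (norm (gradient (u k) x))\<^sup>2 \<partial>lebesgue) \<le> R"
    using energy_bound[OF s(2)] by blast
  have ball_int: "integrable lebesgue (\<lambda>x. indicator S x * (norm (gradient (u k) x))\<^sup>2)" if "S \<in> sets lebesgue" for k S
    using integrable_mult_indicator[OF that test_integrable(2)[OF u[of k]]] by simp
  have R': "(\<integral>x. (\<eta> x)\<^sup>2 * (norm (gradient (u k) x))\<^sup>2 \<partial>lebesgue) \<le> \<bar>R\<bar>" for k
  proof (cases "integrable lebesgue (\<lambda>x. (\<eta> x)\<^sup>2 * (norm (gradient (u k) x))\<^sup>2)")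
    case True
    have "(\<integral>x. (\<eta> x)\<^sup>2 * (norm (gradient (u k) x))\<^sup>2 \<partial>lebesgue) \<le>
        (\<integral>x. indicator (cball a (2 * s)) x * (norm (gradient (u k) x))\<^sup>2 \<partial>lebesgue)"
    proof (rule integral_mono[OF True ball_int])
      fix x
      have "(\<eta> x)\<^sup>2 \<le> 1" using \<eta>1[of x] by (simp add: abs_square_le_1)
      then show "(\<eta> x)\<^sup>2 * (norm (gradient (u k) x))\<^sup>2 \<le> indicator (cball a (2 * s)) x * (norm (gradient (u k) x))\<^sup>2"
        using \<eta>0[of x] by (cases "x \<in> cball a (2 * s)") (auto intro: mult_left_le_one_le)
    qed simp
    then show ?thesis using R[of k] by linarith
  qed (simp add: not_integrable_integral_eq)
  have N0: "N \<ge> 0" and M0: "M \<ge> 0" unfolding N_def M_def by (auto intro!: integral_nonneg_AE)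
  define C where "C = (4 * N + 2 * l * M + 2) / e0\<^sup>2"
  have C: "C > 0" unfolding C_def using N0 M0 l e0 by (intro divide_pos_pos add_nonneg_pos add_nonneg_nonneg) auto
  define c where "c = (2 * s)\<^sup>2 * measure lborel (cball 0 (2 * s) :: 'a set) * C"
  have c: "c \<ge> 0" using C by (simp add: c_def)
  define b where "b = measure lborel E"
  have bE: "bounded E" using E(1) bounded_subset bounded_ball by blast
  show "(\<lambda>k. measure lborel {x \<in> ball a s. u k x > \<delta>}) \<longlonglongrightarrow> 0"
  proof (rule LIMSEQ_I)
    fix \<tau> :: real assume \<tau>: "\<tau> > 0"
    \<comment> \<open>A jump \<open>X\<close> of the logarithm that forces the measure below \<open>\<tau>\<close>, and the \<open>\<epsilon>\<close> producing it.\<close>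
    define X where "X = sqrt (2 * c / (b * \<tau>)) + 1"
    have b: "b > 0" using E by (simp add: b_def)
    have X: "X > 0" "2 * c / (b * \<tau>) < X\<^sup>2"
    proof -
      have sq: "sqrt (2 * c / (b * \<tau>)) \<ge> 0" using c b \<tau> by simp
      then show "X > 0" unfolding X_def by linarith
      have "(sqrt (2 * c / (b * \<tau>)))\<^sup>2 < X\<^sup>2" unfolding X_def using sq by (intro power_strict_mono) auto
      then show "2 * c / (b * \<tau>) < X\<^sup>2" using c b \<tau> by simp
    qed
    define \<epsilon> where "\<epsilon> = \<delta> / (2 * exp X)"
    have \<epsilon>: "\<epsilon> > 0" using \<delta> by (simp add: \<epsilon>_def)
    have \<epsilon>2: "2 * \<epsilon> < \<delta>" using \<delta> X by (simp add: \<epsilon>_def field_simps)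
    have lnX: "ln (\<delta> / (2 * \<epsilon>)) = X" using \<delta> by (simp add: \<epsilon>_def)
    define B where "B = 8 / \<epsilon>\<^sup>2 * N + l / \<epsilon>\<^sup>2 * M + 2 / \<epsilon>^4 * \<bar>R\<bar>"
    have B: "B \<ge> 0" unfolding B_def using N0 M0 l by (intro add_nonneg_nonneg mult_nonneg_nonneg) auto
    \<comment> \<open>With this \<open>t\<close> both error terms of the logarithmic estimate are at most \<open>1\<close> eventually.\<close>
    define t where "t = 1 / (B + 1)"
    have t: "t > 0" "t * B \<le> 1" using B by (auto simp: t_def field_simps)
    have "\<forall>\<^sub>F k in sequentially. qform q (u k) < t"
      using lim t(1) by (rule order_tendstoD)
    moreover have "(\<lambda>k. measure lborel {x \<in> E. u k x > \<epsilon>}) \<longlonglongrightarrow> 0"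
      using van \<epsilon> by (simp add: vanishes_in_measure_def)
    then have "\<forall>\<^sub>F k in sequentially. measure lborel {x \<in> E. u k x > \<epsilon>} < b / 2"
      using b by (intro order_tendstoD) auto
    ultimately have "\<forall>\<^sub>F k in sequentially. norm (measure lborel {x \<in> ball a s. u k x > \<delta>} - 0) < \<tau>"
    proof eventually_elim
      case (elim k)
      note L = log_gradient_estimate[OF q q_le l pos u[of k] u_nonneg \<eta> \<eta>1 \<epsilon> t(1)]
      have "(\<integral>x. (\<eta> x)\<^sup>2 * (norm (gradient (u k) x))\<^sup>2 / (u k x + \<epsilon>)\<^sup>2 \<partial>lebesgue) \<le>
          4 * N + 2 * l * M + qform q (u k) / t + t * B"
      proof -
        have "2 / \<epsilon>^4 * (\<integral>x. (\<eta> x)\<^sup>2 * (norm (gradient (u k) x))\<^sup>2 \<partial>lebesgue) \<le> 2 / \<epsilon>^4 * \<bar>R\<bar>"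
          by (intro mult_left_mono R') simp
        then have "t * (8 / \<epsilon>\<^sup>2 * N + l / \<epsilon>\<^sup>2 * M + 2 / \<epsilon>^4 * (\<integral>x. (\<eta> x)\<^sup>2 * (norm (gradient (u k) x))\<^sup>2 \<partial>lebesgue)) \<le> t * B"
          unfolding B_def using t(1) by (intro mult_left_mono) auto
        then show ?thesis using L(2) unfolding N_def[symmetric] M_def[symmetric] by linarith
      qed
      also have "\<dots> \<le> 4 * N + 2 * l * M + 2"
      proof -
        have "qform q (u k) / t \<le> 1" using elim(1) t(1) by simp
        then show ?thesis using t(2) by linarith
      qed
      finally have J: "(\<integral>x. (\<eta> x)\<^sup>2 * (norm (gradient (u k) x))\<^sup>2 / (u k x + \<epsilon>)\<^sup>2 \<partial>lebesgue) \<le> 4 * N + 2 * l * M + 2" .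
      define f where "f x = (norm (gradient (u k) x))\<^sup>2 / (u k x + \<epsilon>)\<^sup>2" for x
      have f0: "f x \<ge> 0" for x by (simp add: f_def)
      have fi: "integrable lebesgue (\<lambda>x. (\<eta> x)\<^sup>2 * f x)" using L(1) by (simp add: f_def)
      have fm: "f \<in> borel_measurable lebesgue"
      proof -
        note [measurable] = test_function_borel[OF u[of k]]
        show ?thesis unfolding f_def by (intro borel_lebesgue) measurable
      qed
      have fle: "indicator (ball a s) x * f x \<le> (1 / e0\<^sup>2) * ((\<eta> x)\<^sup>2 * f x)" for x
      proof (cases "x \<in> ball a s")
        case True
        have "e0\<^sup>2 \<le> (\<eta> x)\<^sup>2" using \<eta>e[OF True] e0 by (intro power_mono) auto
        then have "e0\<^sup>2 * f x \<le> (\<eta> x)\<^sup>2 * f x" using f0 by (rule mult_right_mono)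
        then show ?thesis using True e0 by (simp add: field_simps)
      qed (simp add: f0)
      have fb: "integrable lebesgue (\<lambda>x. indicator (ball a s) x * f x)"
      proof (rule Bochner_Integration.integrable_bound)
        show "integrable lebesgue (\<lambda>x. (1 / e0\<^sup>2) * ((\<eta> x)\<^sup>2 * f x))" using fi by (rule integrable_mult_right)
        show "AE x in lebesgue. norm (indicator (ball a s) x * f x) \<le> norm ((1 / e0\<^sup>2) * ((\<eta> x)\<^sup>2 * f x))"
          using fle f0 by (intro AE_I2) (simp add: abs_mult)
        show "(\<lambda>x. indicator (ball a s) x * f x) \<in> borel_measurable lebesgue"
          using fm by (intro borel_measurable_times borel_measurable_indicator) auto
      qed
      have "(\<integral>x. indicator (ball a s) x * f x \<partial>lebesgue) \<le> (\<integral>x. (1 / e0\<^sup>2) * ((\<eta> x)\<^sup>2 * f x) \<partial>lebesgue)"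
        by (rule integral_mono[OF fb _ fle]) (rule integrable_mult_right[OF fi])
      also have "\<dots> \<le> (1 / e0\<^sup>2) * (4 * N + 2 * l * M + 2)"
        using J by (subst integral_mult_right_zero) (intro mult_left_mono, auto simp: f_def)
      also have "\<dots> = C" by (simp add: C_def)
      finally have "(\<integral>x. indicator (ball a s) x * f x \<partial>lebesgue) \<le> C" .
      from log_poincare[OF u[of k] u_nonneg \<epsilon> \<epsilon>2 E(1,2) s(1) fb[unfolded f_def] this[unfolded f_def]]
      have P: "measure lborel {x \<in> ball a s. u k x > \<delta>} * measure lborel {x \<in> E. u k x \<le> \<epsilon>} * X\<^sup>2 \<le> c"
        by (simp add: lnX c_def)
      have "b = measure lborel ({x \<in> E. u k x > \<epsilon>} \<union> {x \<in> E. u k x \<le> \<epsilon>})"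
        unfolding b_def by (rule arg_cong[where f = "measure lborel"]) auto
      also have "\<dots> \<le> measure lborel {x \<in> E. u k x > \<epsilon>} + measure lborel {x \<in> E. u k x \<le> \<epsilon>}"
        by (intro measure_Un_le fmeasurableD superlevel_in_fmeasurable[OF u E(2) bE])
      finally have half: "b / 2 \<le> measure lborel {x \<in> E. u k x \<le> \<epsilon>}" using elim(2) by simp
      define F where "F = measure lborel {x \<in> ball a s. u k x > \<delta>}"
      have F0: "F \<ge> 0" by (simp add: F_def)
      have "F * (b / 2) * X\<^sup>2 \<le> F * measure lborel {x \<in> E. u k x \<le> \<epsilon>} * X\<^sup>2"
        using half F0 by (intro mult_right_mono mult_left_mono) auto
      also have "\<dots> \<le> c" using P by (simp add: F_def)
      also have "c < \<tau> * (b / 2) * X\<^sup>2" using X(2) b \<tau> by (simp add: field_simps)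
      finally have "F < \<tau>" using b X(1) by simp
      then show ?case using F0 by (simp add: F_def)
    qed
    then show "\<exists>k0. \<forall>k\<ge>k0. norm (measure lborel {x \<in> ball a s. u k x > \<delta>} - 0) < \<tau>"
      by (simp add: eventually_sequentially)
  qed
qed

text \<open>The centres of balls on which the sequence vanishes form a relatively closed set,
  because two overlapping balls share a set of positive measure.\<close>

lemma vanishes_on_compact:
  assumes \<Omega>: "open \<Omega>" "connected \<Omega>" and s: "s > 0" "cball a (2 * s) \<subseteq> \<Omega>"
    and E: "E \<subseteq> ball a s" "E \<in> sets borel" "measure lborel E > 0" and van: "vanishes_in_measure u E"
    and K: "compact K" "K \<subseteq> \<Omega>"
  shows "vanishes_in_measure u K"
proof -
  define G where "G = {x. \<exists>r>0. cball x (2 * r) \<subseteq> \<Omega> \<and> vanishes_in_measure u (ball x r)}"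
  have G\<Omega>: "G \<subseteq> \<Omega>"
  proof
    fix x assume "x \<in> G"
    then obtain r where "r > 0" "cball x (2 * r) \<subseteq> \<Omega>" unfolding G_def by blast
    then show "x \<in> \<Omega>" by (meson centre_in_cball less_imp_le mult_nonneg_nonneg subsetD zero_le_numeral)
  qed
  have sub: "vanishes_in_measure u (ball y r)" if "vanishes_in_measure u (ball x r')" "ball y r \<subseteq> ball x r'" for x y r r'
    by (rule vanishes_in_measure_subset[OF that _ _ _ u]) auto
  have "open G"
    unfolding open_contains_ball
  proof
    fix x assume "x \<in> G"
    then obtain r where r: "r > 0" "cball x (2 * r) \<subseteq> \<Omega>" "vanishes_in_measure u (ball x r)" unfolding G_def by blast
    have "y \<in> G" if "y \<in> ball x (r / 2)" for y
    proof -
      have "cball y (2 * (r / 2)) \<subseteq> cball x (2 * r)" "ball y (r / 2) \<subseteq> ball x r"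
        using that by (auto intro!: cball_subset_cball_iff[THEN iffD2] simp: subset_iff dist_commute)
          (smt (verit) dist_commute dist_triangle)+
      then show ?thesis unfolding G_def using r sub by (auto intro!: exI[of _ "r / 2"])
    qed
    then show "\<exists>e>0. ball x e \<subseteq> G" using r(1) by (intro exI[of _ "r / 2"]) auto
  qed
  moreover have "closedin (top_of_set \<Omega>) G"
    unfolding closedin_limpt
  proof (intro conjI G\<Omega> allI impI)
    fix x assume x: "x islimpt G \<and> x \<in> \<Omega>"
    then obtain e where e: "e > 0" "cball x e \<subseteq> \<Omega>" using \<Omega>(1) open_contains_cball by blast
    define r where "r = e / 2"
    have r: "r > 0" "cball x (2 * r) \<subseteq> \<Omega>" using e by (auto simp: r_def)
    obtain y where y: "y \<in> G" "dist y x < r" using x r(1) by (meson islimpt_approachable)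
    obtain r' where r': "r' > 0" "vanishes_in_measure u (ball y r')" using y(1) unfolding G_def by blast
    define r2 where "r2 = min r' (r - dist y x)"
    have r2: "r2 > 0" "ball y r2 \<subseteq> ball y r'" using r' y(2) by (auto simp: r2_def)
    have "ball y r2 \<subseteq> ball x r"
    proof
      fix z assume "z \<in> ball y r2"
      then have "dist y z < r - dist y x" by (simp add: r2_def)
      then show "z \<in> ball x r" using dist_triangle[of x z y] by (simp add: dist_commute)
    qed
    moreover have "measure lborel (ball y r2) > 0" using r2(1) by (simp add: content_ball_pos)
    ultimately have "vanishes_in_measure u (ball x r)"
      using vanishes_on_ball[OF r, of "ball y r2"] sub[OF r'(2) r2(2)] by auto
    then show "x \<in> G" using r unfolding G_def by blast
  qed
  moreover have "openin (top_of_set \<Omega>) G"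
    using \<open>open G\<close> G\<Omega> by (simp add: openin_open_eq[OF \<Omega>(1)])
  moreover have "a \<in> G" using vanishes_on_ball[OF s E van] s unfolding G_def by blast
  ultimately have "G = \<Omega>" using \<Omega>(2) unfolding connected_clopen by blast
  then have "\<forall>x\<in>K. \<exists>r>0. vanishes_in_measure u (ball x r)" using K(2) unfolding G_def by blast
  then obtain r where r: "\<And>x. x \<in> K \<Longrightarrow> r x > 0" "\<And>x. x \<in> K \<Longrightarrow> vanishes_in_measure u (ball x (r x))"
    by metis
  obtain F where F: "F \<subseteq> K" "finite F" "K \<subseteq> (\<Union>x\<in>F. ball x (r x))"
    by (rule compactE_image[OF K(1), of K "\<lambda>x. ball x (r x)"]) (use r(1) in \<open>auto intro: centre_in_ball[THEN iffD2]\<close>)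
  have "vanishes_in_measure u (\<Union>x\<in>F. ball x (r x))"
    by (rule vanishes_in_measure_UN[OF F(2) _ _ _ u]) (use F r in auto)
  then show ?thesis
    by (rule vanishes_in_measure_subset[OF _ F(3) _ _ _ u]) (use F(2) K(1) in \<open>auto simp: borel_compact\<close>)
qed

end

section \<open>Localisation\<close>

lemma smooth_cutoffs:
  fixes \<rho> :: real
  assumes \<rho>: "\<rho> > 0"
  obtains \<chi>1 \<chi>2 :: "'a::euclidean_space \<Rightarrow> real" and L where
    "smooth \<chi>1" "smooth \<chi>2" "\<And>x. (\<chi>1 x)\<^sup>2 + (\<chi>2 x)\<^sup>2 = 1" "\<And>x. norm x \<ge> \<rho> \<Longrightarrow> \<chi>1 x = 0"
    "\<And>x. norm x \<ge> \<rho> \<Longrightarrow> \<chi>2 x = 1" "\<And>x. norm x \<le> \<rho> / 2 \<Longrightarrow> \<chi>2 x = 0" "L \<ge> 0"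
    "\<And>x. (norm (gradient \<chi>1 x))\<^sup>2 + (norm (gradient \<chi>2 x))\<^sup>2 \<le> L * indicator {x. \<rho> / 2 \<le> norm x} x"
proof -
  define \<theta>1 :: "'a \<Rightarrow> real" where "\<theta>1 x = smooth_step (\<rho>\<^sup>2 - (norm x)\<^sup>2)" for x
  define \<theta>2 :: "'a \<Rightarrow> real" where "\<theta>2 x = smooth_step ((norm x)\<^sup>2 - (\<rho> / 2)\<^sup>2)" for x
  define S where "S x = \<theta>1 x * \<theta>1 x + \<theta>2 x * \<theta>2 x" for x
  have nsq: "C_k k (\<lambda>x::'a. (norm x)\<^sup>2)" for k using C_k_norm_sq[of k "0::'a"] by simp
  have s1: "C_k k \<theta>1" and s2: "C_k k \<theta>2" for k
  proof -
    have "C_k k (\<lambda>x::'a. \<rho>\<^sup>2 + (- 1) * (norm x)\<^sup>2)" "C_k k (\<lambda>x::'a. (norm x)\<^sup>2 + - (\<rho> / 2)\<^sup>2)"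
      by (intro C_k_add C_k_mult C_k_const nsq)+
    then show "C_k k \<theta>1" "C_k k \<theta>2" unfolding \<theta>1_def \<theta>2_def by (auto intro!: C_k_smooth_step)
  qed
  have \<theta>1z: "\<theta>1 x = 0" if "norm x \<ge> \<rho>" for x
    unfolding \<theta>1_def using power_mono[OF that, of 2] \<rho> by (intro smooth_step_simps(2)) simp
  have \<theta>2z: "\<theta>2 x = 0" if "norm x \<le> \<rho> / 2" for x
    unfolding \<theta>2_def using power_mono[OF that, of 2] by (intro smooth_step_simps(2)) simp
  have \<theta>1p: "\<theta>1 x > 0" if "norm x < \<rho>" for x
    unfolding \<theta>1_def using power_strict_mono[OF that, of 2] by (intro smooth_step_simps(1)) simp
  have \<theta>2p: "\<theta>2 x > 0" if "norm x > \<rho> / 2" for x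
    unfolding \<theta>2_def using power_strict_mono[OF that, of 2] \<rho> by (intro smooth_step_simps(1)) simp
  have Sp: "S x > 0" for x
  proof (cases "norm x < \<rho>")
    case True
    then show ?thesis using \<theta>1p[OF True] unfolding S_def by (intro add_pos_nonneg) auto
  next
    case False
    then have "\<theta>2 x > 0" using \<rho> by (intro \<theta>2p) simp
    then show ?thesis unfolding S_def by (intro add_nonneg_pos) auto
  qed
  define \<chi>1 where "\<chi>1 x = \<theta>1 x * (1 / sqrt (S x))" for x
  define \<chi>2 where "\<chi>2 x = \<theta>2 x * (1 / sqrt (S x))" for x
  have sS: "C_k k (\<lambda>x. 1 / sqrt (S x))" for k
    using Sp by (intro C_k_inverse C_k_sqrt) (auto simp: S_def intro!: C_k_add C_k_mult s1 s2)
  have c1: "smooth \<chi>1" and c2: "smooth \<chi>2"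
    unfolding \<chi>1_def \<chi>2_def by (auto intro!: C_k_mult[OF s1 sS] C_k_mult[OF s2 sS] simp del: times_divide_eq_right)
  have sum1: "(\<chi>1 x)\<^sup>2 + (\<chi>2 x)\<^sup>2 = 1" for x
  proof -
    have "sqrt (S x) * sqrt (S x) = S x" using Sp[of x] by simp
    then have "(\<chi>1 x)\<^sup>2 = \<theta>1 x * \<theta>1 x / S x" "(\<chi>2 x)\<^sup>2 = \<theta>2 x * \<theta>2 x / S x"
      by (simp_all add: \<chi>1_def \<chi>2_def power2_eq_square)
    then have "(\<chi>1 x)\<^sup>2 + (\<chi>2 x)\<^sup>2 = S x / S x"
      by (simp only: add_divide_distrib[symmetric] S_def[symmetric])
    then show ?thesis using Sp[of x] by simp
  qed
  have z1: "\<chi>1 x = 0" if "norm x \<ge> \<rho>" for x using \<theta>1z[OF that] by (simp add: \<chi>1_def)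
  have z2: "\<chi>2 x = 0" if "norm x \<le> \<rho> / 2" for x using \<theta>2z[OF that] by (simp add: \<chi>2_def)
  have o2: "\<chi>2 x = 1" if "norm x \<ge> \<rho>" for x
  proof -
    have "\<theta>2 x > 0" using that \<rho> by (intro \<theta>2p) simp
    then show ?thesis using \<theta>1z[OF that] by (simp add: \<chi>2_def S_def)
  qed
  have o1: "\<chi>1 x = 1" if "norm x \<le> \<rho> / 2" for x
  proof -
    have "\<theta>1 x > 0" using that \<rho> by (intro \<theta>1p) simp
    then show ?thesis using \<theta>2z[OF that] by (simp add: \<chi>1_def S_def)
  qed
  have const: "gradient f x = 0" if "open U" "x \<in> U" "\<And>y. y \<in> U \<Longrightarrow> f y = c" for f :: "'a \<Rightarrow> real" and U x c
  proof (rule gradient_eqI)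
    have "((\<lambda>_. c) has_derivative (\<lambda>h. 0 \<bullet> h)) (at x)" by simp
    then show "(f has_derivative (\<lambda>h. 0 \<bullet> h)) (at x)"
      by (rule has_derivative_transform_within_open[OF _ that(1,2)]) (simp add: that(3))
  qed
  define h where "h x = (norm (gradient \<chi>1 x))\<^sup>2 + (norm (gradient \<chi>2 x))\<^sup>2" for x
  have hin: "h x = 0" if "norm x < \<rho> / 2" for x
  proof -
    have o: "open {x::'a. norm x < \<rho> / 2}" by (intro open_Collect_less continuous_intros)
    show ?thesis
      using const[OF o, of x \<chi>1 1] const[OF o, of x \<chi>2 0] that z2 o1 by (simp add: h_def)
  qed
  have hout: "h x = 0" if "norm x > \<rho>" for x
  proof -
    have o: "open {x::'a. norm x > \<rho>}" by (intro open_Collect_less continuous_intros)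
    show ?thesis
      using const[OF o, of x \<chi>1 0] const[OF o, of x \<chi>2 1] that z1 o2 by (simp add: h_def)
  qed
  have "bounded (h ` cball 0 \<rho>)"
    unfolding h_def
    by (intro compact_imp_bounded compact_continuous_image continuous_intros smooth_continuous_gradient c1 c2) simp
  then obtain B where B: "\<And>x. x \<in> cball 0 \<rho> \<Longrightarrow> \<bar>h x\<bar> \<le> B"
    unfolding bounded_iff by (metis imageI real_norm_def)
  have "h x \<le> \<bar>B\<bar> * indicator {x. \<rho> / 2 \<le> norm x} x" for x
    using B[of x] hin[of x] hout[of x] by (cases "norm x < \<rho> / 2"; cases "norm x > \<rho>") auto
  then show ?thesis
    by (intro that[OF c1 c2 sum1 z1 o2 z2, of "\<bar>B\<bar>"]) (auto simp: h_def)
qed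

lemma gradient_eq_on_open:
  assumes "open U" "x \<in> U" "\<And>y. y \<in> U \<Longrightarrow> f y = g y" "smooth f"
  shows "gradient g x = gradient f x"
  by (rule gradient_eqI, rule has_derivative_transform_within_open[OF smooth_has_derivative[OF assms(4)] assms(1,2)])
    (simp add: assms(3))

lemma integrable_indicator_square:
  assumes "u \<in> test_functions \<Omega>" "S \<in> sets lebesgue"
  shows "integrable lebesgue (\<lambda>x. indicator S x * (u x)\<^sup>2)"
  using integrable_mult_indicator[OF assms(2) test_integrable(1)[OF assms(1)]] by simp

text \<open>The IMS localisation formula. The mixed terms cancel because
  \<open>\<chi>1 \<nabla> \<chi>1 + \<chi>2 \<nabla> \<chi>2 = 0\<close>, the gradient of a constant.\<close>

lemma ims_localisation:
  fixes q :: "'a::euclidean_space \<Rightarrow> real"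
  assumes q: "local_potential \<Omega> q" and u: "u \<in> test_functions \<Omega>"
    and c: "smooth \<chi>1" "smooth \<chi>2" and sum1: "\<And>x. (\<chi>1 x)\<^sup>2 + (\<chi>2 x)\<^sup>2 = 1"
    and S: "S \<in> sets lebesgue"
    and grad: "\<And>x. (norm (gradient \<chi>1 x))\<^sup>2 + (norm (gradient \<chi>2 x))\<^sup>2 \<le> L * indicator S x"
  shows "qform q (\<lambda>x. \<chi>1 x * u x) + qform q (\<lambda>x. \<chi>2 x * u x) \<le>
    qform q u + L * (\<integral>x. indicator S x * (u x)\<^sup>2 \<partial>lebesgue)"
proof -
  have su: "smooth u" using u test_functions_smooth by blast
  note t1 = test_functions_mult[OF u c(1)] and t2 = test_functions_mult[OF u c(2)]
  have orth: "\<chi>1 x *\<^sub>R gradient \<chi>1 x + \<chi>2 x *\<^sub>R gradient \<chi>2 x = 0" for x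
  proof -
    have "((\<lambda>x. (\<chi>1 x)\<^sup>2 + (\<chi>2 x)\<^sup>2) has_derivative
        (\<lambda>h. (2 *\<^sub>R (\<chi>1 x *\<^sub>R gradient \<chi>1 x + \<chi>2 x *\<^sub>R gradient \<chi>2 x)) \<bullet> h)) (at x)"
      by (auto intro!: derivative_eq_intros smooth_has_derivative c simp: inner_add_left algebra_simps)
    from gradient_eqI[OF this] have "gradient (\<lambda>x. 1) x = 2 *\<^sub>R (\<chi>1 x *\<^sub>R gradient \<chi>1 x + \<chi>2 x *\<^sub>R gradient \<chi>2 x)"
      by (simp add: sum1)
    moreover have "gradient (\<lambda>x::'a. 1) x = 0" by (rule gradient_eqI) simp
    ultimately show ?thesis by simp
  qed
  have ptw: "((norm (gradient (\<lambda>x. \<chi>1 x * u x) x))\<^sup>2 + q x * (\<chi>1 x * u x)\<^sup>2) +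
      ((norm (gradient (\<lambda>x. \<chi>2 x * u x) x))\<^sup>2 + q x * (\<chi>2 x * u x)\<^sup>2) \<le>
      ((norm (gradient u x))\<^sup>2 + q x * (u x)\<^sup>2) + L * (indicator S x * (u x)\<^sup>2)" for x
  proof -
    have sq: "(norm (gradient (\<lambda>x. f x * u x) x))\<^sup>2 = (f x)\<^sup>2 * (norm (gradient u x))\<^sup>2 +
        2 * u x * (gradient u x \<bullet> (f x *\<^sub>R gradient f x)) + (u x)\<^sup>2 * (norm (gradient f x))\<^sup>2"
      if "smooth f" for f
      unfolding gradient_mult[OF that su] power2_norm_eq_inner
      by (simp add: inner_add_left inner_add_right inner_commute power2_eq_square algebra_simps)
    have "(norm (gradient (\<lambda>x. \<chi>1 x * u x) x))\<^sup>2 + (norm (gradient (\<lambda>x. \<chi>2 x * u x) x))\<^sup>2 =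
        ((\<chi>1 x)\<^sup>2 + (\<chi>2 x)\<^sup>2) * (norm (gradient u x))\<^sup>2 +
        2 * u x * (gradient u x \<bullet> (\<chi>1 x *\<^sub>R gradient \<chi>1 x + \<chi>2 x *\<^sub>R gradient \<chi>2 x)) +
        (u x)\<^sup>2 * ((norm (gradient \<chi>1 x))\<^sup>2 + (norm (gradient \<chi>2 x))\<^sup>2)"
      unfolding sq[OF c(1)] sq[OF c(2)] inner_add_right by (simp add: algebra_simps)
    also have "\<dots> = (norm (gradient u x))\<^sup>2 + (u x)\<^sup>2 * ((norm (gradient \<chi>1 x))\<^sup>2 + (norm (gradient \<chi>2 x))\<^sup>2)"
      unfolding orth sum1 by simp
    also have "\<dots> \<le> (norm (gradient u x))\<^sup>2 + (u x)\<^sup>2 * (L * indicator S x)"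
      by (intro add_left_mono mult_left_mono grad) simp
    finally have g: "(norm (gradient (\<lambda>x. \<chi>1 x * u x) x))\<^sup>2 + (norm (gradient (\<lambda>x. \<chi>2 x * u x) x))\<^sup>2 \<le>
        (norm (gradient u x))\<^sup>2 + L * (indicator S x * (u x)\<^sup>2)" by (simp add: mult_ac)
    have "q x * (\<chi>1 x * u x)\<^sup>2 + q x * (\<chi>2 x * u x)\<^sup>2 = ((\<chi>1 x)\<^sup>2 + (\<chi>2 x)\<^sup>2) * (q x * (u x)\<^sup>2)"
      by (simp add: power_mult_distrib algebra_simps)
    then show ?thesis using g unfolding sum1 by simp
  qed
  have i: "integrable lebesgue (\<lambda>x. L * (indicator S x * (u x)\<^sup>2))"
    by (intro integrable_mult_right integrable_indicator_square[OF u S])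
  have "qform q (\<lambda>x. \<chi>1 x * u x) + qform q (\<lambda>x. \<chi>2 x * u x) =
      (\<integral>x. ((norm (gradient (\<lambda>x. \<chi>1 x * u x) x))\<^sup>2 + q x * (\<chi>1 x * u x)\<^sup>2) +
      ((norm (gradient (\<lambda>x. \<chi>2 x * u x) x))\<^sup>2 + q x * (\<chi>2 x * u x)\<^sup>2) \<partial>lebesgue)"
    unfolding qform_def
    by (rule Bochner_Integration.integral_add[symmetric]) (rule integrable_qform[OF q t1] integrable_qform[OF q t2])+
  also have "\<dots> \<le> (\<integral>x. ((norm (gradient u x))\<^sup>2 + q x * (u x)\<^sup>2) + L * (indicator S x * (u x)\<^sup>2) \<partial>lebesgue)"
    by (rule integral_mono[OF _ _ ptw])
      (intro Bochner_Integration.integrable_add integrable_qform[OF q] t1 t2 u i)+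
  also have "\<dots> = qform q u + L * (\<integral>x. indicator S x * (u x)\<^sup>2 \<partial>lebesgue)"
    unfolding qform_def by (subst Bochner_Integration.integral_add[OF integrable_qform[OF q u] i]) simp
  finally show ?thesis .
qed

text \<open>A negative value of the form is attained by a non-negative test function: replace \<open>|u|\<close> by
  the smooth function \<open>sqrt (u\<^sup>2 + \<epsilon>\<^sup>2) - \<epsilon>\<close>, whose gradient is pointwise no longer than that
  of \<open>u\<close>.\<close>

lemma nonneg_test_function:
  fixes q :: "'a::euclidean_space \<Rightarrow> real"
  assumes q: "local_potential \<Omega> q" and u: "u \<in> test_functions \<Omega>" and neg: "qform q u < 0"
  obtains v where "v \<in> test_functions \<Omega>" "\<And>x. v x \<ge> 0" "qform q v < 0"
proof -
  obtain K where K: "smooth u" "compact K" "K \<subseteq> \<Omega>" "\<And>x. x \<notin> K \<Longrightarrow> u x = 0"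
    using u by (rule test_functionsE) blast
  have "local_potential \<Omega> (\<lambda>x. \<bar>q x\<bar>)"
    unfolding local_potential_def
  proof (intro conjI allI impI)
    show "(\<lambda>x. \<bar>q x\<bar>) \<in> borel_measurable lebesgue"
      using q unfolding local_potential_def by (auto intro: borel_measurable_abs)
    fix K assume "compact K \<and> K \<subseteq> \<Omega>"
    then have "integrable lebesgue (\<lambda>x. indicator K x * q x)" using q by (simp add: local_potential_def)
    then have "integrable lebesgue (\<lambda>x. \<bar>indicator K x * q x\<bar>)" by (rule integrable_abs)
    then show "integrable lebesgue (\<lambda>x. indicator K x * \<bar>q x\<bar>)" by (simp add: abs_mult)
  qed
  then have iq: "integrable lebesgue (\<lambda>x. \<bar>q x\<bar> * \<bar>u x\<bar>)"
    by (rule integrable_potential_times[OF _ _ K(2,3)])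
      (intro continuous_on_rabs smooth_continuous K(1), simp add: K(4))
  define J where "J = (\<integral>x. \<bar>q x\<bar> * \<bar>u x\<bar> \<partial>lebesgue)"
  have J: "J \<ge> 0" unfolding J_def by (rule integral_nonneg_AE) auto
  define \<epsilon> where "\<epsilon> = - qform q u / (4 * (J + 1))"
  have \<epsilon>: "\<epsilon> > 0" using neg J by (simp add: \<epsilon>_def divide_neg_pos)
  define w where "w x = u x * u x + \<epsilon>\<^sup>2" for x
  have wp: "w x > 0" for x using \<epsilon> by (simp add: w_def add_nonneg_pos)
  define v where "v x = sqrt (w x) + - \<epsilon>" for x
  have sv: "smooth v"
    unfolding v_def w_def using K(1) wp[unfolded w_def] by (intro allI C_k_add C_k_sqrt C_k_mult C_k_const) auto
  have v: "v \<in> test_functions \<Omega>"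
    by (rule test_functionsI[OF sv K(2,3)]) (use \<epsilon> in \<open>simp add: v_def w_def K(4)\<close>)
  have uw: "\<bar>u x\<bar> \<le> sqrt (w x)" for x
    by (simp add: w_def real_le_rsqrt power2_eq_square)
  have ew: "\<epsilon> \<le> sqrt (w x)" for x by (simp add: w_def real_le_rsqrt)
  have wu: "sqrt (w x) \<le> \<bar>u x\<bar> + \<epsilon>" for x
    unfolding w_def using \<epsilon> by (intro real_le_lsqrt) (auto simp: power2_eq_square algebra_simps abs_mult_self_eq)
  have v0: "v x \<ge> 0" for x using ew[of x] by (simp add: v_def)
  have Gv: "gradient v x = (u x / sqrt (w x)) *\<^sub>R gradient u x" for x
  proof (rule gradient_eqI)
    have w': "(w has_derivative (\<lambda>h. 2 * u x * (gradient u x \<bullet> h))) (at x)"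
      unfolding w_def by (auto intro!: derivative_eq_intros smooth_has_derivative[OF K(1)])
    have d: "((\<lambda>x. sqrt (w x)) has_derivative (\<lambda>h. inverse (sqrt (w x)) / 2 * (2 * u x * (gradient u x \<bullet> h)))) (at x)"
      by (rule has_derivative_compose[OF w' DERIV_real_sqrt[OF wp[of x], unfolded has_field_derivative_def]])
    show "(v has_derivative (\<lambda>h. ((u x / sqrt (w x)) *\<^sub>R gradient u x) \<bullet> h)) (at x)"
    proof -
      have e: "inverse a / 2 * (2 * b * c) + 0 = b / a * c" for a b c :: real
        by (cases "a = 0") (simp_all add: field_simps)
      have v: "v = (\<lambda>x. sqrt (w x) + - \<epsilon>)" by (simp add: v_def fun_eq_iff)
      show ?thesis
        using has_derivative_add[OF d has_derivative_const[of "- \<epsilon>"]]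
        unfolding v e inner_scaleR_left .
    qed
  qed
  have ptw: "(norm (gradient v x))\<^sup>2 + q x * (v x)\<^sup>2 \<le>
      ((norm (gradient u x))\<^sup>2 + q x * (u x)\<^sup>2) + 2 * \<epsilon> * (\<bar>q x\<bar> * \<bar>u x\<bar>)" for x
  proof -
    have "\<bar>u x / sqrt (w x)\<bar> \<le> 1" using uw[of x] wp[of x] by (simp add: abs_divide)
    then have "(u x / sqrt (w x))\<^sup>2 \<le> 1" by (simp only: abs_square_le_1)
    then have "(u x / sqrt (w x))\<^sup>2 * (norm (gradient u x))\<^sup>2 \<le> (norm (gradient u x))\<^sup>2"
      by (intro mult_left_le_one_le) auto
    then have g: "(norm (gradient v x))\<^sup>2 \<le> (norm (gradient u x))\<^sup>2"
      by (simp only: Gv norm_scaleR power_mult_distrib power2_abs)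
    have "(v x)\<^sup>2 = w x + \<epsilon>\<^sup>2 - 2 * \<epsilon> * sqrt (w x)"
      using wp[of x] by (simp add: v_def power2_diff[of "sqrt (w x)" \<epsilon>])
    then have d: "(v x)\<^sup>2 - (u x)\<^sup>2 = 2 * \<epsilon> * (\<epsilon> - sqrt (w x))"
      by (simp add: w_def power2_eq_square algebra_simps)
    have "\<bar>\<epsilon> - sqrt (w x)\<bar> \<le> \<bar>u x\<bar>" using ew[of x] wu[of x] by simp
    then have "\<bar>(v x)\<^sup>2 - (u x)\<^sup>2\<bar> \<le> 2 * \<epsilon> * \<bar>u x\<bar>" unfolding d using \<epsilon> by (simp add: abs_mult)
    then have "\<bar>q x\<bar> * \<bar>(v x)\<^sup>2 - (u x)\<^sup>2\<bar> \<le> \<bar>q x\<bar> * (2 * \<epsilon> * \<bar>u x\<bar>)" by (rule mult_left_mono) simp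
    moreover have "q x * ((v x)\<^sup>2 - (u x)\<^sup>2) \<le> \<bar>q x\<bar> * \<bar>(v x)\<^sup>2 - (u x)\<^sup>2\<bar>"
      by (metis abs_ge_self abs_mult)
    ultimately have "q x * (v x)\<^sup>2 \<le> q x * (u x)\<^sup>2 + 2 * \<epsilon> * (\<bar>q x\<bar> * \<bar>u x\<bar>)"
      by (simp add: algebra_simps)
    then show ?thesis using g by linarith
  qed
  have "qform q v \<le> (\<integral>x. ((norm (gradient u x))\<^sup>2 + q x * (u x)\<^sup>2) + 2 * \<epsilon> * (\<bar>q x\<bar> * \<bar>u x\<bar>) \<partial>lebesgue)"
    unfolding qform_def
    by (rule integral_mono[OF integrable_qform[OF q v] _ ptw])
      (intro Bochner_Integration.integrable_add integrable_qform[OF q u] integrable_mult_right iq)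
  also have "\<dots> = qform q u + 2 * \<epsilon> * J"
    unfolding qform_def J_def
    by (subst Bochner_Integration.integral_add[OF integrable_qform[OF q u] integrable_mult_right[OF iq]]) simp
  also have "2 * \<epsilon> * J \<le> - qform q u / 2"
  proof -
    have "2 * \<epsilon> * J \<le> 2 * \<epsilon> * (J + 1)" using \<epsilon> by simp
    also have "\<dots> = - qform q u / 2" 
    proof -
      have "J + 1 \<noteq> 0" using J by simp
      then show ?thesis unfolding \<epsilon>_def by (simp add: divide_simps)
    qed
    finally show ?thesis .
  qed
  finally have "qform q v < 0" using neg by simp
  then show ?thesis using that v v0 by blast
qed

lemma qform_scale:
  assumes "u \<in> test_functions \<Omega>"
  shows "qform q (\<lambda>x. c * u x) = c\<^sup>2 * qform q u"
proof -
  have "qform q (\<lambda>x. c * u x) = (\<integral>x. c\<^sup>2 * ((norm (gradient u x))\<^sup>2 + q x * (u x)\<^sup>2) \<partial>lebesgue)"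
    unfolding qform_def gradient_cmult[OF test_functions_smooth[OF assms]]
    by (simp add: power_mult_distrib algebra_simps)
  then show ?thesis by (simp add: qform_def)
qed

section \<open>Weights that are singular at the origin only\<close>

definition singular_weight :: "('a::euclidean_space \<Rightarrow> real) \<Rightarrow> bool" where
  "singular_weight V \<longleftrightarrow> V \<in> borel_measurable lebesgue \<and> (\<forall>x. V x \<ge> 0) \<and>
     (\<forall>\<rho>>0. integrable lebesgue (\<lambda>x. indicator {x. \<rho> \<le> norm x} x * V x powr (DIM('a) / 2)))"

lemma far_sets: "{x::'a::euclidean_space. \<rho> \<le> norm x} \<in> sets borel" "{x::'a::euclidean_space. \<rho> \<le> norm x} \<in> sets lebesgue"
proof -
  show "{x::'a. \<rho> \<le> norm x} \<in> sets borel"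
    by (intro borel_closed closed_Collect_le continuous_intros)
  then show "{x::'a. \<rho> \<le> norm x} \<in> sets lebesgue" by auto
qed

text \<open>Truncating \<open>V\<close> at a large height leaves a remainder whose \<open>L\<^bsup>n/2\<^esup>\<close> norm is small, so
  that the Sobolev inequality makes it infinitesimally form bounded.\<close>

lemma weight_absorbed:
  fixes V :: "'a::euclidean_space \<Rightarrow> real"
  assumes n3: "DIM('a) \<ge> 3" and V: "singular_weight V" and \<rho>: "\<rho> > 0" and \<epsilon>: "\<epsilon> > 0"
  obtains N where "N \<ge> 0" "\<And>\<Omega> w. w \<in> test_functions \<Omega> \<Longrightarrow> (\<And>x. norm x < \<rho> \<Longrightarrow> w x = 0) \<Longrightarrow>
    (\<integral>x. V x * (w x)\<^sup>2 \<partial>lebesgue) \<le>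
      \<epsilon> * (\<integral>x. (norm (gradient w x))\<^sup>2 \<partial>lebesgue) + N * (\<integral>x. (w x)\<^sup>2 \<partial>lebesgue)"
proof -
  define p where "p = real DIM('a) / 2"
  have p: "p > 0" by (simp add: p_def)
  obtain C :: real where C: "C > 0"
    "\<And>(g::'a \<Rightarrow> real) V I. g \<in> test_functions UNIV \<Longrightarrow> V \<in> borel_measurable lebesgue \<Longrightarrow>
      (\<And>x. V x \<ge> 0) \<Longrightarrow> integrable lebesgue (\<lambda>x. V x powr p) \<Longrightarrow>
      (\<integral>x. V x powr p \<partial>lebesgue) \<le> I \<Longrightarrow> I > 0 \<Longrightarrow>
      integrable lebesgue (\<lambda>x. V x * (g x)\<^sup>2) \<and>
      (\<integral>x. V x * (g x)\<^sup>2 \<partial>lebesgue) \<le>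
        C * I powr (2 / DIM('a)) * (\<integral>x. (norm (gradient g x))\<^sup>2 \<partial>lebesgue)"
    unfolding p_def by (rule sobolev_weighted[OF n3]) blast
  have Vm: "V \<in> borel_measurable lebesgue" and V0: "\<And>x. V x \<ge> 0"
    and Vi: "integrable lebesgue (\<lambda>x. indicator {x. \<rho> \<le> norm x} x * V x powr p)"
    using V \<rho> by (auto simp: singular_weight_def p_def)
  define T where "T N x = indicator {x. \<rho> \<le> norm x \<and> real N < V x} x * V x" for N :: nat and x
  have sets: "{x. \<rho> \<le> norm x \<and> real N < V x} \<in> sets lebesgue" for N
  proof -
    have "{x \<in> space lebesgue. real N < V x} \<in> sets lebesgue" using Vm by measurable
    then have "{x. \<rho> \<le> norm x} \<inter> {x. real N < V x} \<in> sets lebesgue" using far_sets(2) by auto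
    then show ?thesis by (simp add: Collect_conj_eq)
  qed
  have Tm: "T N \<in> borel_measurable lebesgue" for N
    unfolding T_def[abs_def] using Vm sets by (intro borel_measurable_times borel_measurable_indicator) auto
  have T0: "T N x \<ge> 0" for N x using V0 by (simp add: T_def)
  have Tp: "T N x powr p = indicator {x. \<rho> \<le> norm x \<and> real N < V x} x * V x powr p" for N x
    using p by (auto simp: T_def split: split_indicator)
  have Tpm: "(\<lambda>x. T N x powr p) \<in> borel_measurable lebesgue" for N
    using Tm[of N] by measurable
  have lim: "(\<lambda>N. \<integral>x. T N x powr p \<partial>lebesgue) \<longlonglongrightarrow> integral\<^sup>L lebesgue (\<lambda>x::'a. 0)"
  proof (rule integral_dominated_convergence[where w = "\<lambda>x. indicator {x. \<rho> \<le> norm x} x * V x powr p"])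
    show "AE x in lebesgue. (\<lambda>N. T N x powr p) \<longlonglongrightarrow> 0"
    proof (rule AE_I2)
      fix x
      obtain N0 :: nat where N0: "V x < real N0" using reals_Archimedean2 by blast
      have "\<forall>\<^sub>F N in sequentially. T N x powr p = 0"
        unfolding eventually_sequentially
      proof (intro exI[of _ N0] allI impI)
        fix N assume "N0 \<le> N"
        then show "T N x powr p = 0" using N0 by (auto simp: T_def)
      qed
      then show "(\<lambda>N. T N x powr p) \<longlonglongrightarrow> 0" by (rule tendsto_eventually)
    qed
    show "AE x in lebesgue. norm (T N x powr p) \<le> indicator {x. \<rho> \<le> norm x} x * V x powr p" for N
      by (rule AE_I2) (auto simp: Tp split: split_indicator)
  qed (use Tpm Vi in auto)
  define I where "I = (\<epsilon> / C) powr p"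
  have I: "I > 0" using \<epsilon> C by (simp add: I_def)
  have "\<forall>\<^sub>F N in sequentially. (\<integral>x. T N x powr p \<partial>lebesgue) < I"
    using lim I by (intro order_tendstoD) auto
  then obtain N :: nat where N: "(\<integral>x. T N x powr p \<partial>lebesgue) < I"
    unfolding eventually_sequentially by blast
  have Tpi: "integrable lebesgue (\<lambda>x. T N x powr p)"
    by (rule Bochner_Integration.integrable_bound[OF Vi Tpm]) (auto simp: Tp split: split_indicator)
  have CI: "C * I powr (2 / DIM('a)) = \<epsilon>"
    using \<epsilon> C p by (simp add: I_def powr_powr p_def)
  show ?thesis
  proof (rule that[of "real N"])
    fix \<Omega> and w :: "'a \<Rightarrow> real"
    assume w: "w \<in> test_functions \<Omega>" and wz: "\<And>x. norm x < \<rho> \<Longrightarrow> w x = 0"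
    have w': "w \<in> test_functions UNIV" using w test_functions_mono by blast
    have S: "integrable lebesgue (\<lambda>x. T N x * (w x)\<^sup>2)"
      "(\<integral>x. T N x * (w x)\<^sup>2 \<partial>lebesgue) \<le> \<epsilon> * (\<integral>x. (norm (gradient w x))\<^sup>2 \<partial>lebesgue)"
      using C(2)[OF w' Tm T0 Tpi, of I] N I by (auto simp: CI)
    have le: "V x * (w x)\<^sup>2 \<le> T N x * (w x)\<^sup>2 + real N * (w x)\<^sup>2" for x
    proof (cases "norm x < \<rho>")
      case False
      then have "V x \<le> T N x + real N" using V0[of x] by (auto simp: T_def split: split_indicator)
      from mult_right_mono[OF this, of "(w x)\<^sup>2"] show ?thesis by (simp add: distrib_right)
    qed (simp add: wz)
    have "(\<integral>x. V x * (w x)\<^sup>2 \<partial>lebesgue) \<le> (\<integral>x. T N x * (w x)\<^sup>2 + real N * (w x)\<^sup>2 \<partial>lebesgue)"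
      by (rule integral_mono') (use S(1) test_integrable(1)[OF w] le T0 in auto)
    also have "\<dots> = (\<integral>x. T N x * (w x)\<^sup>2 \<partial>lebesgue) + real N * (\<integral>x. (w x)\<^sup>2 \<partial>lebesgue)"
      using S(1) test_integrable(1)[OF w] by simp
    finally show "(\<integral>x. V x * (w x)\<^sup>2 \<partial>lebesgue) \<le>
      \<epsilon> * (\<integral>x. (norm (gradient w x))\<^sup>2 \<partial>lebesgue) + real N * (\<integral>x. (w x)\<^sup>2 \<partial>lebesgue)"
      using S(2) by simp
  qed simp
qed

text \<open>Uniform integrability of squares of test functions with bounded energy.\<close>

lemma test_sobolev_indicator:
  assumes n3: "DIM('a::euclidean_space) \<ge> 3"
  obtains C :: real where "C > 0"
    "\<And>(g::'a \<Rightarrow> real) \<Omega> A m. g \<in> test_functions \<Omega> \<Longrightarrow> A \<in> fmeasurable lebesgue \<Longrightarrow> measure lebesgue A \<le> m \<Longrightarrow> m > 0 \<Longrightarrow>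
      (\<integral>x. indicator A x * (g x)\<^sup>2 \<partial>lebesgue) \<le>
        C * m powr (2 / DIM('a)) * (\<integral>x. (norm (gradient g x))\<^sup>2 \<partial>lebesgue)"
proof -
  obtain C :: real where C: "C > 0"
    "\<And>(g::'a \<Rightarrow> real) V I. g \<in> test_functions UNIV \<Longrightarrow> V \<in> borel_measurable lebesgue \<Longrightarrow>
      (\<And>x. V x \<ge> 0) \<Longrightarrow> integrable lebesgue (\<lambda>x. V x powr (DIM('a) / 2)) \<Longrightarrow>
      (\<integral>x. V x powr (DIM('a) / 2) \<partial>lebesgue) \<le> I \<Longrightarrow> I > 0 \<Longrightarrow>
      integrable lebesgue (\<lambda>x. V x * (g x)\<^sup>2) \<and>
      (\<integral>x. V x * (g x)\<^sup>2 \<partial>lebesgue) \<le>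
        C * I powr (2 / DIM('a)) * (\<integral>x. (norm (gradient g x))\<^sup>2 \<partial>lebesgue)"
    by (rule sobolev_weighted[OF n3]) blast
  show ?thesis
  proof (rule that[OF C(1)])
    fix g :: "'a \<Rightarrow> real" and \<Omega> A :: "'a set" and m
    assume g: "g \<in> test_functions \<Omega>" and A: "A \<in> fmeasurable lebesgue" and m: "measure lebesgue A \<le> m" "m > 0"
    have ip: "indicator A x powr (DIM('a) / 2) = (indicator A x :: real)" for x :: 'a
      by (auto split: split_indicator)
    have "integrable lebesgue (indicator A :: 'a \<Rightarrow> real)"
      using A by (intro integrable_real_indicator) (auto simp: fmeasurable_def)
    moreover have "g \<in> test_functions UNIV" using g test_functions_mono by blast
    ultimately show "(\<integral>x. indicator A x * (g x)\<^sup>2 \<partial>lebesgue) \<le>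
        C * m powr (2 / DIM('a)) * (\<integral>x. (norm (gradient g x))\<^sup>2 \<partial>lebesgue)"
      using C(2)[of g "indicator A" m] A m unfolding ip by (auto simp: fmeasurableD)
  qed
qed

section \<open>The form with inverse-square and singular potential\<close>

definition dirichlet :: "('a::euclidean_space \<Rightarrow> real) \<Rightarrow> real" where
  "dirichlet u = (\<integral>x. (norm (gradient u x))\<^sup>2 \<partial>lebesgue)"

definition mass :: "('a::euclidean_space \<Rightarrow> real) \<Rightarrow> real" where
  "mass u = (\<integral>x. (u x)\<^sup>2 \<partial>lebesgue)"

definition inverse_square_mass :: "('a::euclidean_space \<Rightarrow> real) \<Rightarrow> real" where
  "inverse_square_mass u = (\<integral>x. (u x)\<^sup>2 / (norm x)\<^sup>2 \<partial>lebesgue)"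

definition weighted_mass :: "('a::euclidean_space \<Rightarrow> real) \<Rightarrow> ('a \<Rightarrow> real) \<Rightarrow> real" where
  "weighted_mass V u = (\<integral>x. V x * (u x)\<^sup>2 \<partial>lebesgue)"

definition far_mass :: "real \<Rightarrow> ('a::euclidean_space \<Rightarrow> real) \<Rightarrow> real" where
  "far_mass \<sigma> u = (\<integral>x. indicator {x. \<sigma> \<le> norm x} x * (u x)\<^sup>2 \<partial>lebesgue)"

lemma masses_nonneg: "dirichlet u \<ge> 0" "mass u \<ge> 0" "far_mass \<sigma> u \<ge> 0" "inverse_square_mass u \<ge> 0"
  unfolding dirichlet_def mass_def far_mass_def inverse_square_mass_def
  by (auto intro!: integral_nonneg_AE)

lemma weighted_mass_nonneg: "(\<And>x. V x \<ge> 0) \<Longrightarrow> weighted_mass V u \<ge> 0"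
  unfolding weighted_mass_def by (auto intro!: integral_nonneg_AE)

lemma compact_away_from_0:
  fixes K :: "'a::euclidean_space set"
  assumes "compact K" "0 \<notin> K"
  obtains \<rho> where "\<rho> > 0" "\<And>x. x \<in> K \<Longrightarrow> \<rho> < norm x"
proof -
  obtain d where d: "d > 0" "\<forall>x\<in>K. d \<le> dist 0 x"
    using separate_point_closed[of K 0] assms compact_imp_closed by blast
  show ?thesis by (rule that[of "d / 2"]) (use d in fastforce)+
qed

lemma singular_weight_local:
  fixes V :: "'a::euclidean_space \<Rightarrow> real"
  assumes V: "singular_weight V" and n3: "DIM('a) \<ge> 3" and \<Omega>: "0 \<notin> \<Omega>"
  shows "local_potential \<Omega> V"
  unfolding local_potential_def
proof (intro conjI allI impI)
  show Vm: "V \<in> borel_measurable lebesgue" using V by (simp add: singular_weight_def)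
  fix K assume K: "compact K \<and> K \<subseteq> \<Omega>"
  then obtain \<rho> where \<rho>: "\<rho> > 0" "\<And>x. x \<in> K \<Longrightarrow> \<rho> < norm x"
    using compact_away_from_0[of K] \<Omega> by blast
  define T where "T x = indicator {x. \<rho> \<le> norm x} x * V x" for x
  have Tp: "T x powr (DIM('a) / 2) = indicator {x. \<rho> \<le> norm x} x * V x powr (DIM('a) / 2)" for x
    by (auto simp: T_def split: split_indicator)
  have "integrable lebesgue (\<lambda>x. indicator K x * T x)"
  proof (rule weight_on_set_le(1))
    show "T \<in> borel_measurable lebesgue"
      unfolding T_def using Vm far_sets(2) by (intro borel_measurable_times borel_measurable_indicator)
    show "T x \<ge> 0" for x using V by (simp add: T_def singular_weight_def)
    show "integrable lebesgue (\<lambda>x. T x powr (real DIM('a) / 2))"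
      unfolding Tp using V \<rho>(1) by (simp add: singular_weight_def)
    show "1 < real DIM('a) / 2" using n3 by simp
    show "(\<integral>x. T x powr (real DIM('a) / 2) \<partial>lebesgue) \<le> \<bar>\<integral>x. T x powr (real DIM('a) / 2) \<partial>lebesgue\<bar> + 1" by simp
    show "0 < \<bar>\<integral>x. T x powr (real DIM('a) / 2) \<partial>lebesgue\<bar> + 1" by (rule add_nonneg_pos) auto
    show "K \<in> fmeasurable lebesgue" using K lmeasurable_compact by blast
  qed
  moreover have "indicator K x * T x = indicator K x * V x" for x
    using \<rho>(2)[of x] by (auto simp: T_def split: split_indicator)
  ultimately show "integrable lebesgue (\<lambda>x. indicator K x * V x)" by simp
qed

lemma inverse_square_local:
  fixes \<Omega> :: "'a::euclidean_space set"
  assumes "0 \<notin> \<Omega>"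
  shows "local_potential \<Omega> (\<lambda>x. 1 / (norm x)\<^sup>2)"
  unfolding local_potential_def
proof (intro conjI allI impI)
  have "(\<lambda>x::'a. 1 / (norm x)\<^sup>2) \<in> borel_measurable borel" by measurable
  then show "(\<lambda>x::'a. 1 / (norm x)\<^sup>2) \<in> borel_measurable lebesgue" by (rule borel_lebesgue)
  fix K assume K: "compact K \<and> K \<subseteq> \<Omega>"
  have "continuous_on K (\<lambda>x. 1 / (norm x)\<^sup>2)"
    using K assms by (intro continuous_intros) auto
  then have "integrable lborel (\<lambda>x. indicator K x *\<^sub>R (1 / (norm x)\<^sup>2))"
    using K borel_integrable_compact by blast
  then have "integrable lborel (\<lambda>x. indicator K x * (1 / (norm x)\<^sup>2))" by simp
  then show "integrable lebesgue (\<lambda>x. indicator K x * (1 / (norm x)\<^sup>2))" by (rule integrable_lborel_lebesgue)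
qed

lemma local_potential_combination:
  assumes "local_potential \<Omega> p" "local_potential \<Omega> q"
  shows "local_potential \<Omega> (\<lambda>x. l - a * p x - b * q x)"
  unfolding local_potential_def
proof (intro conjI allI impI)
  have [measurable]: "p \<in> borel_measurable lebesgue" "q \<in> borel_measurable lebesgue"
    using assms by (auto simp: local_potential_def)
  show "(\<lambda>x. l - a * p x - b * q x) \<in> borel_measurable lebesgue" by measurable
  fix K assume K: "compact K \<and> K \<subseteq> \<Omega>"
  then have "K \<in> fmeasurable lebesgue" using lmeasurable_compact by blast
  then have "integrable lebesgue (indicator K :: 'a \<Rightarrow> real)"
    by (intro integrable_real_indicator) (auto simp: fmeasurable_def)
  then have "integrable lebesgue (\<lambda>x. l * indicator K x - a * (indicator K x * p x) - b * (indicator K x * q x))"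
    using assms K by (intro Bochner_Integration.integrable_diff integrable_mult_right) (auto simp: local_potential_def)
  then show "integrable lebesgue (\<lambda>x. indicator K x * (l - a * p x - b * q x))"
    by (simp add: algebra_simps)
qed

definition hardy_potential :: "real \<Rightarrow> real \<Rightarrow> ('a::euclidean_space \<Rightarrow> real) \<Rightarrow> 'a \<Rightarrow> real" where
  "hardy_potential l b V x = l - (real DIM('a))\<^sup>2 / 4 * (1 / (norm x)\<^sup>2) - b * V x"

lemma mass_le_far_mass:
  assumes "u \<in> test_functions \<Omega>" "smooth \<phi>" "\<And>x. \<bar>\<phi> x\<bar> \<le> 1" "\<And>x. norm x < \<sigma> \<Longrightarrow> \<phi> x = 0"
  shows "mass (\<lambda>x. \<phi> x * u x) \<le> far_mass \<sigma> u"
  unfolding mass_def far_mass_def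
proof (rule integral_mono)
  show "integrable lebesgue (\<lambda>x. (\<phi> x * u x)\<^sup>2)"
    by (rule test_integrable(1)[OF test_functions_mult[OF assms(1,2)]])
  show "integrable lebesgue (\<lambda>x. indicator {x. \<sigma> \<le> norm x} x * (u x)\<^sup>2)"
    by (rule integrable_indicator_square[OF assms(1) far_sets(2)])
  fix x
  have "(\<phi> x)\<^sup>2 \<le> 1" using assms(3)[of x] by (simp add: abs_square_le_1)
  then have "(\<phi> x * u x)\<^sup>2 \<le> (u x)\<^sup>2" unfolding power_mult_distrib by (intro mult_left_le_one_le) auto
  then show "(\<phi> x * u x)\<^sup>2 \<le> indicator {x. \<sigma> \<le> norm x} x * (u x)\<^sup>2"
    using assms(4)[of x] by (cases "norm x < \<sigma>") auto
qed

lemma far_mass_le_mass: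
  assumes "u \<in> test_functions \<Omega>"
  shows "far_mass \<sigma> u \<le> mass u"
  unfolding mass_def far_mass_def
  by (rule integral_mono[OF integrable_indicator_square[OF assms far_sets(2)] test_integrable(1)[OF assms]])
    (auto split: split_indicator)

locale hardy_form =
  fixes \<Omega> :: "'a::euclidean_space set" and V :: "'a \<Rightarrow> real" and l b :: real
  assumes n3: "DIM('a) \<ge> 3" and \<Omega>0: "0 \<notin> \<Omega>" and V: "singular_weight V" and l: "l \<ge> 0" and b: "b \<ge> 0"
begin

abbreviation "q \<equiv> hardy_potential l b V"

lemma V_nonneg: "V x \<ge> 0" using V by (simp add: singular_weight_def)

lemma V_local: "local_potential \<Omega> V" by (rule singular_weight_local[OF V n3 \<Omega>0])

lemma q_local: "local_potential \<Omega> q"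
  unfolding hardy_potential_def[abs_def]
  by (rule local_potential_combination[OF inverse_square_local[OF \<Omega>0] V_local])

lemma q_le: "q x \<le> l"
proof -
  have "0 \<le> (real DIM('a))\<^sup>2 / 4 * (1 / (norm x)\<^sup>2)" "0 \<le> b * V x" using b V_nonneg[of x] by simp_all
  then show ?thesis unfolding hardy_potential_def by linarith
qed

lemma qform_eq:
  assumes u: "u \<in> test_functions \<Omega>"
  shows "qform q u = dirichlet u + l * mass u - (real DIM('a))\<^sup>2 / 4 * inverse_square_mass u - b * weighted_mass V u"
proof -
  note i1 = test_integrable(1)[OF u] and i2 = integrable_potential_square[OF inverse_square_local[OF \<Omega>0] u]
    and i3 = integrable_potential_square[OF V_local u]
  have "(\<integral>x. q x * (u x)\<^sup>2 \<partial>lebesgue) = (\<integral>x. l * (u x)\<^sup>2 -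
      (real DIM('a))\<^sup>2 / 4 * (1 / (norm x)\<^sup>2 * (u x)\<^sup>2) - b * (V x * (u x)\<^sup>2) \<partial>lebesgue)"
    by (simp add: hardy_potential_def algebra_simps)
  also have "\<dots> = l * mass u - (real DIM('a))\<^sup>2 / 4 * (\<integral>x. 1 / (norm x)\<^sup>2 * (u x)\<^sup>2 \<partial>lebesgue) - b * weighted_mass V u"
  proof -
    have "(\<integral>x. l * f1 x - c * f2 x - b * f3 x \<partial>lebesgue) =
        l * (\<integral>x. f1 x \<partial>lebesgue) - c * (\<integral>x. f2 x \<partial>lebesgue) - b * (\<integral>x. f3 x \<partial>lebesgue)"
      if "integrable lebesgue f1" "integrable lebesgue f2" "integrable lebesgue f3" for f1 f2 f3 :: "'a \<Rightarrow> real" and c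
      using that by simp
    from this[OF i1 i2 i3] show ?thesis unfolding mass_def weighted_mass_def .
  qed
  also have "(\<integral>x. 1 / (norm x)\<^sup>2 * (u x)\<^sup>2 \<partial>lebesgue) = inverse_square_mass u"
    by (simp add: inverse_square_mass_def)
  finally show ?thesis by (simp add: qform_split[OF q_local u] dirichlet_def)
qed

text \<open>Away from the origin the inverse square is bounded, and the weight costs at most half of
  the Dirichlet integral.\<close>

lemma coercive_off_0:
  assumes \<rho>: "\<rho> > 0"
  obtains N where "N \<ge> 0" "\<And>w. w \<in> test_functions \<Omega> \<Longrightarrow> (\<And>x. norm x < \<rho> \<Longrightarrow> w x = 0) \<Longrightarrow>
    dirichlet w / 2 \<le> qform q w + N * mass w"
proof -
  define \<epsilon> where "\<epsilon> = 1 / (2 * (b + 1))"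
  have \<epsilon>: "\<epsilon> > 0" "b * \<epsilon> \<le> 1 / 2" using b by (auto simp: \<epsilon>_def field_simps)
  obtain N where N: "N \<ge> 0" "\<And>\<Omega> w. w \<in> test_functions \<Omega> \<Longrightarrow> (\<And>x. norm x < \<rho> \<Longrightarrow> w x = 0) \<Longrightarrow>
    weighted_mass V w \<le> \<epsilon> * dirichlet w + N * mass w"
    unfolding weighted_mass_def dirichlet_def mass_def
    by (rule weight_absorbed[OF n3 V \<rho> \<epsilon>(1)]) blast
  define n where "n = (real DIM('a))\<^sup>2 / 4"
  have n: "n \<ge> 0" by (simp add: n_def)
  show ?thesis
  proof (rule that[of "n / \<rho>\<^sup>2 + b * N"])
    show "n / \<rho>\<^sup>2 + b * N \<ge> 0" using n b N by simp
    fix w assume w: "w \<in> test_functions \<Omega>" and z: "\<And>x. norm x < \<rho> \<Longrightarrow> w x = 0"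
    have "inverse_square_mass w \<le> (\<integral>x. 1 / \<rho>\<^sup>2 * (w x)\<^sup>2 \<partial>lebesgue)"
      unfolding inverse_square_mass_def
    proof (rule integral_mono')
      show "integrable lebesgue (\<lambda>x. 1 / \<rho>\<^sup>2 * (w x)\<^sup>2)" by (intro integrable_mult_right test_integrable(1)[OF w])
      fix x
      show "(w x)\<^sup>2 / (norm x)\<^sup>2 \<le> 1 / \<rho>\<^sup>2 * (w x)\<^sup>2"
      proof (cases "norm x < \<rho>")
        case False
        then have "\<rho>\<^sup>2 \<le> (norm x)\<^sup>2" using \<rho> by (intro power_mono) auto
        then have "(w x)\<^sup>2 / (norm x)\<^sup>2 \<le> (w x)\<^sup>2 / \<rho>\<^sup>2" using \<rho> by (intro frac_le) auto
        then show ?thesis by simp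
      qed (simp add: z)
    qed simp
    then have h: "inverse_square_mass w \<le> mass w / \<rho>\<^sup>2" by (simp add: mass_def)
    have "n * inverse_square_mass w \<le> n / \<rho>\<^sup>2 * mass w"
      using mult_left_mono[OF h n] by simp
    moreover have "b * weighted_mass V w \<le> b * (\<epsilon> * dirichlet w + N * mass w)"
      using b by (intro mult_left_mono N(2)[OF w z]) auto
    moreover have "b * \<epsilon> * dirichlet w \<le> 1 / 2 * dirichlet w"
      by (rule mult_right_mono[OF \<epsilon>(2) masses_nonneg(1)])
    moreover have "l * mass w \<ge> 0" using l masses_nonneg(2)[of w] by simp
    ultimately show "dirichlet w / 2 \<le> qform q w + (n / \<rho>\<^sup>2 + b * N) * mass w"
      unfolding qform_eq[OF w] n_def[symmetric] by (simp add: algebra_simps)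
  qed
qed

text \<open>Near-minimisers have bounded energy away from the origin: in the localisation formula the
  part near the origin is non-negative and may be dropped.\<close>

lemma caccioppoli:
  assumes pos: "\<And>u. u \<in> test_functions \<Omega> \<Longrightarrow> qform q u \<ge> 0" and \<rho>: "\<rho> > 0"
  obtains \<phi> N where "smooth \<phi>" "\<And>x. norm x \<ge> \<rho> \<Longrightarrow> \<phi> x = 1" "N \<ge> 0"
    "\<And>u. u \<in> test_functions \<Omega> \<Longrightarrow> dirichlet (\<lambda>x. \<phi> x * u x) \<le> 2 * (qform q u + N * mass u)"
proof -
  obtain \<chi>1 \<chi>2 :: "'a \<Rightarrow> real" and L where \<phi>: "smooth \<chi>1" "smooth \<chi>2" "\<And>x. (\<chi>1 x)\<^sup>2 + (\<chi>2 x)\<^sup>2 = 1"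
    "\<And>x. norm x \<ge> \<rho> \<Longrightarrow> \<chi>2 x = 1" "\<And>x. norm x \<le> \<rho> / 2 \<Longrightarrow> \<chi>2 x = 0" "L \<ge> 0"
    "\<And>x. (norm (gradient \<chi>1 x))\<^sup>2 + (norm (gradient \<chi>2 x))\<^sup>2 \<le> L * indicator {x. \<rho> / 2 \<le> norm x} x"
    by (rule smooth_cutoffs[OF \<rho>]) blast
  obtain N where N: "N \<ge> 0" "\<And>w. w \<in> test_functions \<Omega> \<Longrightarrow> (\<And>x. norm x < \<rho> / 2 \<Longrightarrow> w x = 0) \<Longrightarrow>
    dirichlet w / 2 \<le> qform q w + N * mass w"
    by (rule coercive_off_0[of "\<rho> / 2"]) (use \<rho> in auto)
  have \<phi>b: "\<bar>\<chi>2 x\<bar> \<le> 1" for x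
  proof -
    have "(\<chi>2 x)\<^sup>2 \<le> 1" using \<phi>(3)[of x] zero_le_power2[of "\<chi>1 x"] by linarith
    then show ?thesis by (simp add: abs_square_le_1)
  qed
  show ?thesis
  proof (rule that[OF \<phi>(2,4), of "N + L"])
    fix u assume u: "u \<in> test_functions \<Omega>"
    note t1 = test_functions_mult[OF u \<phi>(1)] and t2 = test_functions_mult[OF u \<phi>(2)]
    have "qform q (\<lambda>x. \<chi>1 x * u x) + qform q (\<lambda>x. \<chi>2 x * u x) \<le> qform q u + L * far_mass (\<rho> / 2) u"
      unfolding far_mass_def by (rule ims_localisation[OF q_local u \<phi>(1,2,3) far_sets(2) \<phi>(7)])
    moreover have "qform q (\<lambda>x. \<chi>1 x * u x) \<ge> 0" by (rule pos[OF t1])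
    moreover have "dirichlet (\<lambda>x. \<chi>2 x * u x) / 2 \<le> qform q (\<lambda>x. \<chi>2 x * u x) + N * mass (\<lambda>x. \<chi>2 x * u x)"
      by (rule N(2)[OF t2]) (simp add: \<phi>(5))
    moreover have "mass (\<lambda>x. \<chi>2 x * u x) \<le> far_mass (\<rho> / 2) u"
      by (rule mass_le_far_mass[OF u \<phi>(2) \<phi>b]) (simp add: \<phi>(5))
    then have "N * mass (\<lambda>x. \<chi>2 x * u x) \<le> N * mass u" "L * far_mass (\<rho> / 2) u \<le> L * mass u"
      using far_mass_le_mass[OF u, of "\<rho> / 2"] N(1) \<phi>(6) by (auto intro!: mult_left_mono)
    ultimately show "dirichlet (\<lambda>x. \<chi>2 x * u x) \<le> 2 * (qform q u + (N + L) * mass u)"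
      by (simp add: algebra_simps)
  qed (use N(1) \<phi>(6) in auto)
qed

text \<open>The cutoff is placed inside the ball where the form is coercive; the localisation
  error and the mass of the outer part both live off a smaller ball.\<close>

lemma coercive_up_to_far_mass:
  assumes r: "r > 0" and \<delta>: "\<delta> > 0"
    and near: "\<And>w. w \<in> test_functions (\<Omega> \<inter> ball 0 r) \<Longrightarrow> \<delta> * (weighted_mass V w + mass w) \<le> qform q w"
  obtains \<sigma> N \<delta>' where "\<sigma> > 0" "N \<ge> 0" "\<delta>' > 0"
    "\<And>u. u \<in> test_functions \<Omega> \<Longrightarrow> \<delta>' * (weighted_mass V u + mass u) \<le> qform q u + N * far_mass \<sigma> u"
proof -
  define \<rho> where "\<rho> = r / 2"
  have \<rho>: "\<rho> > 0" "\<rho> < r" using r by (auto simp: \<rho>_def)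
  obtain \<chi>1 \<chi>2 :: "'a \<Rightarrow> real" and L where \<phi>: "smooth \<chi>1" "smooth \<chi>2" "\<And>x. (\<chi>1 x)\<^sup>2 + (\<chi>2 x)\<^sup>2 = 1"
    "\<And>x. norm x \<ge> \<rho> \<Longrightarrow> \<chi>1 x = 0" "\<And>x. norm x \<le> \<rho> / 2 \<Longrightarrow> \<chi>2 x = 0" "L \<ge> 0"
    "\<And>x. (norm (gradient \<chi>1 x))\<^sup>2 + (norm (gradient \<chi>2 x))\<^sup>2 \<le> L * indicator {x. \<rho> / 2 \<le> norm x} x"
    by (rule smooth_cutoffs[OF \<rho>(1)]) blast
  have \<rho>2: "\<rho> / 2 > 0" using \<rho> by simp
  obtain N where N: "N \<ge> 0" "\<And>w. w \<in> test_functions \<Omega> \<Longrightarrow> (\<And>x. norm x < \<rho> / 2 \<Longrightarrow> w x = 0) \<Longrightarrow>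
    dirichlet w / 2 \<le> qform q w + N * mass w"
    by (rule coercive_off_0[OF \<rho>2]) blast
  obtain N' where N': "N' \<ge> 0" "\<And>\<Omega> w. w \<in> test_functions \<Omega> \<Longrightarrow> (\<And>x. norm x < \<rho> / 2 \<Longrightarrow> w x = 0) \<Longrightarrow>
    weighted_mass V w \<le> 1 * dirichlet w + N' * mass w"
    unfolding weighted_mass_def dirichlet_def mass_def
    by (rule weight_absorbed[OF n3 V \<rho>2 zero_less_one]) blast
  have \<phi>b: "\<bar>\<chi>2 x\<bar> \<le> 1" for x
  proof -
    have "(\<chi>2 x)\<^sup>2 \<le> 1" using \<phi>(3)[of x] zero_le_power2[of "\<chi>1 x"] by linarith
    then show ?thesis by (simp add: abs_square_le_1)
  qed
  define \<delta>' where "\<delta>' = min \<delta> (1 / 2)"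
  have \<delta>': "\<delta>' > 0" "\<delta>' \<le> \<delta>" "\<delta>' \<le> 1 / 2" using \<delta> by (auto simp: \<delta>'_def)
  show ?thesis
  proof (rule that[OF \<rho>2 _ \<delta>'(1), of "N + L + N' + 1"])
    fix u assume u: "u \<in> test_functions \<Omega>"
    note t1 = test_functions_mult[OF u \<phi>(1)] and t2 = test_functions_mult[OF u \<phi>(2)]
    define w1 where "w1 x = \<chi>1 x * u x" for x
    define w2 where "w2 x = \<chi>2 x * u x" for x
    have tw: "w1 \<in> test_functions \<Omega>" "w2 \<in> test_functions \<Omega>" unfolding w1_def w2_def by (rule t1 t2)+
    obtain K where K: "compact K" "K \<subseteq> \<Omega>" "\<And>x. x \<notin> K \<Longrightarrow> u x = 0"
      using u by (rule test_functionsE) blast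
    have w1t: "w1 \<in> test_functions (\<Omega> \<inter> ball 0 r)"
    proof (rule test_functionsI[of _ "K \<inter> cball 0 \<rho>"])
      show "smooth w1" using tw(1) by (rule test_functions_smooth)
      show "compact (K \<inter> cball 0 \<rho>)" using K(1) by (intro compact_Int_closed) auto
      show "K \<inter> cball 0 \<rho> \<subseteq> \<Omega> \<inter> ball 0 r" using K(2) \<rho>(2) by auto
      show "w1 x = 0" if "x \<notin> K \<inter> cball 0 \<rho>" for x
        using that K(3)[of x] \<phi>(4)[of x] by (auto simp: w1_def)
    qed
    have part: "(u x)\<^sup>2 = (w1 x)\<^sup>2 + (w2 x)\<^sup>2" for x
    proof -
      have "(w1 x)\<^sup>2 + (w2 x)\<^sup>2 = ((\<chi>1 x)\<^sup>2 + (\<chi>2 x)\<^sup>2) * (u x)\<^sup>2"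
        by (simp add: w1_def w2_def power_mult_distrib distrib_right)
      then show ?thesis by (simp add: \<phi>(3))
    qed
    have m: "mass u = mass w1 + mass w2"
      unfolding mass_def part using test_integrable(1)[OF tw(1)] test_integrable(1)[OF tw(2)] by simp
    have wm: "weighted_mass V u = weighted_mass V w1 + weighted_mass V w2"
      unfolding weighted_mass_def part distrib_left
      using integrable_potential_square[OF V_local tw(1)] integrable_potential_square[OF V_local tw(2)] by simp
    have ims: "qform q w1 + qform q w2 \<le> qform q u + L * far_mass (\<rho> / 2) u"
      unfolding w1_def w2_def far_mass_def by (rule ims_localisation[OF q_local u \<phi>(1,2,3) far_sets(2) \<phi>(7)])
    have n1: "\<delta>' * (weighted_mass V w1 + mass w1) \<le> qform q w1"
    proof -
      have "\<delta>' * (weighted_mass V w1 + mass w1) \<le> \<delta> * (weighted_mass V w1 + mass w1)"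
        using \<delta>'(2) by (intro mult_right_mono add_nonneg_nonneg weighted_mass_nonneg V_nonneg masses_nonneg)
      then show ?thesis using near[OF w1t] by simp
    qed
    have z2: "w2 x = 0" if "norm x < \<rho> / 2" for x using that by (simp add: w2_def \<phi>(5))
    have n2: "dirichlet w2 / 2 \<le> qform q w2 + N * mass w2" by (rule N(2)[OF tw(2) z2])
    have n3: "weighted_mass V w2 \<le> dirichlet w2 + N' * mass w2" using N'(2)[OF tw(2) z2] by simp
    have m2: "mass w2 \<le> far_mass (\<rho> / 2) u"
      unfolding w2_def by (rule mass_le_far_mass[OF u \<phi>(2) \<phi>b]) (simp add: \<phi>(5))
    have "\<delta>' * (weighted_mass V w2 + mass w2) \<le> 1 / 2 * (dirichlet w2 + (N' + 1) * mass w2)"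
    proof (rule mult_mono)
      show "weighted_mass V w2 + mass w2 \<le> dirichlet w2 + (N' + 1) * mass w2"
        using n3 by (simp add: algebra_simps)
      show "0 \<le> weighted_mass V w2 + mass w2"
        by (intro add_nonneg_nonneg weighted_mass_nonneg V_nonneg masses_nonneg)
    qed (use \<delta>' in auto)
    also have "\<dots> \<le> qform q w2 + (N + N' + 1) * mass w2"
    proof -
      have alg: "1 / 2 * (D + (N' + 1) * c) \<le> Q + (N + N' + 1) * c"
        if "D / 2 \<le> Q + N * c" "0 \<le> c" "0 \<le> N' * c" for D Q c :: real
        using that by (simp add: distrib_right distrib_left)
      show ?thesis
        by (rule alg[OF n2 masses_nonneg(2) mult_nonneg_nonneg[OF N'(1) masses_nonneg(2)]])
    qed
    finally have "\<delta>' * (weighted_mass V w2 + mass w2) \<le> qform q w2 + (N + N' + 1) * mass w2" .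
    moreover have "(N + N' + 1) * mass w2 \<le> (N + N' + 1) * far_mass (\<rho> / 2) u"
      using m2 N(1) N'(1) by (intro mult_left_mono) auto
    ultimately show "\<delta>' * (weighted_mass V u + mass u) \<le> qform q u + (N + L + N' + 1) * far_mass (\<rho> / 2) u"
      using n1 ims unfolding m wm by (simp add: algebra_simps)
  qed (use N(1) N'(1) \<phi>(6) in auto)
qed

end

text \<open>The set \<open>E\<close> is a closed part of a superlevel set of \<open>W\<close>, hence Borel, on one of
  countably many balls covering \<open>\<Omega>\<close>.\<close>

lemma positive_on_part_of_ball:
  fixes W :: "'a::euclidean_space \<Rightarrow> real"
  assumes \<Omega>: "open \<Omega>" and W: "W \<in> borel_measurable lebesgue" "\<And>x. W x \<ge> 0"
    and nz: "\<not> (AE x in lebesgue. x \<in> \<Omega> \<longrightarrow> W x = 0)"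
  obtains a s w0 E where "s > 0" "cball a (2 * s) \<subseteq> \<Omega>" "w0 > 0" "E \<subseteq> ball a s" "E \<in> sets borel"
    "measure lborel E > 0" "\<And>x. x \<in> E \<Longrightarrow> w0 \<le> W x"
proof -
  define \<F> where "\<F> = {ball a s |a s. s > 0 \<and> cball a (2 * s) \<subseteq> \<Omega>}"
  have op: "open S" if "S \<in> \<F>" for S using that by (auto simp: \<F>_def)
  obtain \<F>' where \<F>': "\<F>' \<subseteq> \<F>" "countable \<F>'" "\<Union>\<F>' = \<Union>\<F>"
    by (rule Lindelof[of \<F>]) (use op in auto)
  have cover: "\<Omega> \<subseteq> \<Union>\<F>"
  proof
    fix x assume "x \<in> \<Omega>"
    then obtain e where e: "e > 0" "cball x e \<subseteq> \<Omega>" using \<Omega> open_contains_cball by blast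
    then have "ball x (e / 2) \<in> \<F>" unfolding \<F>_def by (intro CollectI exI[of _ x] exI[of _ "e / 2"]) auto
    then show "x \<in> \<Union>\<F>" using e(1) by (meson UnionI centre_in_ball half_gt_zero)
  qed
  have "\<exists>S\<in>\<F>'. \<not> (AE x in lebesgue. x \<in> S \<longrightarrow> W x = 0)"
  proof (rule ccontr)
    assume "\<not> ?thesis"
    then have "AE x in lebesgue. \<forall>S\<in>\<F>'. x \<in> S \<longrightarrow> W x = 0"
      by (subst AE_ball_countable[OF \<F>'(2)]) blast
    then have "AE x in lebesgue. x \<in> \<Omega> \<longrightarrow> W x = 0"
      by (rule eventually_mono) (use cover \<F>'(3) in blast)
    then show False using nz by simp
  qed
  then obtain a s where s: "s > 0" "cball a (2 * s) \<subseteq> \<Omega>" and nzb: "\<not> (AE x in lebesgue. x \<in> ball a s \<longrightarrow> W x = 0)"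
    using \<F>'(1) unfolding \<F>_def by blast
  define P where "P k = {x. x \<in> ball a s \<and> 1 / real (Suc k) \<le> W x}" for k
  have Pm: "P k \<in> sets lebesgue" for k
  proof -
    have "{x \<in> space lebesgue. 1 / real (Suc k) \<le> W x} \<in> sets lebesgue" using W(1) by measurable
    moreover have "ball a s \<in> sets lebesgue" by simp
    ultimately have "ball a s \<inter> {x \<in> space lebesgue. 1 / real (Suc k) \<le> W x} \<in> sets lebesgue" by (rule sets.Int[rotated])
    then show ?thesis by (simp add: P_def Int_def)
  qed
  have "\<exists>k. P k \<notin> null_sets lebesgue"
  proof (rule ccontr)
    assume "\<not> ?thesis"
    then have "(\<Union>k. P k) \<in> null_sets lebesgue" by (intro null_sets_UN) auto
    then have "AE x in lebesgue. x \<notin> (\<Union>k. P k)" by (rule AE_not_in)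
    then have "AE x in lebesgue. x \<in> ball a s \<longrightarrow> W x = 0"
    proof (rule eventually_mono)
      fix x assume x: "x \<notin> (\<Union>k. P k)"
      show "x \<in> ball a s \<longrightarrow> W x = 0"
      proof (rule impI, rule ccontr)
        assume "x \<in> ball a s" "W x \<noteq> 0"
        then have "W x > 0" using W(2)[of x] by simp
        then obtain k where "inverse (real (Suc k)) < W x" using reals_Archimedean by blast
        then have "x \<in> P k" using \<open>x \<in> ball a s\<close> by (simp add: P_def inverse_eq_divide)
        then show False using x by blast
      qed
    qed
    then show False using nzb by simp
  qed
  then obtain k where k: "P k \<notin> null_sets lebesgue" by blast
  have Psub: "P k \<subseteq> ball a s" by (auto simp: P_def)
  have "emeasure lebesgue (ball a s) < \<infinity>" using emeasure_bounded_finite[of "ball a s"] by simp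
  then have Pfin: "emeasure lebesgue (P k) < \<infinity>"
    using emeasure_mono[OF Psub, of lebesgue] by (auto simp: top_unique less_top)
  have Ppos: "emeasure lebesgue (P k) \<noteq> 0" using k Pm by (auto simp: null_sets_def)
  define e where "e = measure lebesgue (P k)"
  have eP: "emeasure lebesgue (P k) = ennreal e"
    unfolding e_def using Pfin by (intro emeasure_eq_ennreal_measure) auto
  have e: "e > 0" using Ppos eP by (cases "e = 0") (auto simp: e_def less_le)
  obtain T where T: "closed T" "T \<subseteq> P k" "P k - T \<in> lmeasurable" "emeasure lebesgue (P k - T) < ennreal e"
    by (rule sets_lebesgue_inner_closed[OF Pm e])
  have Tb: "T \<in> sets borel" using T(1) by simp
  have "emeasure lebesgue (P k) \<le> emeasure lebesgue T + emeasure lebesgue (P k - T)"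
    using emeasure_subadditive[of T lebesgue "P k - T"] T Pm Tb by (simp add: Un_absorb1)
  then have "emeasure lebesgue T \<noteq> 0" using T(4) eP by auto
  then have T0: "emeasure lborel T \<noteq> 0" using Tb by simp
  have "emeasure lborel T \<le> emeasure lborel (ball a s)" using T(2) Psub by (intro emeasure_mono) auto
  then have "emeasure lborel T \<noteq> \<infinity>" using emeasure_bounded_finite[of "ball a s"] by (auto simp: top_unique)
  then have "measure lborel T > 0" using T0 by (simp add: measure_def enn2real_positive_iff less_top zero_less_iff_neq_zero)
  then show ?thesis
    using that[of s a "1 / real (Suc k)" T] s T(2) Psub Tb by (auto simp: P_def)
qed

section \<open>A gap for improvable forms\<close>

context hardy_form
begin

text \<open>The spectral gap: an improved inequality excludes near-minimisers, because they would have to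
  vanish where \<open>W\<close> is positive, hence everywhere.\<close>

lemma far_mass_gap:
  assumes \<Omega>: "open \<Omega>" "connected \<Omega>" "bounded \<Omega>"
    and pos: "\<And>u. u \<in> test_functions \<Omega> \<Longrightarrow> qform q u \<ge> 0"
    and \<sigma>: "\<sigma> > 0" and N: "N \<ge> 0" and \<delta>: "\<delta> > 0"
    and coer: "\<And>u. u \<in> test_functions \<Omega> \<Longrightarrow> \<delta> * (weighted_mass V u + mass u) \<le> qform q u + N * far_mass \<sigma> u"
    and W: "singular_weight W" and nz: "\<not> (AE x in lebesgue. x \<in> \<Omega> \<longrightarrow> W x = 0)" and C: "C > 0"
    and imp: "\<And>u. u \<in> test_functions \<Omega> \<Longrightarrow> C * weighted_mass W u \<le> qform q u"
  obtains c where "c > 0" "\<And>u. u \<in> test_functions \<Omega> \<Longrightarrow> c * far_mass \<sigma> u \<le> qform q u"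
proof (rule ccontr)
  note gap = that
  assume contra: "\<not> thesis"
  have neg: "\<exists>u\<in>test_functions \<Omega>. qform q u < c * far_mass \<sigma> u" if c: "c > 0" for c
    using gap[OF c] contra by (meson not_le_imp_less)
  have W0: "W x \<ge> 0" for x using W by (simp add: singular_weight_def)
  have Wloc: "local_potential \<Omega> W" by (rule singular_weight_local[OF W n3 \<Omega>0])
  have "\<exists>v. v \<in> test_functions \<Omega> \<and> (\<forall>x. v x \<ge> 0) \<and> far_mass \<sigma> v = 1 \<and> qform q v < 1 / real (Suc k)" for k
  proof -
    define c where "c = 1 / real (Suc k)"
    have c: "c > 0" by (simp add: c_def)
    obtain u where u: "u \<in> test_functions \<Omega>" "qform q u < c * far_mass \<sigma> u" using neg[OF c] by blast
    \<comment> \<open>Moving the far mass into the potential makes \<open>nonneg_test_function\<close> applicable.\<close>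
    define q' where "q' x = q x - c * indicator {x. \<sigma> \<le> norm x} x" for x
    have split: "qform q' v = qform q v - c * far_mass \<sigma> v" if v: "v \<in> test_functions \<Omega>" for v
    proof -
      have "(\<integral>x. f x - c * g x \<partial>lebesgue) = (\<integral>x. f x \<partial>lebesgue) - c * (\<integral>x. g x \<partial>lebesgue)"
        if "integrable lebesgue f" "integrable lebesgue g" for f g :: "'a \<Rightarrow> real"
        using that by simp
      from this[OF integrable_qform[OF q_local v] integrable_indicator_square[OF v far_sets(2), of \<sigma>]]
      show ?thesis by (simp add: qform_def far_mass_def q'_def algebra_simps)
    qed
    have q'loc: "local_potential \<Omega> q'"
    proof -
      have "local_potential \<Omega> (\<lambda>x. indicator {x. \<sigma> \<le> norm x} x :: real)"
        unfolding local_potential_def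
      proof (intro conjI allI impI)
        show "(\<lambda>x. indicator {x. \<sigma> \<le> norm x} x) \<in> borel_measurable lebesgue"
          by (rule borel_measurable_indicator[OF far_sets(2)])
        fix K :: "'a set" assume "compact K \<and> K \<subseteq> \<Omega>"
        then have "K \<inter> {x. \<sigma> \<le> norm x} \<in> fmeasurable lebesgue"
          using lmeasurable_compact far_sets(2) by (intro fmeasurable_Int_fmeasurable) auto
        then have "integrable lebesgue (\<lambda>x. indicator (K \<inter> {x. \<sigma> \<le> norm x}) x :: real)"
          by (intro integrable_real_indicator) (auto simp: fmeasurable_def)
        then show "integrable lebesgue (\<lambda>x. indicator K x * (indicator {x. \<sigma> \<le> norm x} x :: real))"
          by (simp only: indicator_inter_arith)
      qed
      from local_potential_combination[OF q_local this, of 0 "-1" c] show ?thesis by (simp add: q'_def[abs_def])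
    qed
    obtain v where v: "v \<in> test_functions \<Omega>" "\<And>x. v x \<ge> 0" "qform q' v < 0"
      by (rule nonneg_test_function[OF q'loc u(1)]) (use u split[OF u(1)] in auto)
    then have lt: "qform q v < c * far_mass \<sigma> v" using split by simp
    then have fp: "far_mass \<sigma> v > 0"
      using pos[OF v(1)] c masses_nonneg(3)[of \<sigma> v] by (cases "far_mass \<sigma> v = 0") auto
    define a where "a = 1 / sqrt (far_mass \<sigma> v)"
    have a: "a > 0" "a\<^sup>2 * far_mass \<sigma> v = 1" using fp by (auto simp: a_def power_divide)
    have t: "(\<lambda>x. a * v x) \<in> test_functions \<Omega>"
      by (rule test_functions_mult[OF v(1)]) (auto intro: C_k_const)
    have "far_mass \<sigma> (\<lambda>x. a * v x) = (\<integral>x. a\<^sup>2 * (indicator {x. \<sigma> \<le> norm x} x * (v x)\<^sup>2) \<partial>lebesgue)"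
      unfolding far_mass_def by (simp add: power_mult_distrib mult_ac)
    then have f1: "far_mass \<sigma> (\<lambda>x. a * v x) = 1" using a(2) by (simp add: far_mass_def)
    have "qform q (\<lambda>x. a * v x) = a\<^sup>2 * qform q v" by (rule qform_scale[OF v(1)])
    also have "\<dots> < a\<^sup>2 * (c * far_mass \<sigma> v)" using lt a(1) by simp
    also have "\<dots> = c" using a(2) by (simp add: mult_ac)
    finally show ?thesis using t f1 v(2) a(1) unfolding c_def by (intro exI[of _ "\<lambda>x. a * v x"]) auto
  qed
  then obtain v where v: "\<And>k. v k \<in> test_functions \<Omega>" "\<And>k x. v k x \<ge> 0" "\<And>k. far_mass \<sigma> (v k) = 1"
    "\<And>k. qform q (v k) < 1 / real (Suc k)"
    by metis
  have inv0: "(\<lambda>k. 1 / real (Suc k)) \<longlonglongrightarrow> 0"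
    using LIMSEQ_inverse_real_of_nat by (simp add: inverse_eq_divide)
  have lim: "(\<lambda>k. qform q (v k)) \<longlonglongrightarrow> 0"
    by (rule tendsto_sandwich[OF _ _ tendsto_const inv0]) (use pos v(1,4) in \<open>auto intro!: always_eventually less_imp_le\<close>)
  have q1: "qform q (v k) \<le> 1" for k
  proof -
    have "1 / real (Suc k) \<le> 1" by simp
    then show ?thesis using v(4)[of k] by linarith
  qed
  define M where "M = (1 + N) / \<delta>"
  have mM: "mass (v k) \<le> M" for k
  proof -
    have "\<delta> * mass (v k) \<le> \<delta> * (weighted_mass V (v k) + mass (v k))"
      using \<delta> weighted_mass_nonneg[of V, OF V_nonneg] by (intro mult_left_mono) auto
    also have "\<dots> \<le> 1 + N" using coer[OF v(1)[of k]] q1[of k] v(3)[of k] by simp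
    finally show ?thesis using \<delta> by (simp add: M_def field_simps)
  qed
  have gb: "\<exists>\<phi> R. smooth \<phi> \<and> (\<forall>x. norm x \<ge> \<rho> \<longrightarrow> \<phi> x = 1) \<and> (\<forall>k. dirichlet (\<lambda>x. \<phi> x * v k x) \<le> R)"
    if \<rho>: "\<rho> > 0" for \<rho>
  proof (rule caccioppoli[OF pos \<rho>])
    fix \<phi> N'
    assume \<phi>: "smooth \<phi>" "\<And>x. norm x \<ge> \<rho> \<Longrightarrow> \<phi> x = 1" "N' \<ge> 0"
      and le: "\<And>u. u \<in> test_functions \<Omega> \<Longrightarrow> dirichlet (\<lambda>x. \<phi> x * u x) \<le> 2 * (qform q u + N' * mass u)"
    have "dirichlet (\<lambda>x. \<phi> x * v k x) \<le> 2 * (1 + N' * M)" for k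
      using le[OF v(1)[of k]] q1[of k] mult_left_mono[OF mM[of k] \<phi>(3)] by simp
    then show ?thesis
      using \<phi>(1,2) by (intro exI[of _ \<phi>] exI[of _ "2 * (1 + N' * M)"] conjI allI impI) auto
  qed
  have eb: "\<exists>R. \<forall>k. (\<integral>x. indicator (cball a s) x * (norm (gradient (v k) x))\<^sup>2 \<partial>lebesgue) \<le> R"
    if sub: "cball a s \<subseteq> \<Omega>" for a s
  proof -
    have "0 \<notin> cball a s" using sub \<Omega>0 by blast
    then obtain \<rho> where \<rho>: "\<rho> > 0" "\<And>x. x \<in> cball a s \<Longrightarrow> \<rho> < norm x"
      by (rule compact_away_from_0[OF compact_cball]) blast
    obtain \<phi> R where \<phi>: "smooth \<phi>" "\<And>x. norm x \<ge> \<rho> \<Longrightarrow> \<phi> x = 1" "\<And>k. dirichlet (\<lambda>x. \<phi> x * v k x) \<le> R"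
      using gb[OF \<rho>(1)] by auto
    have "(\<integral>x. indicator (cball a s) x * (norm (gradient (v k) x))\<^sup>2 \<partial>lebesgue) \<le> R" for k
    proof -
      have t: "(\<lambda>x. \<phi> x * v k x) \<in> test_functions \<Omega>" by (rule test_functions_mult[OF v(1) \<phi>(1)])
      have o: "open {x::'a. \<rho> < norm x}" by (intro open_Collect_less continuous_intros)
      have "gradient (v k) x = gradient (\<lambda>x. \<phi> x * v k x) x" if "x \<in> cball a s" for x
        by (rule gradient_eq_on_open[OF o _ _ test_functions_smooth[OF t]]) (use \<rho>(2)[OF that] \<phi>(2) in auto)
      then have "(\<integral>x. indicator (cball a s) x * (norm (gradient (v k) x))\<^sup>2 \<partial>lebesgue) \<le>
          (\<integral>x. (norm (gradient (\<lambda>x. \<phi> x * v k x) x))\<^sup>2 \<partial>lebesgue)"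
        by (intro integral_mono' test_integrable(2)[OF t]) (auto split: split_indicator)
      then show ?thesis using \<phi>(3)[of k] by (simp add: dirichlet_def)
    qed
    then show ?thesis by blast
  qed
  interpret near_minimisers \<Omega> q l v
    by unfold_locales (use q_local q_le l pos v lim eb in auto)
  have Wm: "W \<in> borel_measurable lebesgue" using W by (simp add: singular_weight_def)
  obtain a s w0 E where E: "s > 0" "cball a (2 * s) \<subseteq> \<Omega>" "w0 > 0" "E \<subseteq> ball a s" "E \<in> sets borel"
    "measure lborel E > 0" "\<And>x. x \<in> E \<Longrightarrow> w0 \<le> W x"
    by (rule positive_on_part_of_ball[OF \<Omega>(1) Wm W0 nz]) blast
  have bE: "bounded E" using E(4) bounded_subset bounded_ball by blast
  have vanE: "vanishes_in_measure v E"
    unfolding vanishes_in_measure_def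
  proof (intro allI impI)
    fix d :: real assume d: "d > 0"
    have le: "measure lborel {x \<in> E. v k x > d} \<le> (1 / real (Suc k)) * (1 / (C * w0 * d\<^sup>2))" for k
    proof -
      define F where "F = {x \<in> E. v k x > d}"
      have F: "F \<in> fmeasurable lborel" unfolding F_def by (rule superlevel_in_fmeasurable(1)[OF v(1) E(5) bE])
      then have Fs: "F \<in> sets lborel" by (rule fmeasurableD)
      then have Fl: "measure lebesgue F = measure lborel F" by simp
      have iF: "integrable lebesgue (indicator F :: 'a \<Rightarrow> real)"
        using F by (intro integrable_real_indicator) (auto simp: fmeasurable_def)
      have "w0 * d\<^sup>2 * measure lborel F = (\<integral>x. (w0 * d\<^sup>2) * indicator F x \<partial>lebesgue)"
        using Fs by simp
      also have "\<dots> \<le> weighted_mass W (v k)"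
        unfolding weighted_mass_def
      proof (rule integral_mono[OF integrable_mult_right[OF iF] integrable_potential_square[OF Wloc v(1)]])
        fix x
        show "(w0 * d\<^sup>2) * indicator F x \<le> W x * (v k x)\<^sup>2"
        proof (cases "x \<in> F")
          case True
          then have "d\<^sup>2 \<le> (v k x)\<^sup>2" "w0 \<le> W x" using d E(7) by (auto simp: F_def intro!: power_mono)
          then show ?thesis using True E(3) by (auto intro!: mult_mono)
        qed (simp add: W0)
      qed
      finally have "C * (w0 * d\<^sup>2 * measure lborel F) \<le> C * weighted_mass W (v k)"
        using C by (intro mult_left_mono) auto
      also have "\<dots> \<le> 1 / real (Suc k)" using imp[OF v(1)[of k]] v(4)[of k] by linarith
      finally have "(C * w0 * d\<^sup>2) * measure lborel F \<le> 1 / real (Suc k)" by (simp add: mult.assoc)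
      moreover have "C * w0 * d\<^sup>2 > 0" using C E(3) d by simp
      ultimately have "measure lborel F \<le> (1 / real (Suc k)) / (C * w0 * d\<^sup>2)"
        by (subst pos_le_divide_eq) (simp_all only: mult.commute)
      then show ?thesis by (simp add: F_def)
    qed
    have "(\<lambda>k. (1 / real (Suc k)) * (1 / (C * w0 * d\<^sup>2))) \<longlonglongrightarrow> 0 * (1 / (C * w0 * d\<^sup>2))"
      by (intro tendsto_mult inv0 tendsto_const)
    then have up0: "(\<lambda>k. (1 / real (Suc k)) * (1 / (C * w0 * d\<^sup>2))) \<longlonglongrightarrow> 0" by simp
    show "(\<lambda>k. measure lborel {x \<in> E. v k x > d}) \<longlonglongrightarrow> 0"
      by (rule tendsto_sandwich[OF _ _ tendsto_const up0]) (use le in \<open>auto intro!: always_eventually\<close>)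
  qed
  obtain \<phi> R where \<phi>: "smooth \<phi>" "\<And>x. norm x \<ge> \<sigma> \<Longrightarrow> \<phi> x = 1" "\<And>k. dirichlet (\<lambda>x. \<phi> x * v k x) \<le> R"
    using gb[OF \<sigma>] by auto
  have R0: "R \<ge> 0" using \<phi>(3)[of 0] masses_nonneg(1) order_trans by blast
  define g where "g k x = \<phi> x * v k x" for k x
  have g: "g k \<in> test_functions \<Omega>" for k unfolding g_def by (rule test_functions_mult[OF v(1) \<phi>(1)])
  obtain Cs :: real where Cs: "Cs > 0"
    "\<And>(g::'a \<Rightarrow> real) \<Omega> A m. g \<in> test_functions \<Omega> \<Longrightarrow> A \<in> fmeasurable lebesgue \<Longrightarrow> measure lebesgue A \<le> m \<Longrightarrow> m > 0 \<Longrightarrow>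
      (\<integral>x. indicator A x * (g x)\<^sup>2 \<partial>lebesgue) \<le> Cs * m powr (2 / DIM('a)) * dirichlet g"
    unfolding dirichlet_def by (rule test_sobolev_indicator[OF n3]) blast
  \<comment> \<open>A set of measure at most \<open>m\<close> carries at most a quarter of the mass.\<close>
  define m where "m = (1 / (4 * Cs * (R + 1))) powr (real DIM('a) / 2)"
  have m: "m > 0" using Cs R0 by (simp add: m_def)
  have small: "(\<integral>x. indicator A x * (g k x)\<^sup>2 \<partial>lebesgue) \<le> 1 / 4"
    if "A \<in> fmeasurable lebesgue" "measure lebesgue A \<le> m" for A k
  proof -
    have "m powr (2 / DIM('a)) = 1 / (4 * Cs * (R + 1))"
      using Cs(1) R0 by (simp add: m_def powr_powr)
    then have "(\<integral>x. indicator A x * (g k x)\<^sup>2 \<partial>lebesgue) \<le> Cs * (1 / (4 * Cs * (R + 1))) * dirichlet (g k)"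
      using Cs(2)[OF g that m] by simp
    also have "\<dots> \<le> Cs * (1 / (4 * Cs * (R + 1))) * (R + 1)"
      using \<phi>(3)[of k] Cs(1) R0 unfolding g_def by (intro mult_left_mono) auto
    also have "\<dots> = 1 / 4" using Cs(1) R0 by simp
    finally show ?thesis .
  qed
  have \<Omega>m: "\<Omega> \<in> fmeasurable lborel"
    using emeasure_bounded_finite[OF \<Omega>(3)] \<Omega>(1) by (intro fmeasurableI) auto
  then have \<Omega>m': "\<Omega> \<in> fmeasurable lebesgue" by (simp add: fmeasurable_def)
  obtain K where K: "closed K" "K \<subseteq> \<Omega>" "\<Omega> - K \<in> lmeasurable" "emeasure lebesgue (\<Omega> - K) < ennreal m"
    by (rule sets_lebesgue_inner_closed[of \<Omega> m]) (use \<Omega>(1) m in auto)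
  have Kc: "compact K" using K(1,2) \<Omega>(3) bounded_subset compact_eq_bounded_closed by blast
  have mK: "measure lebesgue (\<Omega> - K) \<le> m"
    using K(3,4) m by (simp add: emeasure_eq_measure2 ennreal_less_iff less_imp_le)
  \<comment> \<open>The mass is split over \<open>\<Omega> - K\<close>, the part of \<open>K\<close> where \<open>v k > d / 2\<close>, and the rest.\<close>
  define d where "d = 1 / (2 * (measure lebesgue \<Omega> + 1))"
  have d: "d > 0" "d \<le> 1" "d * measure lebesgue \<Omega> \<le> 1 / 2"
    by (auto simp: d_def field_simps add_nonneg_pos add_pos_nonneg)
  have "vanishes_in_measure v K"
    by (rule vanishes_on_compact[OF \<Omega>(1,2) E(1,2,4,5,6) vanE Kc K(2)])
  then have "(\<lambda>k. measure lborel {x \<in> K. v k x > d / 2}) \<longlonglongrightarrow> 0"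
    using d(1) unfolding vanishes_in_measure_def by (meson half_gt_zero)
  then have "\<forall>\<^sub>F k in sequentially. measure lborel {x \<in> K. v k x > d / 2} < m"
    using m by (intro order_tendstoD) auto
  then obtain k where k: "measure lborel {x \<in> K. v k x > d / 2} < m"
    unfolding eventually_sequentially by blast
  define F where "F = {x \<in> K. v k x > d / 2}"
  have F: "F \<in> fmeasurable lborel"
    unfolding F_def by (rule superlevel_in_fmeasurable(1)[OF v(1)]) (use K(1) Kc compact_imp_bounded in auto)
  then have F': "F \<in> fmeasurable lebesgue" and mF: "measure lebesgue F \<le> m"
    using k by (auto simp: fmeasurable_def F_def)
  obtain S where S: "compact S" "S \<subseteq> \<Omega>" "\<And>x. x \<notin> S \<Longrightarrow> v k x = 0"
    using v(1)[of k] by (rule test_functionsE) blast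
  have i\<Omega>: "integrable lebesgue (indicator \<Omega> :: 'a \<Rightarrow> real)"
    using \<Omega>m' by (intro integrable_real_indicator) (auto simp: fmeasurable_def)
  have ig: "integrable lebesgue (\<lambda>x. indicator A x * (g k x)\<^sup>2)" if "A \<in> fmeasurable lebesgue" for A
    by (rule integrable_indicator_square[OF g]) (use that in auto)
  have "1 = far_mass \<sigma> (v k)" using v(3) by simp
  also have "\<dots> \<le> (\<integral>x. indicator (\<Omega> - K) x * (g k x)\<^sup>2 + indicator F x * (g k x)\<^sup>2 + d / 2 * indicator \<Omega> x \<partial>lebesgue)"
    unfolding far_mass_def
  proof (rule integral_mono)
    show "integrable lebesgue (\<lambda>x. indicator {x. \<sigma> \<le> norm x} x * (v k x)\<^sup>2)"
      by (rule integrable_indicator_square[OF v(1) far_sets(2)])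
    show "integrable lebesgue (\<lambda>x. indicator (\<Omega> - K) x * (g k x)\<^sup>2 + indicator F x * (g k x)\<^sup>2 + d / 2 * indicator \<Omega> x)"
      by (intro Bochner_Integration.integrable_add integrable_mult_right ig i\<Omega> K(3) F')
    fix x
    show "indicator {x. \<sigma> \<le> norm x} x * (v k x)\<^sup>2 \<le>
        indicator (\<Omega> - K) x * (g k x)\<^sup>2 + indicator F x * (g k x)\<^sup>2 + d / 2 * indicator \<Omega> x"
    proof (cases "\<sigma> \<le> norm x \<and> x \<in> \<Omega>")
      case True
      then have gv: "g k x = v k x" using \<phi>(2) by (simp add: g_def)
      consider "x \<notin> K" | "x \<in> F" | "x \<in> K" "x \<notin> F" by blast
      then show ?thesis
      proof cases
        case 3
        then have "v k x \<le> d / 2" by (auto simp: F_def)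
        then have "(v k x)\<^sup>2 \<le> (d / 2)\<^sup>2" using v(2)[of k x] by (intro power_mono) auto
        also have "\<dots> \<le> d / 2" using d by (simp add: power2_eq_square mult_left_le_one_le)
        finally show ?thesis using True 3 by simp
      qed (use True gv d in \<open>auto simp: F_def\<close>)
    next
      case False
      then have e: "indicator {x. \<sigma> \<le> norm x} x * (v k x)\<^sup>2 = 0" using S(2,3) by auto
      show ?thesis unfolding e using d(1) by (intro add_nonneg_nonneg mult_nonneg_nonneg) auto
    qed
  qed
  also have "\<dots> = (\<integral>x. indicator (\<Omega> - K) x * (g k x)\<^sup>2 \<partial>lebesgue) + (\<integral>x. indicator F x * (g k x)\<^sup>2 \<partial>lebesgue) +
      d / 2 * measure lebesgue \<Omega>"
  proof -
    have "(\<integral>x. f1 x + f2 x + d / 2 * f3 x \<partial>lebesgue) =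
        (\<integral>x. f1 x \<partial>lebesgue) + (\<integral>x. f2 x \<partial>lebesgue) + d / 2 * (\<integral>x. f3 x \<partial>lebesgue)"
      if "integrable lebesgue f1" "integrable lebesgue f2" "integrable lebesgue f3" for f1 f2 f3 :: "'a \<Rightarrow> real"
      using that by simp
    from this[OF ig[OF K(3)] ig[OF F'] i\<Omega>] show ?thesis using \<Omega>m' by (simp add: fmeasurableD)
  qed
  also have "\<dots> \<le> 1 / 4 + 1 / 4 + 1 / 4"
    using small[OF K(3) mK] small[OF F' mF] d(3) by (intro add_mono) auto
  finally show False by simp
qed

end

section \<open>The quadratic form of the problem\<close>

text \<open>Extension by zero, with negative values removed, turns conditions that hold almost everywhere
  on \<open>\<Omega>\<close> into conditions that hold everywhere. The integrals do not change for a potential that is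
  non-negative almost everywhere.\<close>

definition extend_weight :: "'a::euclidean_space set \<Rightarrow> ('a \<Rightarrow> real) \<Rightarrow> 'a \<Rightarrow> real" where
  "extend_weight \<Omega> V x = (if x \<in> \<Omega> then max 0 (V x) else 0)"

lemma set_integral_eq_integral:
  fixes f :: "'a::euclidean_space \<Rightarrow> real"
  assumes "\<And>x. x \<notin> D \<Longrightarrow> f x = 0"
  shows "(LINT x:D|lebesgue. f x) = (\<integral>x. f x \<partial>lebesgue)"
  unfolding set_lebesgue_integral_def
  by (rule Bochner_Integration.integral_cong) (use assms in \<open>auto split: split_indicator\<close>)

lemma energy_eq:
  assumes "u \<in> test_functions D"
  shows "energy D l u = l * mass u + dirichlet u"
proof -
  obtain K where K: "K \<subseteq> D" "\<And>x. x \<notin> K \<Longrightarrow> u x = 0" "\<And>x. x \<notin> K \<Longrightarrow> gradient u x = 0"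
    using assms by (rule test_functionsE) blast
  have "x \<notin> D \<Longrightarrow> u x = 0 \<and> gradient u x = 0" for x using K by blast
  then show ?thesis
    unfolding energy_def mass_def dirichlet_def by (subst (1 2) set_integral_eq_integral) auto
qed

lemma hardy_term_eq:
  fixes u :: "'a::euclidean_space \<Rightarrow> real"
  assumes "u \<in> test_functions D"
  shows "hardy_term D u = (real DIM('a))\<^sup>2 / 4 * inverse_square_mass u"
proof -
  obtain K where K: "K \<subseteq> D" "\<And>x. x \<notin> K \<Longrightarrow> u x = 0"
    using assms by (rule test_functionsE) blast
  have "x \<notin> D \<Longrightarrow> u x = 0" for x using K by blast
  then show ?thesis
    unfolding hardy_term_def inverse_square_mass_def by (subst set_integral_eq_integral) auto
qed

lemma potential_term_eq:
  fixes u :: "'a::euclidean_space \<Rightarrow> real"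
  assumes \<Omega>: "open \<Omega>" and V: "V \<in> borel_measurable (lebesgue_on \<Omega>)" "AE x in lebesgue_on \<Omega>. V x \<ge> 0"
    and D: "D \<subseteq> \<Omega>" and u: "u \<in> test_functions D"
  shows "potential_term D V u = weighted_mass (extend_weight \<Omega> V) u"
proof -
  obtain K where K: "K \<subseteq> D" "\<And>x. x \<notin> K \<Longrightarrow> u x = 0"
    using u by (rule test_functionsE) blast
  have u0: "x \<notin> D \<Longrightarrow> u x = 0" for x using K by blast
  have \<Omega>s: "\<Omega> \<in> sets lebesgue" using \<Omega> by simp
  have V': "(\<lambda>x. if x \<in> \<Omega> then V x else 0) \<in> borel_measurable lebesgue"
    using V(1) borel_measurable_if[OF \<Omega>s] by blast
  have um: "u \<in> borel_measurable lebesgue" by (rule borel_lebesgue[OF test_function_borel(1)[OF u]])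
  have "AE x in lebesgue. x \<in> \<Omega> \<longrightarrow> V x \<ge> 0"
    using V(2) \<Omega>s by (simp add: AE_restrict_space_iff)
  then have ae: "AE x in lebesgue. V x * (u x)\<^sup>2 = extend_weight \<Omega> V x * (u x)\<^sup>2"
  proof (rule eventually_mono)
    fix x assume "x \<in> \<Omega> \<longrightarrow> V x \<ge> 0"
    then show "V x * (u x)\<^sup>2 = extend_weight \<Omega> V x * (u x)\<^sup>2"
      using u0[of x] D by (cases "x \<in> \<Omega>") (auto simp: extend_weight_def)
  qed
  have eq1: "V x * (u x)\<^sup>2 = (if x \<in> \<Omega> then V x else 0) * (u x)\<^sup>2" for x
    using u0[of x] D by auto
  have eq2: "extend_weight \<Omega> V x = max 0 (if x \<in> \<Omega> then V x else 0)" for x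
    by (simp add: extend_weight_def)
  have "potential_term D V u = (\<integral>x. V x * (u x)\<^sup>2 \<partial>lebesgue)"
    unfolding potential_term_def by (rule set_integral_eq_integral) (simp add: u0)
  also have "\<dots> = weighted_mass (extend_weight \<Omega> V) u"
    unfolding weighted_mass_def
  proof (rule integral_cong_AE[OF _ _ ae])
    show "(\<lambda>x. V x * (u x)\<^sup>2) \<in> borel_measurable lebesgue"
      unfolding eq1 using V' um by measurable
    show "(\<lambda>x. extend_weight \<Omega> V x * (u x)\<^sup>2) \<in> borel_measurable lebesgue"
      unfolding eq2 using V' um by measurable
  qed
  finally show ?thesis .
qed

lemma extend_weight_singular:
  fixes \<Omega> :: "'a::euclidean_space set"
  assumes \<Omega>: "open \<Omega>" "bounded \<Omega>" and V: "Lp_loc_off_0 (real DIM('a) / 2) \<Omega> V"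
  shows "singular_weight (extend_weight \<Omega> V)"
  unfolding singular_weight_def
proof (intro conjI allI impI)
  have \<Omega>s: "\<Omega> \<in> sets lebesgue" using \<Omega> by simp
  have V': "(\<lambda>x. if x \<in> \<Omega> then V x else 0) \<in> borel_measurable lebesgue"
    using V borel_measurable_if[OF \<Omega>s] by (auto simp: Lp_loc_off_0_def)
  have eq2: "extend_weight \<Omega> V = (\<lambda>x. max 0 (if x \<in> \<Omega> then V x else 0))"
    by (auto simp: extend_weight_def)
  show m: "extend_weight \<Omega> V \<in> borel_measurable lebesgue"
    unfolding eq2 using V' by measurable
  show "extend_weight \<Omega> V x \<ge> 0" for x by (simp add: extend_weight_def)
  fix \<rho> :: real assume \<rho>: "\<rho> > 0"
  define K where "K = closure \<Omega> \<inter> {x. \<rho> \<le> norm x}"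
  have cl: "closed {x::'a. \<rho> \<le> norm x}" by (intro closed_Collect_le continuous_intros)
  have "compact K" unfolding K_def using \<Omega>(2) cl by (intro compact_Int_closed) auto
  moreover have "K \<subseteq> closure \<Omega> - {0}" using \<rho> by (auto simp: K_def)
  ultimately have int: "integrable lebesgue (\<lambda>x. indicator (K \<inter> \<Omega>) x *\<^sub>R \<bar>V x\<bar> powr (real DIM('a) / 2))"
    using V unfolding Lp_loc_off_0_def set_integrable_def by blast
  show "integrable lebesgue (\<lambda>x. indicator {x. \<rho> \<le> norm x} x * extend_weight \<Omega> V x powr (real DIM('a) / 2))"
  proof (rule Bochner_Integration.integrable_bound[OF int])
    show "(\<lambda>x. indicator {x. \<rho> \<le> norm x} x * extend_weight \<Omega> V x powr (real DIM('a) / 2)) \<in> borel_measurable lebesgue"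
    proof (rule borel_measurable_times)
      show "indicator {x::'a. \<rho> \<le> norm x} \<in> borel_measurable lebesgue" by (rule borel_measurable_indicator[OF far_sets(2)])
      show "(\<lambda>x. extend_weight \<Omega> V x powr (real DIM('a) / 2)) \<in> borel_measurable lebesgue"
        using m by measurable
    qed
    show "AE x in lebesgue. norm (indicator {x. \<rho> \<le> norm x} x * extend_weight \<Omega> V x powr (real DIM('a) / 2)) \<le>
        norm (indicator (K \<inter> \<Omega>) x *\<^sub>R \<bar>V x\<bar> powr (real DIM('a) / 2))"
    proof (rule AE_I2)
      fix x
      show "norm (indicator {x. \<rho> \<le> norm x} x * extend_weight \<Omega> V x powr (real DIM('a) / 2)) \<le>
        norm (indicator (K \<inter> \<Omega>) x *\<^sub>R \<bar>V x\<bar> powr (real DIM('a) / 2))"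
      proof (cases "\<rho> \<le> norm x \<and> x \<in> \<Omega>")
        case True
        then have "x \<in> K \<inter> \<Omega>" using closure_subset by (auto simp: K_def)
        moreover have "extend_weight \<Omega> V x powr (real DIM('a) / 2) \<le> \<bar>V x\<bar> powr (real DIM('a) / 2)"
          using True by (intro powr_mono2) (auto simp: extend_weight_def)
        ultimately show ?thesis using True by simp
      qed (auto simp: extend_weight_def)
    qed
  qed
qed

text \<open>The ball of half the radius touching at the same point, whose centre is \<open>p/2\<close>, has
  its closure outside of \<open>\<Omega>\<close> except for the origin.\<close>

lemma exterior_ball_inequality:
  assumes "exterior_ball_at_0 \<Omega>"
  obtains p :: "'a::euclidean_space" where "p \<noteq> 0" "\<And>x. x \<in> \<Omega> \<Longrightarrow> x \<noteq> 0 \<Longrightarrow> x \<bullet> p < x \<bullet> x"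
proof -
  obtain c r where c: "r > 0" "ball c r \<subseteq> - closure \<Omega>" "0 \<in> frontier (ball c r)"
    using assms by (auto simp: exterior_ball_at_0_def)
  have nc: "norm c = r" using c(1,3) by (simp add: frontier_ball)
  show ?thesis
  proof (rule that[of c])
    show "c \<noteq> 0" using nc c(1) by auto
    fix x assume x: "x \<in> \<Omega>" "x \<noteq> 0"
    then have "x \<notin> ball c r" using c(2) closure_subset by blast
    then have "norm c \<le> norm (x - c)" using nc by (simp add: dist_norm norm_minus_commute)
    then have "(norm c)\<^sup>2 \<le> (norm (x - c))\<^sup>2" by (intro power_mono) auto
    then have "2 * (x \<bullet> c) \<le> x \<bullet> x"
      unfolding power2_norm_eq_inner by (simp add: inner_diff_left inner_diff_right inner_commute)
    moreover have "x \<bullet> x > 0" using x(2) by simp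
    ultimately show "x \<bullet> c < x \<bullet> x" by linarith
  qed
qed

lemma hardy_surplus_near_0:
  fixes \<Omega> :: "'a::euclidean_space set"
  assumes ext: "exterior_ball_at_0 \<Omega>" and \<Omega>0: "0 \<notin> \<Omega>"
  obtains r where "r > 0" "\<And>w. w \<in> test_functions (\<Omega> \<inter> ball 0 r) \<Longrightarrow>
    (real DIM('a))\<^sup>2 / 4 * inverse_square_mass w + K * mass w \<le> dirichlet w"
proof -
  obtain p where p: "p \<noteq> 0" "\<And>x. x \<in> \<Omega> \<Longrightarrow> x \<noteq> 0 \<Longrightarrow> x \<bullet> p < x \<bullet> x"
    using exterior_ball_inequality[OF ext] by blast
  obtain r where r: "r > 0" "\<And>w. w \<in> test_functions (ball 0 r \<inter> {x. x \<bullet> p < x \<bullet> x}) \<Longrightarrow>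
      (\<integral>x. ((real DIM('a))\<^sup>2 / 4 / (norm x)\<^sup>2 + K) * (w x)\<^sup>2 \<partial>lborel) \<le>
        (\<integral>x. (norm (gradient w x))\<^sup>2 \<partial>lborel)"
    by (rule hardy_near_boundary_point[OF p(1), of K]) blast
  show ?thesis
  proof (rule that[OF r(1)])
    fix w assume w: "w \<in> test_functions (\<Omega> \<inter> ball 0 r)"
    have sub: "\<Omega> \<inter> ball 0 r \<subseteq> ball 0 r \<inter> {x. x \<bullet> p < x \<bullet> x}" using p(2) \<Omega>0 by auto
    have w\<Omega>: "w \<in> test_functions \<Omega>" by (rule test_functions_mono[OF _ w]) auto
    note [measurable] = test_function_borel[OF w]
    note i1 = test_integrable(1)[OF w] and i2 = integrable_potential_square[OF inverse_square_local[OF \<Omega>0] w\<Omega>]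
    define n where "n = (real DIM('a))\<^sup>2 / 4"
    have "(\<integral>x. n * f1 x + K * f2 x \<partial>lebesgue) = n * (\<integral>x. f1 x \<partial>lebesgue) + K * (\<integral>x. f2 x \<partial>lebesgue)"
      if "integrable lebesgue f1" "integrable lebesgue f2" for f1 f2 :: "'a \<Rightarrow> real"
      using that by simp
    from this[OF i2 i1] have "n * inverse_square_mass w + K * mass w =
        (\<integral>x. n * (1 / (norm x)\<^sup>2 * (w x)\<^sup>2) + K * (w x)\<^sup>2 \<partial>lebesgue)"
      by (simp add: inverse_square_mass_def mass_def)
    also have "\<dots> = (\<integral>x. (n / (norm x)\<^sup>2 + K) * (w x)\<^sup>2 \<partial>lebesgue)" by (simp add: distrib_right)
    also have "\<dots> = (\<integral>x. (n / (norm x)\<^sup>2 + K) * (w x)\<^sup>2 \<partial>lborel)"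
      by (rule integral_lborel_lebesgue) measurable
    also have "\<dots> \<le> (\<integral>x. (norm (gradient w x))\<^sup>2 \<partial>lborel)"
      unfolding n_def by (rule r(2)[OF test_functions_mono[OF sub w]])
    also have "\<dots> = dirichlet w"
      unfolding dirichlet_def by (rule integral_lborel_lebesgue[symmetric]) measurable
    finally show "(real DIM('a))\<^sup>2 / 4 * inverse_square_mass w + K * mass w \<le> dirichlet w" by (simp add: n_def)
  qed
qed

text \<open>By monotonicity the limit is a supremum.\<close>

lemma C_zero_less_imp_C_r_less:
  assumes b: "ereal b < C_zero \<Omega> \<mu> V" and anti: "\<And>r s. 0 < r \<Longrightarrow> r \<le> s \<Longrightarrow> C_r \<Omega> \<mu> V s \<le> C_r \<Omega> \<mu> V r"
  obtains r where "r > 0" "ereal b < C_r \<Omega> \<mu> V r"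
proof -
  define S where "S = (SUP r\<in>{0<..}. C_r \<Omega> \<mu> V r)"
  have "(C_r \<Omega> \<mu> V \<longlongrightarrow> S) (at_right 0)"
  proof (rule order_tendstoI)
    fix a assume "a < S"
    then obtain r where r: "r > 0" "a < C_r \<Omega> \<mu> V r" unfolding S_def by (auto simp: less_SUP_iff)
    have "\<forall>\<^sub>F s in at_right 0. s \<in> {0<..<r}" by (rule eventually_at_right_real[OF r(1)])
    then show "\<forall>\<^sub>F s in at_right 0. a < C_r \<Omega> \<mu> V s"
      by (rule eventually_mono) (use r anti in \<open>force intro: less_le_trans\<close>)
  next
    fix a assume "S < a"
    then show "\<forall>\<^sub>F s in at_right 0. C_r \<Omega> \<mu> V s < a"
      unfolding S_def eventually_at_filter by (intro always_eventually) (auto intro: le_less_trans[OF SUP_upper])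
  qed
  then have "C_zero \<Omega> \<mu> V = S" unfolding C_zero_def by (intro tendsto_Lim) auto
  then show ?thesis using b that unfolding S_def by (auto simp: less_SUP_iff)
qed

text \<open>The quotient defining \<open>C\<^sup>0(V)\<close> bounds \<open>b' \<integral>V w\<^sup>2\<close> for some \<open>b' > b\<close> up to
  \<open>\<mu> \<integral>w\<^sup>2\<close>. A convex combination with the Hardy inequality with surplus absorbs
  this error and leaves a constant between \<open>b\<close> and \<open>b'\<close>.\<close>

lemma near_origin_coercivity:
  fixes \<Omega> :: "'a::euclidean_space set"
  assumes n3: "DIM('a) \<ge> 3" and \<Omega>: "open \<Omega>" "0 \<notin> \<Omega>" "exterior_ball_at_0 \<Omega>"
    and V: "V \<in> borel_measurable (lebesgue_on \<Omega>)" "AE x in lebesgue_on \<Omega>. V x \<ge> 0"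
    and b: "b > 0" "ereal b < C_zero \<Omega> \<mu> V" and \<mu>: "\<mu> \<ge> 0"
  obtains r \<delta> where "r > 0" "\<delta> > 0" "\<And>w. w \<in> test_functions (\<Omega> \<inter> ball 0 r) \<Longrightarrow>
    \<delta> * (weighted_mass (extend_weight \<Omega> V) w + mass w) \<le>
      dirichlet w - (real DIM('a))\<^sup>2 / 4 * inverse_square_mass w - b * weighted_mass (extend_weight \<Omega> V) w"
proof -
  define n where "n = (real DIM('a))\<^sup>2 / 4"
  define P where "P = weighted_mass (extend_weight \<Omega> V)"
  define X where "X w = dirichlet w - n * inverse_square_mass w" for w :: "'a \<Rightarrow> real"
  have P0: "P w \<ge> 0" for w
    unfolding P_def by (rule weighted_mass_nonneg) (simp add: extend_weight_def)
  define A where "A r = {u \<in> test_functions (\<Omega> \<inter> ball 0 r). P u \<noteq> 0}" for r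
  have Cr: "C_r \<Omega> \<mu> V r = (INF u\<in>A r. ereal ((\<mu> * mass u + X u) / P u))" for r
  proof -
    have t: "potential_term (\<Omega> \<inter> ball 0 r) V u = P u" "energy (\<Omega> \<inter> ball 0 r) \<mu> u = \<mu> * mass u + dirichlet u"
      "hardy_term (\<Omega> \<inter> ball 0 r) u = n * inverse_square_mass u" if "u \<in> test_functions (\<Omega> \<inter> ball 0 r)" for u
      using potential_term_eq[OF \<Omega>(1) V _ that] energy_eq[OF that] hardy_term_eq[OF that] by (auto simp: P_def n_def)
    show ?thesis
      unfolding C_r_def A_def X_def by (intro INF_cong) (auto simp: t)
  qed
  have anti: "C_r \<Omega> \<mu> V s \<le> C_r \<Omega> \<mu> V r" if "0 < r" "r \<le> s" for r s
  proof -
    have "\<Omega> \<inter> ball 0 r \<subseteq> \<Omega> \<inter> ball 0 s" using that by auto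
    then have "A r \<subseteq> A s" unfolding A_def using test_functions_mono by blast
    then show ?thesis unfolding Cr by (intro INF_superset_mono) auto
  qed
  obtain r0 where r0: "r0 > 0" "ereal b < C_r \<Omega> \<mu> V r0"
    using C_zero_less_imp_C_r_less[OF b(2) anti] by blast
  obtain b' where b': "b < b'" "ereal b' < C_r \<Omega> \<mu> V r0"
  proof -
    obtain e where e: "ereal b < e" "e < C_r \<Omega> \<mu> V r0" using r0(2) dense by blast
    then show ?thesis using that by (cases e) auto
  qed
  have near: "b' * P w \<le> \<mu> * mass w + X w" if w: "w \<in> test_functions (\<Omega> \<inter> ball 0 r0)" "P w \<noteq> 0" for w
  proof -
    have "C_r \<Omega> \<mu> V r0 \<le> ereal ((\<mu> * mass w + X w) / P w)"
      unfolding Cr by (rule INF_lower) (use w in \<open>simp add: A_def\<close>)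
    then have "ereal b' < ereal ((\<mu> * mass w + X w) / P w)" using b'(2) by (rule less_le_trans[rotated])
    then have "b' < (\<mu> * mass w + X w) / P w" by simp
    then show ?thesis using P0[of w] w(2) by (simp add: field_simps less_le)
  qed
  define b'' where "b'' = (b + b') / 2"
  define \<theta> where "\<theta> = b'' / b'"
  have \<theta>: "0 < \<theta>" "\<theta> < 1" "\<theta> * b' = b''" using b(1) b'(1) by (auto simp: \<theta>_def b''_def field_simps)
  \<comment> \<open>The surplus \<open>K\<close> is chosen so that a fraction \<open>1 - \<theta>\<close> of it pays for \<open>\<theta> \<mu> + 1\<close>.\<close>
  define K where "K = (\<theta> * \<mu> + 1) / (1 - \<theta>)"
  have K: "K \<ge> 0" "(1 - \<theta>) * K = \<theta> * \<mu> + 1" using \<theta> \<mu> by (auto simp: K_def)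
  obtain r1 where r1: "r1 > 0" "\<And>w. w \<in> test_functions (\<Omega> \<inter> ball 0 r1) \<Longrightarrow> n * inverse_square_mass w + K * mass w \<le> dirichlet w"
    unfolding n_def by (rule hardy_surplus_near_0[OF \<Omega>(3,2), of K]) blast
  define r where "r = min r0 r1"
  define \<delta> where "\<delta> = min (b'' - b) 1"
  show ?thesis
  proof (rule that[of r \<delta>])
    show "r > 0" using r0 r1 by (simp add: r_def)
    show "\<delta> > 0" using b'(1) by (simp add: \<delta>_def b''_def)
    fix w assume w: "w \<in> test_functions (\<Omega> \<inter> ball 0 r)"
    have w0: "w \<in> test_functions (\<Omega> \<inter> ball 0 r0)" and w1: "w \<in> test_functions (\<Omega> \<inter> ball 0 r1)"
      by (rule test_functions_mono[OF _ w]; auto simp: r_def)+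
    have XK: "K * mass w \<le> X w" using r1(2)[OF w1] by (simp add: X_def)
    have m: "mass w \<ge> 0" by (rule masses_nonneg)
    have Xb: "b' * P w \<le> \<mu> * mass w + X w"
    proof (cases "P w = 0")
      case True
      have "0 \<le> \<mu> * mass w" "0 \<le> K * mass w" using \<mu> K(1) m by simp_all
      then show ?thesis using XK True by simp
    qed (rule near[OF w0])
    have "\<theta> * (b' * P w) \<le> \<theta> * (\<mu> * mass w + X w)" using Xb \<theta>(1) by (intro mult_left_mono) auto
    then have "b'' * P w \<le> \<theta> * \<mu> * mass w + \<theta> * X w"
      unfolding \<theta>(3)[symmetric] by (simp add: distrib_left mult.assoc)
    moreover have "(\<theta> * \<mu> + 1) * mass w \<le> (1 - \<theta>) * X w"
      unfolding K(2)[symmetric] using mult_left_mono[OF XK, of "1 - \<theta>"] \<theta>(2) by (simp add: mult.assoc)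
    ultimately have "b'' * P w + mass w \<le> X w" by (simp add: algebra_simps)
    moreover have "\<delta> * P w \<le> (b'' - b) * P w" "\<delta> * mass w \<le> 1 * mass w"
      using P0[of w] m by (intro mult_right_mono; simp add: \<delta>_def)+
    ultimately have "\<delta> * (P w + mass w) \<le> X w - b * P w" by (simp add: algebra_simps)
    then show "\<delta> * (weighted_mass (extend_weight \<Omega> V) w + mass w) \<le>
      dirichlet w - (real DIM('a))\<^sup>2 / 4 * inverse_square_mass w - b * weighted_mass (extend_weight \<Omega> V) w"
      by (simp add: P_def X_def n_def)
  qed
qed

section \<open>Maximality\<close>

text \<open>An improvement by \<open>W\<close> gives the gap, and the gap turns coercivity up to the far mass
  into the Hardy inequality with the larger constant \<open>b + a\<close>.\<close>

lemma best_constant_maximal: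
  fixes \<Omega> :: "'a::euclidean_space set"
  assumes n3: "DIM('a) \<ge> 3" and \<Omega>: "open \<Omega>" "connected \<Omega>" "bounded \<Omega>" "0 \<in> frontier \<Omega>" "exterior_ball_at_0 \<Omega>"
    and adm: "admissible \<Omega> V" and \<mu>: "\<mu> \<ge> 0" and l0: "l \<ge> 0" and b0: "b > 0"
    and best: "best_hardy_constant \<Omega> l V b" and less: "ereal b < C_zero \<Omega> \<mu> V"
  shows "maximal_potential \<Omega> l V b"
  unfolding maximal_potential_def
proof
  assume "\<exists>W C. admissible \<Omega> W \<and> \<not> ae_zero_on \<Omega> W \<and> C > 0 \<and> (\<forall>u\<in>test_functions \<Omega>. energy \<Omega> l u \<ge>
     hardy_term \<Omega> u + b * potential_term \<Omega> V u + C * potential_term \<Omega> W u)"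
  then obtain W C where W: "admissible \<Omega> W" "\<not> ae_zero_on \<Omega> W" and C: "C > 0"
    and imp: "\<And>u. u \<in> test_functions \<Omega> \<Longrightarrow> energy \<Omega> l u \<ge>
      hardy_term \<Omega> u + b * potential_term \<Omega> V u + C * potential_term \<Omega> W u" by blast
  have \<Omega>0: "0 \<notin> \<Omega>" using \<Omega>(1,4) by (simp add: frontier_def interior_open)
  have meas: "U \<in> borel_measurable (lebesgue_on \<Omega>)" "AE x in lebesgue_on \<Omega>. U x \<ge> 0"
    "singular_weight (extend_weight \<Omega> U)" if "admissible \<Omega> U" for U
    using that extend_weight_singular[OF \<Omega>(1,3), of U] by (auto simp: admissible_def Lp_loc_off_0_def)
  define Ve where "Ve = extend_weight \<Omega> V"
  define We where "We = extend_weight \<Omega> W"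
  have pot: "potential_term \<Omega> V u = weighted_mass Ve u" "potential_term \<Omega> W u = weighted_mass We u"
    if "u \<in> test_functions \<Omega>" for u
    unfolding Ve_def We_def using that meas[OF adm] meas[OF W(1)] \<Omega>(1) by (auto intro!: potential_term_eq)
  interpret hardy_form \<Omega> Ve l b
    by unfold_locales (use n3 \<Omega>0 meas(3)[OF adm] l0 b0 in \<open>auto simp: Ve_def\<close>)
  have qf: "qform q u = energy \<Omega> l u - hardy_term \<Omega> u - b * potential_term \<Omega> V u" if "u \<in> test_functions \<Omega>" for u
    using qform_eq[OF that] energy_eq[OF that] hardy_term_eq[OF that] pot(1)[OF that] by simp
  have pos: "qform q u \<ge> 0" if "u \<in> test_functions \<Omega>" for u
    using best that unfolding qf[OF that] best_hardy_constant_def hardy_ineq_def by force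
  have impW: "C * weighted_mass We u \<le> qform q u" if "u \<in> test_functions \<Omega>" for u
    using imp[OF that] unfolding qf[OF that] pot(2)[OF that] by simp
  have nzW: "\<not> (AE x in lebesgue. x \<in> \<Omega> \<longrightarrow> We x = 0)"
  proof
    assume z: "AE x in lebesgue. x \<in> \<Omega> \<longrightarrow> We x = 0"
    have \<Omega>s: "\<Omega> \<in> sets lebesgue" using \<Omega>(1) by simp
    have "AE x in lebesgue. x \<in> \<Omega> \<longrightarrow> W x \<ge> 0"
      using meas(2)[OF W(1)] \<Omega>s by (simp add: AE_restrict_space_iff)
    then have "AE x in lebesgue. x \<in> \<Omega> \<longrightarrow> W x = 0"
      using z by eventually_elim (auto simp: We_def extend_weight_def)
    then have "ae_zero_on \<Omega> W" using \<Omega>s by (simp add: ae_zero_on_def AE_restrict_space_iff)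
    then show False using W(2) by simp
  qed
  obtain r \<delta>0 where r: "r > 0" "\<delta>0 > 0" "\<And>w. w \<in> test_functions (\<Omega> \<inter> ball 0 r) \<Longrightarrow>
    \<delta>0 * (weighted_mass Ve w + mass w) \<le>
      dirichlet w - (real DIM('a))\<^sup>2 / 4 * inverse_square_mass w - b * weighted_mass Ve w"
    unfolding Ve_def
    by (rule near_origin_coercivity[OF n3 \<Omega>(1) \<Omega>0 \<Omega>(5) meas(1,2)[OF adm] b0 less \<mu>]) blast
  have near: "\<delta>0 * (weighted_mass Ve w + mass w) \<le> qform q w" if "w \<in> test_functions (\<Omega> \<inter> ball 0 r)" for w
  proof -
    have "w \<in> test_functions \<Omega>" by (rule test_functions_mono[OF _ that]) auto
    moreover have "l * mass w \<ge> 0" using l0 masses_nonneg(2)[of w] by simp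
    ultimately show ?thesis using r(3)[OF that] by (simp add: qform_eq)
  qed
  obtain \<sigma> N \<delta> where \<sigma>: "\<sigma> > 0" and N: "N \<ge> 0" and \<delta>: "\<delta> > 0"
    and coer: "\<And>u. u \<in> test_functions \<Omega> \<Longrightarrow> \<delta> * (weighted_mass Ve u + mass u) \<le> qform q u + N * far_mass \<sigma> u"
    by (rule coercive_up_to_far_mass[OF r(1,2) near]) (assumption, rule that)
  obtain c where c: "c > 0" "\<And>u. u \<in> test_functions \<Omega> \<Longrightarrow> c * far_mass \<sigma> u \<le> qform q u"
    by (rule far_mass_gap[OF \<Omega>(1,2,3) pos \<sigma> N \<delta> coer _ nzW C impW]) (use meas(3)[OF W(1)] in \<open>auto simp: We_def\<close>)
  define a where "a = \<delta> / (1 + N / c)"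
  have den: "1 + N / c > 0" using N c(1) by (simp add: add_pos_nonneg)
  have a: "a > 0" using \<delta> den by (simp add: a_def)
  have "hardy_ineq \<Omega> l V (b + a)"
    unfolding hardy_ineq_def
  proof
    fix u assume u: "u \<in> test_functions \<Omega>"
    have "\<delta> * weighted_mass Ve u \<le> \<delta> * (weighted_mass Ve u + mass u)"
      using \<delta> masses_nonneg(2)[of u] by simp
    also have "\<dots> \<le> qform q u + N / c * (c * far_mass \<sigma> u)" using coer[OF u] c(1) by simp
    also have "\<dots> \<le> qform q u + N / c * qform q u"
      using c N u by (intro add_left_mono mult_left_mono) auto
    finally have "\<delta> * weighted_mass Ve u \<le> (1 + N / c) * qform q u" by (simp add: distrib_right)
    then have "a * weighted_mass Ve u \<le> qform q u"
      using den unfolding a_def times_divide_eq_left by (subst pos_divide_le_eq) (auto simp: mult.commute)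
    then show "energy \<Omega> l u \<ge> hardy_term \<Omega> u + (b + a) * potential_term \<Omega> V u"
      unfolding qf[OF u] pot(1)[OF u] by (simp add: distrib_right)
  qed
  then have "b + a \<le> b" using best unfolding best_hardy_constant_def by blast
  then show False using a by simp
qed

text \<open>The set of constants is closed, and bounded above by the quotient at one test function
  \<open>\<eta>\<close> that is positive on a set of positive measure where \<open>V\<close> is positive.\<close>

lemma best_constant_exists:
  fixes \<Omega> :: "'a::euclidean_space set"
  assumes n3: "DIM('a) \<ge> 3" and \<Omega>: "open \<Omega>" "bounded \<Omega>" "0 \<in> frontier \<Omega>"
    and V: "admissible \<Omega> V" "\<not> ae_zero_on \<Omega> V"
  obtains l b where "l \<ge> 0" "b > 0" "best_hardy_constant \<Omega> l V b"
proof -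
  have \<Omega>0: "0 \<notin> \<Omega>" using \<Omega>(1,3) by (simp add: frontier_def interior_open)
  have \<Omega>s: "\<Omega> \<in> sets lebesgue" using \<Omega>(1) by simp
  obtain l C where lC: "l \<ge> 0" "C > 0" "hardy_ineq \<Omega> l V C" using V(1) by (auto simp: admissible_def)
  have meas: "V \<in> borel_measurable (lebesgue_on \<Omega>)" "AE x in lebesgue_on \<Omega>. V x \<ge> 0"
    using V(1) by (auto simp: admissible_def Lp_loc_off_0_def)
  define Ve where "Ve = extend_weight \<Omega> V"
  have sw: "singular_weight Ve"
    using V(1) extend_weight_singular[OF \<Omega>(1,2), of V] by (simp add: admissible_def Ve_def)
  then have Vem: "Ve \<in> borel_measurable lebesgue" and Ve0: "\<And>x. Ve x \<ge> 0" by (auto simp: singular_weight_def)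
  have pot: "potential_term \<Omega> V u = weighted_mass Ve u" if "u \<in> test_functions \<Omega>" for u
    unfolding Ve_def by (rule potential_term_eq[OF \<Omega>(1) meas order_refl that])
  have nz: "\<not> (AE x in lebesgue. x \<in> \<Omega> \<longrightarrow> Ve x = 0)"
  proof
    assume z: "AE x in lebesgue. x \<in> \<Omega> \<longrightarrow> Ve x = 0"
    have "AE x in lebesgue. x \<in> \<Omega> \<longrightarrow> V x \<ge> 0"
      using meas(2) \<Omega>s by (simp add: AE_restrict_space_iff)
    then have "AE x in lebesgue. x \<in> \<Omega> \<longrightarrow> V x = 0"
      using z by eventually_elim (auto simp: Ve_def extend_weight_def)
    then have "ae_zero_on \<Omega> V" using \<Omega>s by (simp add: ae_zero_on_def AE_restrict_space_iff)
    then show False using V(2) by simp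
  qed
  obtain a s w0 E where E: "s > 0" "cball a (2 * s) \<subseteq> \<Omega>" "w0 > 0" "E \<subseteq> ball a s" "E \<in> sets borel"
    "measure lborel E > 0" "\<And>x. x \<in> E \<Longrightarrow> w0 \<le> Ve x"
    by (rule positive_on_part_of_ball[OF \<Omega>(1) Vem Ve0 nz]) blast
  obtain \<eta> :: "'a \<Rightarrow> real" and e0 where \<eta>: "\<eta> \<in> test_functions \<Omega>" and e0: "e0 > 0" "\<And>x. x \<in> ball a s \<Longrightarrow> \<eta> x \<ge> e0"
    by (rule bump_function_exists[OF E(1,2)]) blast
  have Pi: "integrable lebesgue (\<lambda>x. Ve x * (\<eta> x)\<^sup>2)"
    by (rule integrable_potential_square[OF singular_weight_local[OF sw n3 \<Omega>0] \<eta>])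
  have P\<eta>: "weighted_mass Ve \<eta> > 0"
  proof -
    have "weighted_mass Ve \<eta> \<noteq> 0"
    proof
      assume "weighted_mass Ve \<eta> = 0"
      then have "AE x in lebesgue. Ve x * (\<eta> x)\<^sup>2 = 0"
        unfolding weighted_mass_def using integral_nonneg_eq_0_iff_AE[OF Pi] Ve0 by simp
      then have "AE x in lebesgue. x \<notin> E"
      proof (rule eventually_mono)
        fix x assume z: "Ve x * (\<eta> x)\<^sup>2 = 0"
        show "x \<notin> E"
        proof
          assume x: "x \<in> E"
          then have "w0 \<le> Ve x" "e0 \<le> \<eta> x" using E(4,7) e0(2) by auto
          then have "Ve x > 0" "\<eta> x > 0" using E(3) e0(1) by linarith+
          then show False using z by simp
        qed
      qed
      then have "E \<in> null_sets lebesgue" using E(5) by (subst (asm) AE_iff_null_sets[symmetric]) auto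
      then show False using E(5,6) by (auto simp: null_sets_def measure_def)
    qed
    then show ?thesis using weighted_mass_nonneg[of Ve \<eta>, OF Ve0] by simp
  qed
  define S where "S = {b. hardy_ineq \<Omega> l V b}"
  define gap where "gap u = energy \<Omega> l u - hardy_term \<Omega> u" for u
  have S: "b * weighted_mass Ve u \<le> gap u" if "b \<in> S" "u \<in> test_functions \<Omega>" for b u
    using that pot[OF that(2)] by (auto simp: S_def hardy_ineq_def gap_def algebra_simps)
  have bdd: "bdd_above S"
  proof (rule bdd_aboveI)
    fix b assume "b \<in> S"
    then show "b \<le> gap \<eta> / weighted_mass Ve \<eta>" using S[OF _ \<eta>] P\<eta> by (simp add: pos_le_divide_eq)
  qed
  have CS: "C \<in> S" using lC by (simp add: S_def)
  define b where "b = Sup S"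
  have ub: "b' \<le> b" if "b' \<in> S" for b' unfolding b_def by (rule cSup_upper[OF that bdd])
  have "hardy_ineq \<Omega> l V b"
    unfolding hardy_ineq_def
  proof
    fix u assume u: "u \<in> test_functions \<Omega>"
    have "b * weighted_mass Ve u \<le> gap u"
    proof (cases "weighted_mass Ve u = 0")
      case True
      then show ?thesis using S[OF CS u] by simp
    next
      case False
      then have pu: "weighted_mass Ve u > 0" using weighted_mass_nonneg[of Ve u, OF Ve0] by simp
      have "b \<le> gap u / weighted_mass Ve u"
        unfolding b_def
      proof (rule cSup_least)
        show "S \<noteq> {}" using CS by blast
        show "b' \<le> gap u / weighted_mass Ve u" if "b' \<in> S" for b'
          using S[OF that u] pu by (simp add: pos_le_divide_eq)
      qed
      then show ?thesis using pu by (simp add: pos_le_divide_eq)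
    qed
    then show "energy \<Omega> l u \<ge> hardy_term \<Omega> u + b * potential_term \<Omega> V u"
      by (simp add: pot[OF u] gap_def)
  qed
  then have "best_hardy_constant \<Omega> l V b"
    using ub by (simp add: best_hardy_constant_def S_def)
  moreover have "b > 0" using ub[OF CS] lC(2) by simp
  ultimately show ?thesis using that lC(1) by blast
qed

theorem theorem11:
  fixes \<Omega> :: "'a::euclidean_space set" and V :: "'a \<Rightarrow> real" and \<mu> :: real
  assumes "DIM('a) \<ge> 3"
    and "open \<Omega>" and "connected \<Omega>" and "bounded \<Omega>"
    and "0 \<in> frontier \<Omega>"
    and "interior_ball_at_0 \<Omega>" and "exterior_ball_at_0 \<Omega>"
    and "admissible \<Omega> V" and "\<not> ae_zero_on \<Omega> V"
    and "\<mu> \<ge> 0"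
  shows "(\<forall>l b. l \<ge> 0 \<and> b > 0 \<and> best_hardy_constant \<Omega> l V b \<and> ereal b < C_zero \<Omega> \<mu> V
            \<longrightarrow> maximal_potential \<Omega> l V b)
       \<and> (subcritical \<Omega> \<mu> V \<longrightarrow>
            (\<exists>l b. l \<ge> 0 \<and> b > 0 \<and> best_hardy_constant \<Omega> l V b \<and> maximal_potential \<Omega> l V b))"
proof -
  have maximal: "maximal_potential \<Omega> l V b"
    if "l \<ge> 0" "b > 0" "best_hardy_constant \<Omega> l V b" "ereal b < C_zero \<Omega> \<mu> V" for l b
    by (rule best_constant_maximal[OF assms(1-5,7,8,10) that])
  obtain l b where lb: "l \<ge> 0" "b > 0" "best_hardy_constant \<Omega> l V b"
    by (rule best_constant_exists[OF assms(1,2,4,5,8,9)])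
  have "maximal_potential \<Omega> l V b" if "subcritical \<Omega> \<mu> V"
    by (rule maximal[OF lb]) (use that in \<open>simp add: subcritical_def\<close>)
  with lb maximal show ?thesis by blast
qed

end
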